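(* Let $\Sigma=(X,\sigma)$ be a topological dynamical system and let $\tilde\pi=\pi\times u$ be a Hilbert space representation of $C^*(\Sigma)$. Let $\{x_\alpha\}_\alpha$ be a family of aperiodic points of $X$ and $\{(y_\beta,t_\gamma)\}_{\beta,\gamma}$ a family of pairs, each consisting of a periodic point $y_\beta\in X$ and a parameter $t_\gamma\in\mathbb{T}$, such that $\ker(\tilde\pi)$ is the intersection of all the kernels $\ker(\tilde\pi_{x_\alpha})$ and $\ker(\tilde\pi_{y_\beta,t_\gamma})$. (i) $C(X)'=\{a\in C^*(\Sigma) : \operatorname{supp}(a(n))\subseteq \operatorname{Per}^n(\sigma)\text{ for all } n\in\mathbb{Z}\}$. Consequently, $C(X)'=C(X)$ if and only if $\Sigma$ is topologically free. (ii) $\pi(C(X))'$ consists of all elements $\tilde\pi(a)$, $a\in C^*(\Sigma)$, such that $\tilde\pi_{x_\alpha}(a)\in\pi_{x_\alpha}(C(X))$ for every point $x_\alpha$ in the family $\{x_\alpha\}_\alpha$ and $\tilde\pi_{y_\beta,t_\gamma}(a)\in\pi_{y_\beta,t_\gamma}(C(X))$ for every pair $(y_\beta,t_\gamma)$ in the family $\{(y_\beta,t_\gamma)\}_{\beta,\gamma}$.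
   Context: A topological dynamical system $\Sigma=(X,\sigma)$ consists of a compact Hausdorff space $X$ and a homeomorphism $\sigma$ of $X$. $C^*(\Sigma)=C(X)\rtimes_\alpha\mathbb{Z}$ is the $C^*$-crossed product for the automorphism $\alpha(f)=f\circ\sigma^{-1}$ of $C(X)$; it is generated by a copy of $C(X)$ and a canonical unitary $\delta$ with $\delta f\delta^*=\alpha(f)$. $E:C^*(\Sigma)\to C(X)$ is the canonical faithful projection of norm one, with $E(\sum_n f_n\delta^n)=f_0$ on finite sums; for $a\in C^*(\Sigma)$ and $j\in\mathbb{Z}$, $a(j)=E(a\delta^{-j})\in C(X)$ is the $j$-th generalized Fourier coefficient. For an integer $n$, $\operatorname{Per}^n(\sigma)=\{x\in X:\sigma^n(x)=x\}$ (so $\operatorname{Per}^0(\sigma)=X$). A point is periodic if it lies in $\operatorname{Per}^n(\sigma)$ for some $n\ge 1$, and aperiodic otherwise. $\Sigma$ is topologically free if the set of aperiodic points is dense in $X$. $\operatorname{supp}$ denotes the (closed) support. A Hilbert space representation $\tilde\pi=\pi\times u$ of $C^*(\Sigma)$ is a unital $*$-homomorphism $\tilde\pi$ into the bounded operators on a Hilbert space; $\pi$ is its restriction to $C(X)$ and $u=\tilde\pi(\delta)$. The commutants are taken inside the respective algebras: $C(X)'=\{a\in C^*(\Sigma): af=fa\text{ for all }f\in C(X)\}$ and $\pi(C(X))'=\{\tilde\pi(a)\in\tilde\pi(C^*(\Sigma)): \tilde\pi(af)=\tilde\pi(fa)\text{ for all }f\in C(X)\}$. For aperiodic $x$, $\tilde\pi_x$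 is the representation of $C^*(\Sigma)$ on $\ell^2(\mathbb{Z})$ (standard basis $\{e_i\}_{i\in\mathbb{Z}}$) with $\tilde\pi_x(f)e_i=f(\sigma^i(x))e_i$ and $\tilde\pi_x(\delta)e_i=e_{i+1}$. For $y$ periodic with least period $p$ and $t\in\mathbb{T}$ (the unit circle), $\tilde\pi_{y,t}$ is the representation on $\mathbb{C}^p$ (standard basis $e_0,\dots,e_{p-1}$) with $\tilde\pi_{y,t}(f)e_i=f(\sigma^i(y))e_i$, $\tilde\pi_{y,t}(\delta)e_j=e_{j+1}$ for $0\le j\le p-2$ and $\tilde\pi_{y,t}(\delta)e_{p-1}=t\,e_0$. Their restrictions to $C(X)$ are denoted $\pi_x$, $\pi_{y,t}$. It is a known fact that every closed ideal of $C^*(\Sigma)$ is the intersection of kernels of a family of representations of these two kinds, so families as in the claim exist for every $\tilde\pi$. *)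

theory Defs
  imports "HOL-Analysis.Analysis"
begin

section \<open>Complex Hilbert spaces and unital C*-algebras\<close>

class scaleC =
  fixes scaleC :: "complex \<Rightarrow> 'a \<Rightarrow> 'a" (infixr "*\<^sub>C" 75)

class complex_vector = real_vector + scaleC +
  assumes scaleC_add_right: "c *\<^sub>C (x + y) = c *\<^sub>C x + c *\<^sub>C y"
    and scaleC_add_left: "(c + d) *\<^sub>C x = c *\<^sub>C x + d *\<^sub>C x"
    and scaleC_scaleC: "c *\<^sub>C d *\<^sub>C x = (c * d) *\<^sub>C x"
    and scaleC_of_real: "complex_of_real r *\<^sub>C x = r *\<^sub>R x"

class complex_normed_vector = complex_vector + real_normed_vector +
  assumes norm_scaleC: "norm (c *\<^sub>C x) = cmod c * norm x"

text \<open>The inner product is linear in its first argument.\<close>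

class complex_hilbert_space = complex_normed_vector + banach +
  fixes cinner :: "'a \<Rightarrow> 'a \<Rightarrow> complex"
  assumes cinner_commute: "cinner x y = cnj (cinner y x)"
    and cinner_add_left: "cinner (x + y) z = cinner x z + cinner y z"
    and cinner_scaleC_left: "cinner (c *\<^sub>C x) y = c * cinner x y"
    and cinner_self: "cinner x x = complex_of_real ((norm x)\<^sup>2)"

class unital_cstar_algebra = complex_normed_vector + real_normed_algebra_1 + banach +
  fixes star :: "'a \<Rightarrow> 'a"
  assumes scaleC_mult_left: "(c *\<^sub>C a) * b = c *\<^sub>C (a * b)"
    and scaleC_mult_right: "a * (c *\<^sub>C b) = c *\<^sub>C (a * b)"
    and star_add: "star (a + b) = star a + star b"
    and star_scaleC: "star (c *\<^sub>C a) = cnj c *\<^sub>C star a"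
    and star_mult: "star (a * b) = star b * star a"
    and star_star: "star (star a) = a"
    and cstar_identity: "norm (star a * a) = (norm a)\<^sup>2"


section \<open>The Hilbert space of square-summable families\<close>

typedef 'i ell2 = "{f :: 'i \<Rightarrow> complex. (\<lambda>i. (cmod (f i))\<^sup>2) summable_on UNIV}"
  morphisms coord Abs_ell2
  by (rule exI[of _ "\<lambda>_. 0"]) simp

setup_lifting type_definition_ell2

lemma coord_summable: "(\<lambda>i. (cmod (coord x i))\<^sup>2) summable_on UNIV"
  using coord[of x] by simp

lemma sq_summable_iff_bounded:
  "(\<lambda>i. (cmod (f i))\<^sup>2) summable_on UNIV \<longleftrightarrow> (\<exists>K. \<forall>F. finite F \<longrightarrow> (\<Sum>i\<in>F. (cmod (f i))\<^sup>2) \<le> K)"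
proof
  assume "(\<lambda>i. (cmod (f i))\<^sup>2) summable_on UNIV"
  then show "\<exists>K. \<forall>F. finite F \<longrightarrow> (\<Sum>i\<in>F. (cmod (f i))\<^sup>2) \<le> K"
    by (intro exI[of _ "\<Sum>\<^sub>\<infinity>i. (cmod (f i))\<^sup>2"]) (auto intro!: finite_sum_le_infsum)
next
  assume "\<exists>K. \<forall>F. finite F \<longrightarrow> (\<Sum>i\<in>F. (cmod (f i))\<^sup>2) \<le> K"
  then obtain K where "\<And>F. finite F \<Longrightarrow> (\<Sum>i\<in>F. (cmod (f i))\<^sup>2) \<le> K" by blast
  then show "(\<lambda>i. (cmod (f i))\<^sup>2) summable_on UNIV"
    by (intro nonneg_bdd_above_summable_on) (auto simp: bdd_above_def)
qed

lemma L2_set_le_infsum: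
  assumes "(\<lambda>i. (cmod (f i))\<^sup>2) summable_on UNIV" "finite F"
  shows "L2_set (\<lambda>i. cmod (f i)) F \<le> sqrt (\<Sum>\<^sub>\<infinity>i. (cmod (f i))\<^sup>2)"
  unfolding L2_set_def
  by (rule real_sqrt_le_mono, rule finite_sum_le_infsum[OF assms]) simp_all

lemma sum_sq_add_le:
  assumes "(\<lambda>i. (cmod (f i))\<^sup>2) summable_on UNIV" "(\<lambda>i. (cmod (g i))\<^sup>2) summable_on UNIV" "finite F"
  shows "(\<Sum>i\<in>F. (cmod (f i + g i))\<^sup>2)
    \<le> (sqrt (\<Sum>\<^sub>\<infinity>i. (cmod (f i))\<^sup>2) + sqrt (\<Sum>\<^sub>\<infinity>i. (cmod (g i))\<^sup>2))\<^sup>2"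
proof -
  have "L2_set (\<lambda>i. cmod (f i + g i)) F \<le> L2_set (\<lambda>i. cmod (f i) + cmod (g i)) F"
    by (rule L2_set_mono) (auto simp: norm_triangle_ineq)
  also have "\<dots> \<le> L2_set (\<lambda>i. cmod (f i)) F + L2_set (\<lambda>i. cmod (g i)) F"
    by (rule L2_set_triangle_ineq)
  also have "\<dots> \<le> sqrt (\<Sum>\<^sub>\<infinity>i. (cmod (f i))\<^sup>2) + sqrt (\<Sum>\<^sub>\<infinity>i. (cmod (g i))\<^sup>2)"
    using assms by (intro add_mono L2_set_le_infsum)
  finally have "L2_set (\<lambda>i. cmod (f i + g i)) F
    \<le> sqrt (\<Sum>\<^sub>\<infinity>i. (cmod (f i))\<^sup>2) + sqrt (\<Sum>\<^sub>\<infinity>i. (cmod (g i))\<^sup>2)" .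
  from power_mono[OF this L2_set_nonneg, of 2] show ?thesis
    by (simp add: L2_set_def sum_nonneg)
qed

lemma sq_summable_add:
  assumes "(\<lambda>i. (cmod (f i))\<^sup>2) summable_on UNIV" "(\<lambda>i. (cmod (g i))\<^sup>2) summable_on UNIV"
  shows "(\<lambda>i. (cmod (f i + g i))\<^sup>2) summable_on UNIV"
  unfolding sq_summable_iff_bounded[of "\<lambda>i. f i + g i"]
  by (rule exI, rule allI, rule impI, rule sum_sq_add_le[OF assms])

instantiation ell2 :: (type) complex_vector
begin

lift_definition zero_ell2 :: "'a ell2" is "\<lambda>_. 0" by simp

lift_definition plus_ell2 :: "'a ell2 \<Rightarrow> 'a ell2 \<Rightarrow> 'a ell2" is "\<lambda>f g i. f i + g i"
  by (rule sq_summable_add)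

lift_definition scaleC_ell2 :: "complex \<Rightarrow> 'a ell2 \<Rightarrow> 'a ell2" is "\<lambda>c f i. c * f i"
  by (auto simp: norm_mult power_mult_distrib intro!: summable_on_cmult_right)

definition "scaleR_ell2 (r::real) (x::'a ell2) = complex_of_real r *\<^sub>C x"

definition "uminus_ell2 (x::'a ell2) = (-1) *\<^sub>C x"

definition "minus_ell2 (x::'a ell2) (y::'a ell2) = x + (- y)"

instance
proof
  fix x y z :: "'a ell2" and r s :: real and c d :: complex
  show "x + y + z = x + (y + z)" by transfer (simp add: add.assoc)
  show "x + y = y + x" by transfer (simp add: add.commute)
  show "0 + x = x" by transfer simp
  show "- x + x = 0" unfolding uminus_ell2_def by transfer simp
  show "x - y = x + - y" by (simp add: minus_ell2_def)
  show "r *\<^sub>R (x + y) = r *\<^sub>R x + r *\<^sub>R y"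
    unfolding scaleR_ell2_def by transfer (simp add: algebra_simps)
  show "(r + s) *\<^sub>R x = r *\<^sub>R x + s *\<^sub>R x"
    unfolding scaleR_ell2_def by transfer (simp add: algebra_simps)
  show "r *\<^sub>R s *\<^sub>R x = (r * s) *\<^sub>R x"
    unfolding scaleR_ell2_def by transfer (simp add: algebra_simps)
  show "1 *\<^sub>R x = x"
    unfolding scaleR_ell2_def by transfer simp
  show "c *\<^sub>C (x + y) = c *\<^sub>C x + c *\<^sub>C y" by transfer (simp add: algebra_simps)
  show "(c + d) *\<^sub>C x = c *\<^sub>C x + d *\<^sub>C x" by transfer (simp add: algebra_simps)
  show "c *\<^sub>C d *\<^sub>C x = (c * d) *\<^sub>C x" by transfer (simp add: algebra_simps)
  show "complex_of_real r *\<^sub>C x = r *\<^sub>R x" by (simp add: scaleR_ell2_def)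
qed

end

lemma coord_zero [simp]: "coord 0 i = 0" by transfer simp
lemma coord_add [simp]: "coord (x + y) i = coord x i + coord y i" by transfer simp
lemma coord_scaleC [simp]: "coord (c *\<^sub>C x) i = c * coord x i" by transfer simp
lemma coord_uminus [simp]: "coord (- x) i = - coord x i" unfolding uminus_ell2_def by simp
lemma coord_diff [simp]: "coord (x - y) i = coord x i - coord y i" by (simp add: diff_conv_add_uminus del: add_uminus_conv_diff)
lemma coord_eqI: "(\<And>i. coord x i = coord y i) \<Longrightarrow> x = y" by transfer auto

instantiation ell2 :: (type) complex_normed_vector
begin

definition "norm_ell2 (x::'a ell2) = sqrt (\<Sum>\<^sub>\<infinity>i. (cmod (coord x i))\<^sup>2)"
definition "sgn_ell2 (x::'a ell2) = x /\<^sub>R norm x"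
definition "dist_ell2 (x::'a ell2) y = norm (x - y)"
definition [code del]:
  "(uniformity :: ('a ell2 \<times> 'a ell2) filter) = (INF e\<in>{0<..}. principal {(x, y). dist x y < e})"
definition [code del]:
  "open (U :: 'a ell2 set) = (\<forall>x\<in>U. eventually (\<lambda>(x', y). x' = x \<longrightarrow> y \<in> U) uniformity)"

instance
proof
  fix x y :: "'a ell2" and r :: real and c :: complex and U :: "'a ell2 set"
  show "dist x y = norm (x - y)" by (rule dist_ell2_def)
  show "sgn x = x /\<^sub>R norm x" by (rule sgn_ell2_def)
  show "(uniformity :: ('a ell2 \<times> 'a ell2) filter) = (INF e\<in>{0<..}. principal {(x, y). dist x y < e})"
    by (rule uniformity_ell2_def)
  show "open U = (\<forall>x\<in>U. \<forall>\<^sub>F (x', y) in uniformity. x' = x \<longrightarrow> y \<in> U)"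
    by (rule open_ell2_def)
  show normC: "norm (c *\<^sub>C x) = cmod c * norm x" for c
    by (simp add: norm_ell2_def norm_mult power_mult_distrib infsum_cmult_right' real_sqrt_mult)
  show "norm (r *\<^sub>R x) = \<bar>r\<bar> * norm x"
    unfolding scaleR_ell2_def normC by simp
  show "norm x = 0 \<longleftrightarrow> x = 0"
  proof
    assume "norm x = 0"
    then have 0: "(\<Sum>\<^sub>\<infinity>i. (cmod (coord x i))\<^sup>2) = 0" by (simp add: norm_ell2_def)
    have "(cmod (coord x i))\<^sup>2 \<le> 0" for i
      using finite_sum_le_infsum[OF coord_summable, of "{i}" x] 0 by simp
    then show "x = 0" by (intro coord_eqI) simp
  qed (simp add: norm_ell2_def)
  show "norm (x + y) \<le> norm x + norm y"
  proof -
    have "(\<Sum>\<^sub>\<infinity>i. (cmod (coord (x + y) i))\<^sup>2) \<le> (norm x + norm y)\<^sup>2"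
      unfolding norm_ell2_def
      by (rule infsum_le_finite_sums[OF coord_summable])
        (simp add: sum_sq_add_le[OF coord_summable coord_summable])
    moreover have "0 \<le> norm x + norm y" by (simp add: norm_ell2_def infsum_nonneg)
    ultimately show ?thesis
      unfolding norm_ell2_def[of "x + y"] by (rule real_le_lsqrt[rotated])
  qed
qed

end

lemma sum_coord_le_norm: "finite F \<Longrightarrow> (\<Sum>i\<in>F. (cmod (coord x i))\<^sup>2) \<le> (norm x)\<^sup>2"
proof -
  have "(norm x)\<^sup>2 = (\<Sum>\<^sub>\<infinity>i. (cmod (coord x i))\<^sup>2)"
    unfolding norm_ell2_def by (rule real_sqrt_pow2) (simp add: infsum_nonneg)
  then show "finite F \<Longrightarrow> (\<Sum>i\<in>F. (cmod (coord x i))\<^sup>2) \<le> (norm x)\<^sup>2"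
    using finite_sum_le_infsum[OF coord_summable, of F x] by simp
qed

lemma norm_ell2_le:
  assumes "0 \<le> K" "\<And>F. finite F \<Longrightarrow> (\<Sum>i\<in>F. (cmod (coord x i))\<^sup>2) \<le> K\<^sup>2"
  shows "norm x \<le> K"
  unfolding norm_ell2_def
  by (rule real_le_lsqrt[OF assms(1) infsum_le_finite_sums[OF coord_summable assms(2)]])

lemma coord_le_norm: "cmod (coord x i) \<le> norm x"
proof (rule power2_le_imp_le)
  show "(cmod (coord x i))\<^sup>2 \<le> (norm x)\<^sup>2"
    using sum_coord_le_norm[of "{i}" x] by simp
qed (rule norm_ge_zero)

instance ell2 :: (type) banach
proof
  fix X :: "nat \<Rightarrow> 'a ell2"
  assume X: "Cauchy X"
  have "Cauchy (\<lambda>n. coord (X n) i)" for i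
  proof (rule CauchyI)
    fix e :: real assume "0 < e"
    then obtain M where M: "\<And>m n. M \<le> m \<Longrightarrow> M \<le> n \<Longrightarrow> norm (X m - X n) < e"
      using CauchyD[OF X] by blast
    have "cmod (coord (X m) i - coord (X n) i) < e" if "M \<le> m" "M \<le> n" for m n
      using coord_le_norm[of "X m - X n" i] M[OF that] by simp
    then show "\<exists>M. \<forall>m\<ge>M. \<forall>n\<ge>M. cmod (coord (X m) i - coord (X n) i) < e" by blast
  qed
  then have "\<exists>l. (\<lambda>n. coord (X n) i) \<longlonglongrightarrow> l" for i
    using Cauchy_convergent convergent_def by blast
  then obtain f where f: "\<And>i. (\<lambda>n. coord (X n) i) \<longlonglongrightarrow> f i" by metis
  have key: "\<exists>M. \<forall>n\<ge>M. \<forall>F. finite F \<longrightarrow> (\<Sum>i\<in>F. (cmod (coord (X n) i - f i))\<^sup>2) \<le> e\<^sup>2"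
    if e: "0 < e" for e
  proof -
    obtain M where M: "\<And>m n. M \<le> m \<Longrightarrow> M \<le> n \<Longrightarrow> norm (X m - X n) < e"
      using CauchyD[OF X e] by blast
    have "(\<Sum>i\<in>F. (cmod (coord (X n) i - f i))\<^sup>2) \<le> e\<^sup>2" if n: "M \<le> n" and F: "finite F" for n F
    proof (rule LIMSEQ_le_const2)
      show "(\<lambda>m. \<Sum>i\<in>F. (cmod (coord (X n) i - coord (X m) i))\<^sup>2)
        \<longlonglongrightarrow> (\<Sum>i\<in>F. (cmod (coord (X n) i - f i))\<^sup>2)"
        by (intro tendsto_intros f)
      have "(\<Sum>i\<in>F. (cmod (coord (X n) i - coord (X m) i))\<^sup>2) \<le> e\<^sup>2" if "M \<le> m" for m
      proof -
        have "(\<Sum>i\<in>F. (cmod (coord (X n) i - coord (X m) i))\<^sup>2) \<le> (norm (X n - X m))\<^sup>2"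
          using sum_coord_le_norm[OF F, of "X n - X m"] by simp
        also have "\<dots> \<le> e\<^sup>2" using M[OF n that] by (intro power_mono) auto
        finally show ?thesis .
      qed
      then show "\<exists>N. \<forall>m\<ge>N. (\<Sum>i\<in>F. (cmod (coord (X n) i - coord (X m) i))\<^sup>2) \<le> e\<^sup>2" by blast
    qed
    then show ?thesis by blast
  qed
  obtain M where M: "\<And>F. finite F \<Longrightarrow> (\<Sum>i\<in>F. (cmod (coord (X M) i - f i))\<^sup>2) \<le> 1"
    using key[of 1] by auto
  have diff: "(\<lambda>i. (cmod (f i - coord (X M) i))\<^sup>2) summable_on UNIV"
    unfolding sq_summable_iff_bounded using M by (auto simp: norm_minus_commute)
  have "(\<lambda>i. (cmod (coord (X M) i + (f i - coord (X M) i)))\<^sup>2) summable_on UNIV"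
    by (rule sq_summable_add[OF coord_summable diff])
  then have f2: "(\<lambda>i. (cmod (f i))\<^sup>2) summable_on UNIV" by simp
  define x where "x = Abs_ell2 f"
  have x: "coord x i = f i" for i using f2 by (simp add: x_def Abs_ell2_inverse)
  have "X \<longlonglongrightarrow> x"
  proof (rule LIMSEQ_I)
    fix r :: real assume "0 < r"
    then obtain N where N: "\<And>n F. N \<le> n \<Longrightarrow> finite F \<Longrightarrow>
        (\<Sum>i\<in>F. (cmod (coord (X n) i - f i))\<^sup>2) \<le> (r/2)\<^sup>2"
      using key[of "r/2"] by auto
    have "norm (X n - x) \<le> r/2" if "N \<le> n" for n
      using N[OF that] \<open>0 < r\<close> by (intro norm_ell2_le) (auto simp: x)
    then show "\<exists>N. \<forall>n\<ge>N. norm (X n - x) < r" using \<open>0 < r\<close> by force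
  qed
  then show "convergent X" by (rule convergentI)
qed

lemma ell2_prod_summable: "(\<lambda>i. coord x i * cnj (coord y i)) summable_on UNIV"
proof (rule abs_summable_summable[OF Infinite_Sum.abs_summable_on_comparison_test'])
  show "(\<lambda>i. (cmod (coord x i))\<^sup>2 + (cmod (coord y i))\<^sup>2) summable_on UNIV"
    by (rule summable_on_add[OF coord_summable coord_summable])
  fix i
  have "2 * (cmod (coord x i) * cmod (coord y i)) \<le> (cmod (coord x i))\<^sup>2 + (cmod (coord y i))\<^sup>2"
    using sum_squares_bound[of "cmod (coord x i)" "cmod (coord y i)"] by (simp only: mult.assoc)
  moreover have "0 \<le> cmod (coord x i) * cmod (coord y i)"
    by (rule mult_nonneg_nonneg) (rule norm_ge_zero)+
  ultimately show "cmod (coord x i * cnj (coord y i)) \<le> (cmod (coord x i))\<^sup>2 + (cmod (coord y i))\<^sup>2"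
    unfolding norm_mult complex_mod_cnj by linarith
qed

instantiation ell2 :: (type) complex_hilbert_space
begin

definition "cinner_ell2 (x::'a ell2) y = (\<Sum>\<^sub>\<infinity>i. coord x i * cnj (coord y i))"

instance
proof
  fix x y z :: "'a ell2" and c :: complex
  show "cinner x y = cnj (cinner y x)"
    unfolding cinner_ell2_def infsum_cnj[symmetric] by (simp add: mult.commute)
  show "cinner (x + y) z = cinner x z + cinner y z"
    unfolding cinner_ell2_def coord_add distrib_right
    by (rule infsum_add[OF ell2_prod_summable ell2_prod_summable])
  show "cinner (c *\<^sub>C x) y = c * cinner x y"
    unfolding cinner_ell2_def coord_scaleC mult.assoc by (rule infsum_cmult_right')
  have "cinner x x = (\<Sum>\<^sub>\<infinity>i. complex_of_real ((cmod (coord x i))\<^sup>2))"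
    unfolding cinner_ell2_def complex_norm_square ..
  also have "\<dots> = complex_of_real (\<Sum>\<^sub>\<infinity>i. (cmod (coord x i))\<^sup>2)"
    by (rule infsumI, rule has_sum_of_real, rule has_sum_infsum[OF coord_summable])
  finally show "cinner x x = complex_of_real ((norm x)\<^sup>2)"
    by (simp only: norm_ell2_def real_sqrt_pow2 infsum_nonneg zero_le_power2)
qed

end

lift_definition ell2_basis :: "'i \<Rightarrow> 'i ell2" is "\<lambda>i j. if j = i then 1 else 0"
proof -
  fix i :: 'i
  have "(\<Sum>j\<in>F. (cmod (if j = i then 1 else 0))\<^sup>2) \<le> 1" if "finite F" for F
    using that by (simp add: if_distrib[of cmod] if_distrib[of "\<lambda>r. r\<^sup>2"] sum.delta cong: if_cong)
  then show "(\<lambda>j. (cmod (if j = i then 1 else 0))\<^sup>2) summable_on UNIV"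
    unfolding sq_summable_iff_bounded by blast
qed

text \<open>\<open>\<complex>\<^sup>p\<close> is realised inside \<open>\<ell>\<^sup>2(\<int>)\<close> as the span of \<open>e\<^sub>0, \<dots>, e\<^bsub>p-1\<^esub>\<close>: its dimension depends
  on a point of the dynamical system, so it cannot be a type.\<close>

definition fin_hilbert :: "nat \<Rightarrow> int ell2 set" where
  "fin_hilbert p = {v. \<forall>i. i \<notin> {0..<int p} \<longrightarrow> coord v i = 0}"


section \<open>Hilbert space representations\<close>

text \<open>The Hilbert space is a closed subspace \<open>H\<close> of a type. A bounded operator on \<open>H\<close> is a function on
  the whole type which vanishes outside \<open>H\<close>, so that equality of operators is equality of functions.\<close>

definition closed_csubspace :: "'h::complex_hilbert_space set \<Rightarrow> bool" where
  "closed_csubspace H \<longleftrightarrow> closed H \<and> 0 \<in> H \<and> (\<forall>v\<in>H. \<forall>w\<in>H. v + w \<in> H) \<and> (\<forall>c. \<forall>v\<in>H. c *\<^sub>C v \<in> H)"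

definition bounded_ops :: "'h::complex_hilbert_space set \<Rightarrow> ('h \<Rightarrow> 'h) set" where
  "bounded_ops H = {T. (\<forall>v\<in>H. T v \<in> H) \<and> (\<forall>v. v \<notin> H \<longrightarrow> T v = 0)
     \<and> (\<forall>v\<in>H. \<forall>w\<in>H. T (v + w) = T v + T w)
     \<and> (\<forall>c. \<forall>v\<in>H. T (c *\<^sub>C v) = c *\<^sub>C T v)
     \<and> (\<exists>K. \<forall>v\<in>H. norm (T v) \<le> K * norm v)}"

definition hilbert_rep ::
  "'h::complex_hilbert_space set \<Rightarrow> ('a::unital_cstar_algebra \<Rightarrow> 'h \<Rightarrow> 'h) \<Rightarrow> bool" where
  "hilbert_rep H \<rho> \<longleftrightarrow> closed_csubspace H
     \<and> (\<forall>a. \<rho> a \<in> bounded_ops H)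
     \<and> (\<forall>a b. \<forall>v\<in>H. \<rho> (a + b) v = \<rho> a v + \<rho> b v)
     \<and> (\<forall>c a. \<forall>v\<in>H. \<rho> (c *\<^sub>C a) v = c *\<^sub>C \<rho> a v)
     \<and> (\<forall>a b. \<forall>v\<in>H. \<rho> (a * b) v = \<rho> a (\<rho> b v))
     \<and> (\<forall>v\<in>H. \<rho> 1 v = v)
     \<and> (\<forall>a. \<forall>v\<in>H. \<forall>w\<in>H. cinner (\<rho> (star a) v) w = cinner v (\<rho> a w))"

definition rep_kernel :: "('a \<Rightarrow> 'h \<Rightarrow> 'h::zero) \<Rightarrow> 'a set" where
  "rep_kernel \<rho> = {a. \<rho> a = (\<lambda>_. 0)}"


section \<open>Topological dynamical systems\<close>

definition top_dyn_system :: "('x::t2_space \<Rightarrow> 'x) \<Rightarrow> bool" where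
  "top_dyn_system \<sigma> \<longleftrightarrow> compact (UNIV :: 'x set) \<and> homeomorphism UNIV UNIV \<sigma> (inv \<sigma>)"

definition iter_int :: "('x \<Rightarrow> 'x) \<Rightarrow> int \<Rightarrow> 'x \<Rightarrow> 'x" where
  "iter_int \<sigma> n = (if 0 \<le> n then \<sigma> ^^ nat n else inv \<sigma> ^^ nat (- n))"

definition Per :: "('x \<Rightarrow> 'x) \<Rightarrow> int \<Rightarrow> 'x set" where
  "Per \<sigma> n = {x. iter_int \<sigma> n x = x}"

definition periodic :: "('x \<Rightarrow> 'x) \<Rightarrow> 'x \<Rightarrow> bool" where
  "periodic \<sigma> x \<longleftrightarrow> (\<exists>n\<ge>1. x \<in> Per \<sigma> n)"

definition least_period :: "('x \<Rightarrow> 'x) \<Rightarrow> 'x \<Rightarrow> nat" where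
  "least_period \<sigma> x = (LEAST p. 1 \<le> p \<and> x \<in> Per \<sigma> (int p))"

definition topologically_free :: "('x::topological_space \<Rightarrow> 'x) \<Rightarrow> bool" where
  "topologically_free \<sigma> \<longleftrightarrow> closure {x. \<not> periodic \<sigma> x} = UNIV"

definition supp :: "('x::topological_space \<Rightarrow> complex) \<Rightarrow> 'x set" where
  "supp f = closure {x. f x \<noteq> 0}"

definition CX :: "('x::topological_space \<Rightarrow> complex) set" where
  "CX = {f. continuous_on UNIV f}"


section \<open>The crossed product\<close>

text \<open>A family \<open>a :: int \<Rightarrow> 'x \<Rightarrow> complex\<close> in \<open>fin_fams\<close> stands for the formal finite sum
  \<open>\<Sum>n. a n \<delta>\<^sup>n\<close>. Product and involution of the skew-polynomial *-algebra are dictated by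
  \<open>\<delta>\<^sup>k f \<delta>\<^sup>*\<^sup>k = f \<circ> \<sigma>\<^sup>-\<^sup>k\<close>.\<close>

definition fin_fams :: "(int \<Rightarrow> 'x::topological_space \<Rightarrow> complex) set" where
  "fin_fams = {a. (\<forall>n. a n \<in> CX) \<and> finite {n. a n \<noteq> (\<lambda>_. 0)}}"

definition fam_mult :: "('x \<Rightarrow> 'x) \<Rightarrow> (int \<Rightarrow> 'x \<Rightarrow> complex) \<Rightarrow> (int \<Rightarrow> 'x \<Rightarrow> complex) \<Rightarrow> int \<Rightarrow> 'x \<Rightarrow> complex" where
  "fam_mult \<sigma> a b = (\<lambda>n x. \<Sum>k | a k \<noteq> (\<lambda>_. 0). a k x * b (n - k) (iter_int \<sigma> (- k) x))"

definition fam_star :: "('x \<Rightarrow> 'x) \<Rightarrow> (int \<Rightarrow> 'x \<Rightarrow> complex) \<Rightarrow> int \<Rightarrow> 'x \<Rightarrow> complex" where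
  "fam_star \<sigma> a = (\<lambda>n x. cnj (a (- n) (iter_int \<sigma> (- n) x)))"

definition cstar_seminorm ::
  "('x::topological_space \<Rightarrow> 'x) \<Rightarrow> ((int \<Rightarrow> 'x \<Rightarrow> complex) \<Rightarrow> real) \<Rightarrow> bool" where
  "cstar_seminorm \<sigma> q \<longleftrightarrow>
     (\<forall>a\<in>fin_fams. 0 \<le> q a)
     \<and> (\<forall>a\<in>fin_fams. \<forall>b\<in>fin_fams. q (\<lambda>n x. a n x + b n x) \<le> q a + q b)
     \<and> (\<forall>c. \<forall>a\<in>fin_fams. q (\<lambda>n x. c * a n x) = cmod c * q a)
     \<and> (\<forall>a\<in>fin_fams. \<forall>b\<in>fin_fams. q (fam_mult \<sigma> a b) \<le> q a * q b)
     \<and> (\<forall>a\<in>fin_fams. q (fam_mult \<sigma> (fam_star \<sigma> a) a) = (q a)\<^sup>2)"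

definition unitary_pow :: "'a::unital_cstar_algebra \<Rightarrow> int \<Rightarrow> 'a" where
  "unitary_pow u n = (if 0 \<le> n then u ^ nat n else star u ^ nat (- n))"

definition fin_sum ::
  "(('x \<Rightarrow> complex) \<Rightarrow> 'a) \<Rightarrow> 'a \<Rightarrow> (int \<Rightarrow> 'x \<Rightarrow> complex) \<Rightarrow> 'a::unital_cstar_algebra" where
  "fin_sum \<iota> \<delta> a = (\<Sum>n | a n \<noteq> (\<lambda>_. 0). \<iota> (a n) * unitary_pow \<delta> n)"

text \<open>The C*-algebra \<open>'a\<close>, together with \<open>\<iota>\<close> (the copy of \<open>C(X)\<close>) and \<open>\<delta>\<close>, is the crossed product
  \<open>C(X) \<rtimes> \<int>\<close>: the enveloping C*-algebra of the *-algebra of finite sums, that is, its completion in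
  the largest C*-seminorm. Since \<open>fin_sum \<iota> \<delta>\<close> is a *-homomorphism, the norm of \<open>'a\<close> restricts to a
  C*-seminorm on finite sums, and the last conjunct says that it is the largest one. (By the GNS
  construction, this is the supremum of the norms in all covariant representations.)\<close>

definition crossed_product ::
  "('x::t2_space \<Rightarrow> 'x) \<Rightarrow> (('x \<Rightarrow> complex) \<Rightarrow> 'a) \<Rightarrow> 'a::unital_cstar_algebra \<Rightarrow> bool" where
  "crossed_product \<sigma> \<iota> \<delta> \<longleftrightarrow> top_dyn_system \<sigma>
     \<and> (\<forall>f\<in>CX. \<forall>g\<in>CX. \<iota> (\<lambda>x. f x + g x) = \<iota> f + \<iota> g)
     \<and> (\<forall>c. \<forall>f\<in>CX. \<iota> (\<lambda>x. c * f x) = c *\<^sub>C \<iota> f)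
     \<and> (\<forall>f\<in>CX. \<forall>g\<in>CX. \<iota> (\<lambda>x. f x * g x) = \<iota> f * \<iota> g)
     \<and> (\<forall>f\<in>CX. \<iota> (\<lambda>x. cnj (f x)) = star (\<iota> f))
     \<and> \<iota> (\<lambda>_. 1) = 1
     \<and> star \<delta> * \<delta> = 1 \<and> \<delta> * star \<delta> = 1
     \<and> (\<forall>f\<in>CX. \<delta> * \<iota> f * star \<delta> = \<iota> (f \<circ> inv \<sigma>))
     \<and> closure (fin_sum \<iota> \<delta> ` fin_fams) = UNIV
     \<and> (\<forall>q. cstar_seminorm \<sigma> q \<longrightarrow> (\<forall>a\<in>fin_fams. q a \<le> norm (fin_sum \<iota> \<delta> a)))"

text \<open>The canonical projection \<open>E\<close> onto \<open>C(X)\<close>, with values regarded as functions on \<open>X\<close>.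
  It is determined by its values on finite sums and contractivity.\<close>

definition cond_exp ::
  "(('x::topological_space \<Rightarrow> complex) \<Rightarrow> 'a) \<Rightarrow> 'a \<Rightarrow> 'a::unital_cstar_algebra \<Rightarrow> 'x \<Rightarrow> complex" where
  "cond_exp \<iota> \<delta> = (THE E. (\<forall>a. E a \<in> CX)
     \<and> (\<forall>a b x. E (a + b) x = E a x + E b x)
     \<and> (\<forall>c a x. E (c *\<^sub>C a) x = c * E a x)
     \<and> (\<forall>a x. cmod (E a x) \<le> norm a)
     \<and> (\<forall>a\<in>fin_fams. E (fin_sum \<iota> \<delta> a) = a 0))"

definition fourier ::
  "(('x::topological_space \<Rightarrow> complex) \<Rightarrow> 'a) \<Rightarrow> 'a \<Rightarrow> 'a::unital_cstar_algebra \<Rightarrow> int \<Rightarrow> 'x \<Rightarrow> complex" where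
  "fourier \<iota> \<delta> a j = cond_exp \<iota> \<delta> (a * unitary_pow \<delta> (- j))"

definition CX_commutant ::
  "(('x::topological_space \<Rightarrow> complex) \<Rightarrow> 'a::unital_cstar_algebra) \<Rightarrow> 'a set" where
  "CX_commutant \<iota> = {a. \<forall>f\<in>CX. a * \<iota> f = \<iota> f * a}"

definition rep_commutant ::
  "(('x::topological_space \<Rightarrow> complex) \<Rightarrow> 'a::unital_cstar_algebra) \<Rightarrow> ('a \<Rightarrow> 'h \<Rightarrow> 'h) \<Rightarrow> ('h \<Rightarrow> 'h) set" where
  "rep_commutant \<iota> \<rho> = {\<rho> a | a. \<forall>f\<in>CX. \<rho> (a * \<iota> f) = \<rho> (\<iota> f * a)}"

text \<open>The representations attached to an aperiodic point \<open>x\<close>, and to a periodic point \<open>y\<close> together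
  with \<open>t\<close> on the unit circle; they are determined by their values on the generators.\<close>

definition aperiodic_rep ::
  "('x::topological_space \<Rightarrow> 'x) \<Rightarrow> (('x \<Rightarrow> complex) \<Rightarrow> 'a) \<Rightarrow> 'a \<Rightarrow> 'x
    \<Rightarrow> 'a::unital_cstar_algebra \<Rightarrow> int ell2 \<Rightarrow> int ell2" where
  "aperiodic_rep \<sigma> \<iota> \<delta> x = (THE \<rho>. hilbert_rep UNIV \<rho>
     \<and> (\<forall>f\<in>CX. \<forall>i. \<rho> (\<iota> f) (ell2_basis i) = f (iter_int \<sigma> i x) *\<^sub>C ell2_basis i)
     \<and> (\<forall>i. \<rho> \<delta> (ell2_basis i) = ell2_basis (i + 1)))"

definition periodic_rep ::
  "('x::topological_space \<Rightarrow> 'x) \<Rightarrow> (('x \<Rightarrow> complex) \<Rightarrow> 'a) \<Rightarrow> 'a \<Rightarrow> 'x \<Rightarrow> complex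
    \<Rightarrow> 'a::unital_cstar_algebra \<Rightarrow> int ell2 \<Rightarrow> int ell2" where
  "periodic_rep \<sigma> \<iota> \<delta> y t = (let p = int (least_period \<sigma> y) in
     THE \<rho>. hilbert_rep (fin_hilbert (least_period \<sigma> y)) \<rho>
     \<and> (\<forall>f\<in>CX. \<forall>i\<in>{0..p - 1}. \<rho> (\<iota> f) (ell2_basis i) = f (iter_int \<sigma> i y) *\<^sub>C ell2_basis i)
     \<and> (\<forall>j\<in>{0..p - 2}. \<rho> \<delta> (ell2_basis j) = ell2_basis (j + 1))
     \<and> \<rho> \<delta> (ell2_basis (p - 1)) = t *\<^sub>C ell2_basis 0)"

end

theory Submission
  imports Defs
begin

text \<open>
  Everything rests on the maximality of the norm of \<open>C\<^sup>*(\<Sigma>)\<close>. Any covariant assignment of monomials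
  \<open>f \<delta>\<^sup>n\<close> to elements of a space satisfying the C*-identity induces a C*-seminorm on finite sums
  (\<open>norm_total_cstar_seminorm\<close>), so it is contractive and extends to \<open>C\<^sup>*(\<Sigma>)\<close>. Applied to operators on
  \<open>\<ell>\<^sup>2(\<int>)\<close> this yields the representations along the orbits; their matrix entry at \<open>e\<^sub>0\<close>
  gives the canonical projection \<open>E\<close>, hence the Fourier coefficients. That the orbit representations are
  determined by their values on generators follows because representations are contractive
  (\<open>contractive\<close>). For the gauge action \<open>\<delta> \<mapsto> t \<delta>\<close> on the crossed product, maximality of the norm
  shows that Fejer means are contractive, and from this that an element is determined by its Fourier
  coefficients (\<open>fourier_zero_imp_zero\<close>).

  Part (i) is then a comparison of coefficients: \<open>(a f)(n) = a(n) (f \<circ> \<sigma>\<^sup>-\<^sup>n)\<close> and \<open>(f a)(n) = f a(n)\<close> agree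
  for all \<open>f\<close> exactly if \<open>a(n)\<close> vanishes off \<open>Per\<^sup>n(\<sigma>)\<close>. The criterion for \<open>C(X)' = C(X)\<close> follows, by Baire's
  theorem in one direction.

  For part (ii), \<open>\<pi>(a f) = \<pi>(f a)\<close> means that \<open>a f - f a\<close> lies in the kernel of each of the given orbit
  representations, that is, that the operator of \<open>a\<close> there commutes with all operators of functions. These are
  diagonal and separate the basis vectors, so the operator of \<open>a\<close> is diagonal. On an infinite orbit its
  diagonal is given by the continuous function \<open>E(a)\<close>, on a finite orbit by some continuous function because finitely
  many values can be interpolated; either way the operator is that of a function
  (\<open>aperiodic_commute_iff\<close>, \<open>periodic_commute_iff\<close>).
\<close>

section \<open>Complex Hilbert spaces and C*-algebras\<close>

lemma scaleC_zero_left [simp]: "0 *\<^sub>C (x::'a::complex_vector) = 0"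
  using scaleC_of_real[of 0 x] by simp

lemma scaleC_minus_one: "(-1) *\<^sub>C (x::'a::complex_vector) = - x"
  using scaleC_of_real[of "-1" x] by simp

lemma scaleC_one [simp]: "1 *\<^sub>C (x::'a::complex_vector) = x"
  using scaleC_of_real[of "1" x] by simp

lemma scaleC_zero_right [simp]: "c *\<^sub>C (0::'a::complex_vector) = 0"
  using scaleC_add_right[of c 0 0] by simp

lemma scaleC_sum_right: "c *\<^sub>C (\<Sum>i\<in>S. f i) = (\<Sum>i\<in>S. c *\<^sub>C (f i :: 'b::complex_vector))"
  by (induction S rule: infinite_finite_induct) (simp_all add: scaleC_add_right)

lemma scaleC_sum_left: "(\<Sum>i\<in>S. c i) *\<^sub>C x = (\<Sum>i\<in>S. c i *\<^sub>C (x :: 'b::complex_vector))"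
  by (induction S rule: infinite_finite_induct) (simp_all add: scaleC_add_left)

lemma cinner_add_right: "cinner x (y + z) = cinner x y + cinner x z"
  by (subst (1 2 3) cinner_commute) (simp add: cinner_add_left)

lemma cinner_scaleC_right: "cinner x (c *\<^sub>C y) = cnj c * cinner x y"
  by (subst (1 2) cinner_commute) (simp add: cinner_scaleC_left)

lemma cinner_minus_left: "cinner (- x) y = - cinner x y"
  using cinner_scaleC_left[of "-1" x y] by (simp add: scaleC_minus_one)

lemma cinner_minus_right: "cinner x (- y) = - cinner x y"
  using cinner_scaleC_right[of x "-1" y] by (simp add: scaleC_minus_one)

lemma cinner_diff_left: "cinner (x - y) z = cinner x z - cinner y z"
  using cinner_add_left[of x "- y" z] by (simp add: cinner_minus_left)

lemma cinner_diff_right: "cinner x (y - z) = cinner x y - cinner x z"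
  using cinner_add_right[of x y "- z"] by (simp add: cinner_minus_right)

lemma cinner_zero_right [simp]: "cinner x 0 = 0"
  using cinner_diff_right[of x 0 0] by simp

lemma cinner_zero_left [simp]: "cinner 0 x = 0"
  using cinner_diff_left[of 0 0 x] by simp

lemma Cauchy_Schwarz_complex:
  fixes x y :: "'h::complex_hilbert_space"
  shows "cmod (cinner x y) \<le> norm x * norm y"
proof (cases "y = 0")
  case False
  define N c z where "N = (norm y)\<^sup>2" and "c = cinner x y"
    and "z = complex_of_real N *\<^sub>C x - c *\<^sub>C y"
  have N: "N > 0" using False by (simp add: N_def)
  have yx: "cinner y x = cnj c" unfolding c_def by (rule cinner_commute)
  have "complex_of_real ((norm z)\<^sup>2) = cinner z z" by (simp add: cinner_self)
  also have "\<dots> = N * N * cinner x x - N * cnj c * c - N * c * cnj c + c * cnj c * cinner y y"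
    unfolding z_def cinner_diff_left cinner_diff_right cinner_scaleC_left cinner_scaleC_right
    by (simp add: c_def[symmetric] yx algebra_simps)
  also have "\<dots> = complex_of_real (N * (N * (norm x)\<^sup>2 - (cmod c)\<^sup>2))"
    by (simp add: cinner_self N_def[symmetric] algebra_simps flip: complex_norm_square)
  finally have "(norm z)\<^sup>2 = N * (N * (norm x)\<^sup>2 - (cmod c)\<^sup>2)"
    using of_real_eq_iff by blast
  then have "0 \<le> N * (N * (norm x)\<^sup>2 - (cmod c)\<^sup>2)" by (metis zero_le_power2)
  then have "(cmod c)\<^sup>2 \<le> N * (norm x)\<^sup>2" using N by (simp add: zero_le_mult_iff)
  then have "(cmod c)\<^sup>2 \<le> (norm x * norm y)\<^sup>2" by (simp add: N_def power_mult_distrib mult.commute)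
  then show ?thesis unfolding c_def by (rule power2_le_imp_le) simp
qed simp

lemma tendsto_cinner:
  fixes f g :: "'i \<Rightarrow> 'h::complex_hilbert_space"
  assumes "(f \<longlongrightarrow> x) F" "(g \<longlongrightarrow> y) F"
  shows "((\<lambda>i. cinner (f i) (g i)) \<longlongrightarrow> cinner x y) F"
proof -
  have "bounded_bilinear (cinner :: 'h \<Rightarrow> 'h \<Rightarrow> complex)"
  proof
    fix a a' b b' :: 'h and r :: real
    show "cinner (a + a') b = cinner a b + cinner a' b" by (rule cinner_add_left)
    show "cinner a (b + b') = cinner a b + cinner a b'" by (rule cinner_add_right)
    show "cinner (r *\<^sub>R a) b = r *\<^sub>R cinner a b"
      by (simp add: cinner_scaleC_left scaleR_conv_of_real flip: scaleC_of_real)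
    show "cinner a (r *\<^sub>R b) = r *\<^sub>R cinner a b"
      by (simp add: cinner_scaleC_right scaleR_conv_of_real flip: scaleC_of_real)
    show "\<exists>K. \<forall>(a::'h) b. norm (cinner a b) \<le> norm a * norm b * K"
      by (intro exI[of _ 1]) (simp add: Cauchy_Schwarz_complex)
  qed
  then show ?thesis using assms by (rule bounded_bilinear.tendsto)
qed

lemma norm_star [simp]: "norm (star a) = norm (a::'a::unital_cstar_algebra)"
proof -
  have "norm a \<le> norm (star a)" for a :: 'a
  proof (cases "a = 0")
    case False
    have "norm a * norm a \<le> norm (star a) * norm a"
      using norm_mult_ineq[of "star a" a] by (simp add: cstar_identity power2_eq_square)
    then show ?thesis using False by simp
  qed simp
  from this[of a] this[of "star a"] show ?thesis by (simp add: star_star)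
qed

lemma star_zero [simp]: "star (0::'a::unital_cstar_algebra) = 0"
  using star_scaleC[of 0 0] by simp

lemma star_one [simp]: "star (1::'a::unital_cstar_algebra) = 1"
  using star_mult[of "star (1::'a)" 1] by (simp add: star_star)

lemma star_power: "star (a ^ n) = star (a::'a::unital_cstar_algebra) ^ n"
  by (induction n) (simp_all add: star_mult power_commutes)

section \<open>Representations are contractive\<close>

text \<open>The Neumann series.\<close>

lemma left_inverse_of_norm_less_one:
  fixes x :: "'a::{real_normed_algebra_1,banach}"
  assumes "norm x < 1"
  obtains d where "d * (1 - x) = 1"
proof
  have s: "summable (\<lambda>n. x ^ n)" by (rule complete_algebra_summable_geometric[OF assms])
  have "(\<Sum>n. x ^ n) * x = (\<Sum>n. x ^ Suc n)"
    using suminf_mult2[OF s, of x] by (simp add: power_commutes)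
  also have "\<dots> = (\<Sum>n. x ^ n) - 1" using suminf_split_head[OF s] by simp
  finally show "(\<Sum>n. x ^ n) * (1 - x) = 1" by (simp add: right_diff_distrib)
qed

lemma mem_rep_kernel: "a \<in> rep_kernel \<rho> \<longleftrightarrow> (\<forall>v. \<rho> a v = 0)"
  by (auto simp: rep_kernel_def)

locale hilbert_representation =
  fixes H :: "'h::complex_hilbert_space set" and \<rho> :: "'a::unital_cstar_algebra \<Rightarrow> 'h \<Rightarrow> 'h"
  assumes rep: "hilbert_rep H \<rho>"
begin

lemma sub: "closed_csubspace H" using rep by (simp add: hilbert_rep_def)

lemma in_H [simp]: "v \<in> H \<Longrightarrow> \<rho> a v \<in> H"
  and out_H: "v \<notin> H \<Longrightarrow> \<rho> a v = 0"
  and add_v: "v \<in> H \<Longrightarrow> w \<in> H \<Longrightarrow> \<rho> a (v + w) = \<rho> a v + \<rho> a w"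
  and scaleC_v: "v \<in> H \<Longrightarrow> \<rho> a (c *\<^sub>C v) = c *\<^sub>C \<rho> a v"
  using rep by (auto simp: hilbert_rep_def bounded_ops_def)

lemma bounded: "\<exists>K. \<forall>v\<in>H. norm (\<rho> a v) \<le> K * norm v"
  using rep by (auto simp: hilbert_rep_def bounded_ops_def)

lemma zero_H [simp]: "0 \<in> H" and add_H: "v \<in> H \<Longrightarrow> w \<in> H \<Longrightarrow> v + w \<in> H"
  and scaleC_H: "v \<in> H \<Longrightarrow> c *\<^sub>C v \<in> H"
  using sub by (auto simp: closed_csubspace_def)

lemma diff_H: "v \<in> H \<Longrightarrow> w \<in> H \<Longrightarrow> v - w \<in> H"
  using add_H[of v "(-1) *\<^sub>C w"] scaleC_H[of w "-1"] by (simp add: scaleC_minus_one)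

lemma add_a: "\<rho> (a + b) v = \<rho> a v + \<rho> b v"
  using rep out_H by (cases "v \<in> H") (auto simp: hilbert_rep_def)

lemma scaleC_a: "\<rho> (c *\<^sub>C a) v = c *\<^sub>C \<rho> a v"
  using rep out_H by (cases "v \<in> H") (auto simp: hilbert_rep_def)

lemma zero_v [simp]: "\<rho> a 0 = 0"
  using scaleC_v[of 0 a 0] by simp

lemma mult_a: "\<rho> (a * b) v = \<rho> a (\<rho> b v)"
  using rep out_H by (cases "v \<in> H") (auto simp: hilbert_rep_def)

lemma one_a: "v \<in> H \<Longrightarrow> \<rho> 1 v = v"
  using rep by (auto simp: hilbert_rep_def)

lemma star_a: "v \<in> H \<Longrightarrow> w \<in> H \<Longrightarrow> cinner (\<rho> (star a) v) w = cinner v (\<rho> a w)"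
  using rep by (auto simp: hilbert_rep_def)

lemma minus_a: "\<rho> (- a) v = - \<rho> a v"
  using scaleC_a[of "-1" a v] by (simp add: scaleC_minus_one)

lemma diff_a: "\<rho> (a - b) v = \<rho> a v - \<rho> b v"
  using add_a[of a "- b" v] by (simp add: minus_a)

lemma zero_a [simp]: "\<rho> 0 v = 0"
  using diff_a[of 0 0 v] by simp

lemma sum_a: "\<rho> (\<Sum>i\<in>S. f i) v = (\<Sum>i\<in>S. \<rho> (f i) v)"
  by (induction S rule: infinite_finite_induct) (simp_all add: add_a)

text \<open>A $*$-homomorphism is automatically contractive: if the norm \<open>M\<close> of \<open>\<rho> a\<close> were larger than
  that of \<open>a\<close>, then \<open>M\<^sup>2 - a\<^sup>* a\<close> would be invertible by the Neumann series, so that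
  \<open>M\<^sup>2 - \<rho>(a)\<^sup>*\<rho>(a)\<close> would be bounded below; but \<open>M\<^sup>2\<close> is an approximate eigenvalue of
  \<open>\<rho>(a)\<^sup>*\<rho>(a)\<close>.\<close>

lemma contractive: "norm (\<rho> a v) \<le> norm a * norm v"
proof (cases "v \<in> H")
  case True
  define B where "B = {K. 0 \<le> K \<and> (\<forall>v\<in>H. norm (\<rho> a v) \<le> K * norm v)}"
  define M where "M = Inf B"
  obtain K0 where K0: "\<forall>v\<in>H. norm (\<rho> a v) \<le> K0 * norm v" using bounded by blast
  have "norm (\<rho> a v) \<le> max 0 K0 * norm v" if "v \<in> H" for v
    using K0 that mult_right_mono[of K0 "max 0 K0" "norm v"] by fastforce
  then have ne: "B \<noteq> {}" unfolding B_def by (auto intro!: exI[of _ "max 0 K0"])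
  have bdd: "bdd_below B" unfolding B_def by (rule bdd_belowI[of _ 0]) auto
  have M0: "0 \<le> M" unfolding M_def by (rule cInf_greatest[OF ne]) (auto simp: B_def)
  have Mle: "norm (\<rho> a v) \<le> M * norm v" if v: "v \<in> H" for v
  proof (cases "v = 0")
    case False
    have "norm (\<rho> a v) / norm v \<le> M"
      unfolding M_def
    proof (rule cInf_greatest[OF ne])
      fix K assume "K \<in> B"
      then show "norm (\<rho> a v) / norm v \<le> K" using v False by (simp add: B_def pos_divide_le_eq)
    qed
    then show ?thesis using False by (simp add: pos_divide_le_eq)
  qed simp
  have "M \<le> norm a"
  proof (rule ccontr)
    assume "\<not> M \<le> norm a"
    then have gt: "norm a < M" by simp
    then have Mp: "0 < M" using norm_ge_zero[of a] by linarith
    define x where "x = (1 / M\<^sup>2) *\<^sub>R (star a * a)"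
    have "norm x = (norm a)\<^sup>2 / M\<^sup>2" using Mp by (simp add: x_def cstar_identity)
    also have "\<dots> < 1" using Mp gt by (simp add: power_strict_mono)
    finally obtain d where d: "d * (1 - x) = 1" by (rule left_inverse_of_norm_less_one)
    obtain D0 where D0: "\<forall>v\<in>H. norm (\<rho> d v) \<le> D0 * norm v" using bounded by blast
    define D where "D = max D0 1"
    have D: "D \<ge> 1" "norm (\<rho> d v) \<le> D * norm v" if "v \<in> H" for v
      using D0 that mult_right_mono[of D0 "max D0 1" "norm v"] unfolding D_def by fastforce+
    have adj: "norm (\<rho> (star a) w) \<le> M * norm w" if w: "w \<in> H" for w
    proof (cases "\<rho> (star a) w = 0")
      case False
      have "complex_of_real ((norm (\<rho> (star a) w))\<^sup>2) = cinner w (\<rho> a (\<rho> (star a) w))"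
        using star_a[OF w in_H[OF w, of "star a"], of a] by (simp only: cinner_self)
      then have "(norm (\<rho> (star a) w))\<^sup>2 = cmod (cinner w (\<rho> a (\<rho> (star a) w)))"
        by (metis abs_of_nonneg norm_of_real zero_le_power2)
      also have "\<dots> \<le> norm w * (M * norm (\<rho> (star a) w))"
        using Cauchy_Schwarz_complex Mle[of "\<rho> (star a) w"] w
        by (meson in_H mult_left_mono norm_ge_zero order_trans)
      finally show ?thesis using False by (simp add: power2_eq_square algebra_simps)
    qed (use Mp in simp)
    \<comment> \<open>\<open>D\<close> bounds the inverse of \<open>1 - \<rho>(a)\<^sup>*\<rho>(a) / M\<^sup>2\<close>, so that operator is bounded below; expanding the square
      of its norm at \<open>v\<close> turns this into a gap between \<open>norm (\<rho> a v)\<close> and \<open>M * norm v\<close>.\<close>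
    have key: "(norm v)\<^sup>2 \<le> D\<^sup>2 * 2 * ((norm v)\<^sup>2 - (norm (\<rho> a v))\<^sup>2 / M\<^sup>2)" if v: "v \<in> H" for v
    proof -
      define w where "w = \<rho> (star a) (\<rho> a v)"
      have "norm w \<le> M * (M * norm v)"
        unfolding w_def using adj[of "\<rho> a v"] Mle[OF v] v Mp
        by (meson in_H mult_left_mono order_trans less_imp_le)
      then have "(norm w)\<^sup>2 \<le> (M * (M * norm v))\<^sup>2" by (rule power_mono) simp
      then have nw: "(norm w)\<^sup>2 \<le> M ^ 4 * (norm v)\<^sup>2"
        by (simp add: power_mult_distrib power4_eq_xxxx power2_eq_square mult_ac)
      have wv: "cinner w v = complex_of_real ((norm (\<rho> a v))\<^sup>2)"
        unfolding w_def using v by (simp add: star_a cinner_self)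
      have vw: "cinner v w = complex_of_real ((norm (\<rho> a v))\<^sup>2)"
        by (subst cinner_commute) (simp add: wv)
      have "\<rho> (1 - x) v = v - complex_of_real (1 / M\<^sup>2) *\<^sub>C w"
        unfolding x_def w_def using v by (simp add: diff_a one_a scaleC_a mult_a flip: scaleC_of_real)
      then have "complex_of_real ((norm (\<rho> (1 - x) v))\<^sup>2)
          = complex_of_real ((norm v)\<^sup>2 - 2 * (norm (\<rho> a v))\<^sup>2 / M\<^sup>2 + (norm w)\<^sup>2 / M ^ 4)"
        by (simp add: cinner_self[symmetric] cinner_diff_left cinner_diff_right cinner_scaleC_left
            cinner_scaleC_right wv vw flip: of_real_mult of_real_diff of_real_add of_real_power)
          (use Mp in \<open>simp add: cinner_self field_simps power4_eq_xxxx power2_eq_square\<close>)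
      then have "(norm (\<rho> (1 - x) v))\<^sup>2 = (norm v)\<^sup>2 - 2 * (norm (\<rho> a v))\<^sup>2 / M\<^sup>2 + (norm w)\<^sup>2 / M ^ 4"
        using of_real_eq_iff by blast
      also have "(norm w)\<^sup>2 / M ^ 4 \<le> (norm v)\<^sup>2" using nw Mp by (simp add: pos_divide_le_eq mult.commute)
      finally have n1: "(norm (\<rho> (1 - x) v))\<^sup>2 \<le> 2 * ((norm v)\<^sup>2 - (norm (\<rho> a v))\<^sup>2 / M\<^sup>2)" by simp
      have "norm v = norm (\<rho> d (\<rho> (1 - x) v))" using v by (simp add: d one_a flip: mult_a)
      also have "\<dots> \<le> D * norm (\<rho> (1 - x) v)" using D v by simp
      finally have "(norm v)\<^sup>2 \<le> (D * norm (\<rho> (1 - x) v))\<^sup>2" by (rule power_mono) simp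
      also have "\<dots> = D\<^sup>2 * (norm (\<rho> (1 - x) v))\<^sup>2" by (simp add: power_mult_distrib)
      also have "\<dots> \<le> D\<^sup>2 * (2 * ((norm v)\<^sup>2 - (norm (\<rho> a v))\<^sup>2 / M\<^sup>2))"
        by (rule mult_left_mono[OF n1]) simp
      finally show ?thesis by (simp only: mult.assoc)
    qed
    have D1: "1 \<le> D" by (simp add: D_def)
    \<comment> \<open>Solving \<open>key\<close> for \<open>norm (\<rho> a v)\<close> gives a bound smaller than the least one.\<close>
    define L where "L = M * sqrt (1 - 1 / (2 * D\<^sup>2))"
    have D2: "1 \<le> D\<^sup>2" using D1 by simp
    have rng: "0 \<le> 1 - 1 / (2 * D\<^sup>2)" "1 - 1 / (2 * D\<^sup>2) < 1" using D1 by (simp_all add: divide_le_eq) (use D2 in linarith)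
    have "L \<in> B"
      unfolding B_def
    proof (intro CollectI conjI ballI)
      show L0: "0 \<le> L" using Mp rng by (simp add: L_def)
      fix v assume v: "v \<in> H"
      have "(norm (\<rho> a v))\<^sup>2 \<le> M\<^sup>2 * (1 - 1 / (2 * D\<^sup>2)) * (norm v)\<^sup>2"
        using key[OF v] D1 Mp by (simp add: field_simps)
      also have "\<dots> = (L * norm v)\<^sup>2" using rng by (simp add: L_def power_mult_distrib)
      finally show "norm (\<rho> a v) \<le> L * norm v" by (rule power2_le_imp_le) (simp add: L0)
    qed
    then have "M \<le> L" unfolding M_def using bdd by (rule cInf_lower)
    moreover have "L < M * 1" unfolding L_def
      by (rule mult_strict_left_mono[OF _ Mp]) (use rng in \<open>simp add: real_sqrt_lt_1_iff\<close>)
    ultimately show False by simp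
  qed
  then show ?thesis using Mle[OF True] mult_right_mono[of M "norm a" "norm v"] by simp
qed (simp add: out_H)

lemma eq_iff_diff_in_kernel: "\<rho> a = \<rho> b \<longleftrightarrow> a - b \<in> rep_kernel \<rho>"
  by (auto simp: mem_rep_kernel diff_a fun_eq_iff)

lemma tendsto_a:
  assumes "(f \<longlongrightarrow> a) F"
  shows "((\<lambda>i. \<rho> (f i) v) \<longlongrightarrow> \<rho> a v) F"
proof (rule Lim_null[THEN iffD2], rule Lim_null_comparison)
  show "\<forall>\<^sub>F i in F. norm (\<rho> (f i) v - \<rho> a v) \<le> norm (f i - a) * norm v"
    using contractive by (simp add: diff_a[symmetric])
  show "((\<lambda>i. norm (f i - a) * norm v) \<longlongrightarrow> 0) F"
    using assms by (intro tendsto_mult_left_zero tendsto_norm_zero) (simp add: Lim_null[symmetric])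
qed

end

section \<open>Continuous functions and periodic points\<close>

locale dynamics =
  fixes \<sigma> :: "'x::t2_space \<Rightarrow> 'x"
  assumes tds: "top_dyn_system \<sigma>"
begin

lemma compact_X: "compact (UNIV :: 'x set)"
  and homeo: "homeomorphism UNIV UNIV \<sigma> (inv \<sigma>)"
  using tds by (auto simp: top_dyn_system_def)

lemma inv_left [simp]: "inv \<sigma> (\<sigma> x) = x" and inv_right [simp]: "\<sigma> (inv \<sigma> x) = x"
  using homeo by (auto simp: homeomorphism_def)

lemma iter_0 [simp]: "iter_int \<sigma> 0 x = x" by (simp add: iter_int_def)

lemma iter_Suc: "iter_int \<sigma> (n + 1) x = \<sigma> (iter_int \<sigma> n x)"
proof (cases "0 \<le> n")
  case True
  then show ?thesis by (simp add: iter_int_def nat_add_distrib)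
next
  case False
  define k where "k = nat (- (n + 1))"
  have n: "n = - int (Suc k)" using False by (simp add: k_def)
  show ?thesis unfolding n by (cases k) (simp_all add: iter_int_def nat_add_distrib)
qed

lemma iter_1 [simp]: "iter_int \<sigma> 1 x = \<sigma> x"
  using iter_Suc[of 0 x] by simp

lemma iter_pred: "iter_int \<sigma> (n - 1) x = inv \<sigma> (iter_int \<sigma> n x)"
  using iter_Suc[of "n - 1" x] by simp

lemma iter_add: "iter_int \<sigma> (m + n) x = iter_int \<sigma> m (iter_int \<sigma> n x)"
proof (induction m rule: int_induct[of _ 0])
  case (step1 i)
  then show ?case using iter_Suc[of "i + n" x] iter_Suc[of i "iter_int \<sigma> n x"] by (simp add: ac_simps)
next
  case (step2 i)
  then show ?case using iter_pred[of "i + n" x] iter_pred[of i "iter_int \<sigma> n x"] by (simp add: algebra_simps)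
qed simp

lemma iter_cancel [simp]: "iter_int \<sigma> n (iter_int \<sigma> (- n) x) = x"
  "iter_int \<sigma> (- n) (iter_int \<sigma> n x) = x"
  by (simp_all add: iter_add[symmetric])

lemma iter_mult: "iter_int \<sigma> p x = x \<Longrightarrow> iter_int \<sigma> (k * p) x = x"
proof (induction k rule: int_induct[of _ 0])
  case (step1 i)
  then show ?case by (simp add: distrib_right iter_add)
next
  case (step2 i)
  then have "iter_int \<sigma> (- p) x = x" by (metis iter_cancel(2))
  with step2 show ?case using iter_add[of "i * p" "- p" x] by (simp add: left_diff_distrib)
qed simp

lemma continuous_iter: "continuous_on UNIV (iter_int \<sigma> n)"
proof (induction n rule: int_induct[of _ 0])
  case base
  have "iter_int \<sigma> 0 = (\<lambda>x. x)" by auto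
  then show ?case by (simp add: continuous_on_id)
next
  case (step1 i)
  have "iter_int \<sigma> (i + 1) = \<sigma> \<circ> iter_int \<sigma> i" by (auto simp: iter_Suc)
  then show ?case using step1 homeo continuous_on_compose[of UNIV "iter_int \<sigma> i" \<sigma>]
    by (auto simp: homeomorphism_def intro: continuous_on_subset)
next
  case (step2 i)
  have "iter_int \<sigma> (i - 1) = inv \<sigma> \<circ> iter_int \<sigma> i" by (auto simp: iter_pred)
  then show ?case using step2 homeo continuous_on_compose[of UNIV "iter_int \<sigma> i" "inv \<sigma>"]
    by (auto simp: homeomorphism_def intro: continuous_on_subset)
qed

lemma CX_iter: "f \<in> CX \<Longrightarrow> (\<lambda>x. f (iter_int \<sigma> n x)) \<in> CX"
  unfolding CX_def using continuous_on_compose2[OF _ continuous_iter, of UNIV f] by auto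

lemma CX_bounded:
  fixes f :: "'x \<Rightarrow> complex"
  assumes "f \<in> CX"
  shows "\<exists>K\<ge>0. \<forall>x. cmod (f x) \<le> K"
proof -
  have "compact (f ` UNIV)"
    using assms compact_X unfolding CX_def by (auto intro!: compact_continuous_image)
  then obtain K where "\<forall>y\<in>f ` UNIV. norm y \<le> K" using compact_imp_bounded bounded_iff by blast
  then have K: "cmod (f x) \<le> K" for x by blast
  then show ?thesis using order_trans[OF norm_ge_zero K] by blast
qed

lemma closed_Per: "closed (Per \<sigma> n)"
  unfolding Per_def using continuous_iter[of n] continuous_on_id by (rule closed_Collect_eq)

lemma Hausdorff_X: "Hausdorff_space (euclidean :: 'x topology)"
  unfolding Hausdorff_space_def disjnt_def by simp (metis hausdorff)

lemma normal_X: "normal_space (euclidean :: 'x topology)"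
  using compact_X Hausdorff_X
  by (intro compact_Hausdorff_or_regular_imp_normal_space) (auto simp: compact_space_def)

lemma CX_separates_closed:
  fixes C :: "'x set"
  assumes "closed C" "x \<notin> C"
  shows "\<exists>f\<in>CX. f x = 1 \<and> (\<forall>y\<in>C. f y = 0)"
proof -
  have "\<exists>g. continuous_map euclidean euclideanreal g \<and> g ` C \<subseteq> {0} \<and> g ` {x} \<subseteq> {1}"
    using normal_X[unfolded normal_space_iff_Urysohn_alt, rule_format, of C "{x}"] assms
    by (simp add: disjnt_def)
  then obtain g where g: "continuous_on UNIV g" "g ` C \<subseteq> {0}" "g x = (1::real)" by auto
  show ?thesis
    by (rule bexI[of _ "\<lambda>x. complex_of_real (g x)"])
      (use g in \<open>auto simp: CX_def intro!: continuous_intros\<close>)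
qed

lemma CX_const: "(\<lambda>_. c) \<in> CX" by (simp add: CX_def)
lemma CX_add: "f \<in> CX \<Longrightarrow> g \<in> CX \<Longrightarrow> (\<lambda>x. f x + g x) \<in> CX"
  by (simp add: CX_def continuous_on_add)
lemma CX_mult: "f \<in> CX \<Longrightarrow> g \<in> CX \<Longrightarrow> (\<lambda>x. f x * g x) \<in> CX"
  by (simp add: CX_def continuous_on_mult)
lemma CX_cnj: "f \<in> CX \<Longrightarrow> (\<lambda>x. cnj (f x)) \<in> CX"
  by (simp add: CX_def continuous_on_cnj)
lemma CX_scale: "f \<in> CX \<Longrightarrow> (\<lambda>x. c * f x) \<in> CX"
  by (intro CX_mult CX_const)
lemma CX_sum: "(\<And>i. i \<in> S \<Longrightarrow> f i \<in> CX) \<Longrightarrow> (\<lambda>x. \<Sum>i\<in>S. f i x) \<in> CX"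
  by (simp add: CX_def continuous_on_sum)

lemma CX_separates_points: "(x::'x) \<noteq> y \<Longrightarrow> \<exists>f\<in>CX. f x = 1 \<and> f y = 0"
  using CX_separates_closed[of "{y}" x] by simp

lemma CX_interpolation:
  fixes S :: "'x set"
  assumes "finite S"
  shows "\<exists>f\<in>CX. \<forall>x\<in>S. f x = c x"
proof -
  have "\<exists>f\<in>CX. f x = 1 \<and> (\<forall>y\<in>S - {x}. f y = 0)" for x
    using CX_separates_closed[of "S - {x}" x] assms by (simp add: finite_imp_closed)
  then obtain b where b: "\<And>x. b x \<in> CX" "\<And>x. b x x = 1" "\<And>x y. y \<in> S - {x} \<Longrightarrow> b x y = 0"
    by metis
  show ?thesis
  proof (intro bexI ballI)
    show "(\<lambda>y. \<Sum>x\<in>S. c x * b x y) \<in> CX" by (intro CX_sum CX_scale b)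
    fix y assume y: "y \<in> S"
    have "(\<Sum>x\<in>S. c x * b x y) = (\<Sum>x\<in>S. if x = y then c x else 0)"
      by (rule sum.cong) (use b y in auto)
    also have "\<dots> = c y" using y assms by simp
    finally show "(\<Sum>x\<in>S. c x * b x y) = c y" .
  qed
qed

text \<open>The complement of the set of aperiodic points is the countable union of the closed sets
  \<open>Per\<^sup>n(\<sigma>)\<close>, so Baire's theorem for compact Hausdorff spaces applies.\<close>

lemma not_free_interior:
  assumes "\<not> topologically_free \<sigma>"
  obtains n where "n \<ge> 1" "interior (Per \<sigma> n) \<noteq> {}"
proof -
  have "\<exists>n\<ge>1. interior (Per \<sigma> n) \<noteq> {}"
  proof (rule ccontr)
    assume *: "\<not> ?thesis"
    have "euclidean interior_of \<Union>(Per \<sigma> ` {1..}) = {}"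
    proof (rule Baire_category_alt)
      have "compact_space (euclidean :: 'x topology)" "Hausdorff_space (euclidean :: 'x topology)"
        using compact_X Hausdorff_X by (auto simp: compact_space_def)
      then show "completely_metrizable_space (euclidean :: 'x topology) \<or>
          locally_compact_space (euclidean :: 'x topology) \<and> regular_space (euclidean :: 'x topology)"
        by (simp add: compact_imp_locally_compact_space compact_Hausdorff_imp_regular_space)
      show "countable (Per \<sigma> ` {1..})" by simp
      show "closedin euclidean T \<and> euclidean interior_of T = {}" if "T \<in> Per \<sigma> ` {1..}" for T
        using that * closed_Per by auto
    qed
    then have "interior (\<Union>(Per \<sigma> ` {1..})) = {}" by simp
    moreover have "{x. \<not> periodic \<sigma> x} = - \<Union>(Per \<sigma> ` {1..})"
      by (auto simp: periodic_def)
    ultimately have "topologically_free \<sigma>"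
      by (simp only: topologically_free_def closure_complement Compl_empty_eq)
    with assms show False by simp
  qed
  then show ?thesis using that by blast
qed

lemma aperiodic_inj:
  assumes "\<not> periodic \<sigma> x" "iter_int \<sigma> i x = iter_int \<sigma> j x"
  shows "i = j"
proof (rule ccontr)
  assume ne: "i \<noteq> j"
  have *: False if "i < j" "iter_int \<sigma> i x = iter_int \<sigma> j x" for i j
  proof -
    have "iter_int \<sigma> (j - i) x = iter_int \<sigma> (- i) (iter_int \<sigma> j x)" by (simp add: iter_add[symmetric])
    also have "\<dots> = x" by (simp add: that(2)[symmetric])
    finally have "x \<in> Per \<sigma> (j - i)" by (simp add: Per_def)
    with assms(1) that(1) show False unfolding periodic_def by force
  qed
  from ne consider "i < j" | "j < i" by linarith
  then show False using * assms(2) by cases metis+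
qed

lemma least_period:
  assumes "periodic \<sigma> y"
  shows "least_period \<sigma> y \<ge> 1" "iter_int \<sigma> (int (least_period \<sigma> y)) y = y"
proof -
  obtain n where n: "n \<ge> 1" "y \<in> Per \<sigma> n" using assms by (auto simp: periodic_def)
  then have "1 \<le> nat n \<and> y \<in> Per \<sigma> (int (nat n))" by simp
  from LeastI[of "\<lambda>p. 1 \<le> p \<and> y \<in> Per \<sigma> (int p)", OF this]
  show "least_period \<sigma> y \<ge> 1" "iter_int \<sigma> (int (least_period \<sigma> y)) y = y"
    by (auto simp: least_period_def Per_def)
qed

lemma least_period_inj:
  assumes "periodic \<sigma> y"
  shows "inj_on (\<lambda>i. iter_int \<sigma> i y) {0..<int (least_period \<sigma> y)}"
proof -
  have *: False if "0 \<le> i" "i < j" "j < int (least_period \<sigma> y)" "iter_int \<sigma> i y = iter_int \<sigma> j y" for i j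
  proof -
    have "iter_int \<sigma> (j - i) y = iter_int \<sigma> (- i) (iter_int \<sigma> j y)" by (simp add: iter_add[symmetric])
    also have "\<dots> = y" by (simp add: that(4)[symmetric])
    finally have "1 \<le> nat (j - i) \<and> y \<in> Per \<sigma> (int (nat (j - i)))" using that by (simp add: Per_def)
    then have "least_period \<sigma> y \<le> nat (j - i)" unfolding least_period_def by (rule Least_le)
    then show False using that by linarith
  qed
  show ?thesis
  proof (rule inj_onI, rule ccontr)
    fix i j assume ij: "i \<in> {0..<int (least_period \<sigma> y)}" "j \<in> {0..<int (least_period \<sigma> y)}"
      "iter_int \<sigma> i y = iter_int \<sigma> j y" "i \<noteq> j"
    from \<open>i \<noteq> j\<close> consider "i < j" | "j < i" by linarith
    then show False using *[of i j] *[of j i] ij by cases auto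
  qed
qed

end

section \<open>Finite sums and their homomorphisms\<close>

definition fam_supp :: "(int \<Rightarrow> 'x \<Rightarrow> complex) \<Rightarrow> int set" where
  "fam_supp a = {n. a n \<noteq> (\<lambda>_. 0)}"

definition single :: "('x \<Rightarrow> complex) \<Rightarrow> int \<Rightarrow> int \<Rightarrow> 'x \<Rightarrow> complex" where
  "single f n = (\<lambda>k. if k = n then f else (\<lambda>_. 0))"

lemma fin_famsD: "a \<in> fin_fams \<Longrightarrow> a n \<in> CX" "a \<in> fin_fams \<Longrightarrow> finite (fam_supp a)"
  by (auto simp: fin_fams_def fam_supp_def)

lemma fin_famsI: "(\<And>n. a n \<in> CX) \<Longrightarrow> finite (fam_supp a) \<Longrightarrow> a \<in> fin_fams"
  by (auto simp: fin_fams_def fam_supp_def)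

context dynamics
begin

lemma single_fin: "f \<in> CX \<Longrightarrow> single f n \<in> fin_fams"
  by (rule fin_famsI) (auto simp: single_def fam_supp_def CX_const intro: finite_subset[of _ "{n}"])

lemma fam_add_fin:
  assumes "a \<in> fin_fams" "b \<in> fin_fams"
  shows "(\<lambda>n x. a n x + b n x) \<in> fin_fams"
proof (rule fin_famsI)
  show "finite (fam_supp (\<lambda>n x. a n x + b n x))"
    by (rule finite_subset[of _ "fam_supp a \<union> fam_supp b"])
      (use assms in \<open>auto simp: fam_supp_def fin_fams_def\<close>)
qed (use assms in \<open>auto intro: CX_add fin_famsD\<close>)

lemma fam_scale_fin:
  assumes "a \<in> fin_fams"
  shows "(\<lambda>n x. c n * a n x) \<in> fin_fams"
proof (rule fin_famsI)
  show "finite (fam_supp (\<lambda>n x. c n * a n x))"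
    by (rule finite_subset[of _ "fam_supp a"]) (use assms in \<open>auto simp: fam_supp_def fin_fams_def\<close>)
qed (use assms in \<open>auto intro: CX_scale fin_famsD\<close>)

lemma fam_star_supp: "fam_supp (fam_star \<sigma> a) \<subseteq> uminus ` fam_supp a"
proof
  fix n assume "n \<in> fam_supp (fam_star \<sigma> a)"
  then have "- n \<in> fam_supp a" by (auto simp: fam_supp_def fam_star_def)
  then show "n \<in> uminus ` fam_supp a" by force
qed

lemma fam_star_fin:
  assumes "a \<in> fin_fams"
  shows "fam_star \<sigma> a \<in> fin_fams"
proof (rule fin_famsI)
  show "finite (fam_supp (fam_star \<sigma> a))"
    by (rule finite_subset[OF fam_star_supp]) (use assms in \<open>auto intro: fin_famsD\<close>)
  show "fam_star \<sigma> a n \<in> CX" for n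
    unfolding fam_star_def by (intro CX_cnj CX_iter fin_famsD assms)
qed

lemma fam_mult_alt: "fam_mult \<sigma> a b n x = (\<Sum>k\<in>fam_supp a. a k x * b (n - k) (iter_int \<sigma> (- k) x))"
  by (simp add: fam_mult_def fam_supp_def)

lemma fam_mult_supp: "fam_supp (fam_mult \<sigma> a b) \<subseteq> (\<lambda>(k, l). k + l) ` (fam_supp a \<times> fam_supp b)"
proof
  fix n assume n: "n \<in> fam_supp (fam_mult \<sigma> a b)"
  have "\<exists>k\<in>fam_supp a. n - k \<in> fam_supp b"
  proof (rule ccontr)
    assume *: "\<not> ?thesis"
    have "b (n - k) = (\<lambda>_. 0)" if "k \<in> fam_supp a" for k
      using * that by (auto simp: fam_supp_def)
    then have "fam_mult \<sigma> a b n = (\<lambda>_. 0)" by (auto simp: fam_mult_alt)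
    with n show False by (simp add: fam_supp_def)
  qed
  then obtain k where "k \<in> fam_supp a" "n - k \<in> fam_supp b" by blast
  then show "n \<in> (\<lambda>(k, l). k + l) ` (fam_supp a \<times> fam_supp b)"
    by (auto intro!: image_eqI[of _ _ "(k, n - k)"])
qed

lemma fam_mult_fin:
  assumes "a \<in> fin_fams" "b \<in> fin_fams"
  shows "fam_mult \<sigma> a b \<in> fin_fams"
proof (rule fin_famsI)
  show "finite (fam_supp (fam_mult \<sigma> a b))"
    by (rule finite_subset[OF fam_mult_supp]) (use assms in \<open>auto intro: fin_famsD\<close>)
  show "fam_mult \<sigma> a b n \<in> CX" for n
    unfolding fam_mult_alt[abs_def] by (intro CX_sum CX_mult CX_iter fin_famsD assms)
qed

end

text \<open>The value \<open>m f n\<close> plays the role of the monomial \<open>f \<delta>\<^sup>n\<close> in some target with a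
  multiplication \<open>mlt\<close> and a relation \<open>adj S T\<close> saying that \<open>T\<close> is the adjoint of \<open>S\<close>. Two kinds of targets
  occur: the crossed product itself with its monomials multiplied by \<open>t\<^sup>n\<close>, \<open>\<bar>t\<bar> = 1\<close>, and the bounded
  operators on \<open>\<ell>\<^sup>2(\<int>)\<close>. With adjointness as a relation no
  adjoint has to be constructed. The bound on \<open>m (\<lambda>_. c) 0\<close> is what makes the norm of a total homogeneous:
  multiplying by a scalar is multiplying by a constant function.\<close>

locale covariant_monomials = dynamics \<sigma>
  for \<sigma> :: "'x::t2_space \<Rightarrow> 'x" +
  fixes m :: "('x \<Rightarrow> complex) \<Rightarrow> int \<Rightarrow> 'b::banach"
    and mlt :: "'b \<Rightarrow> 'b \<Rightarrow> 'b"
    and adj :: "'b \<Rightarrow> 'b \<Rightarrow> bool"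
  assumes m_add: "\<And>f g n. f \<in> CX \<Longrightarrow> g \<in> CX \<Longrightarrow> m (\<lambda>x. f x + g x) n = m f n + m g n"
    and m_mult: "\<And>f g n k. f \<in> CX \<Longrightarrow> g \<in> CX \<Longrightarrow>
      mlt (m f n) (m g k) = m (\<lambda>x. f x * g (iter_int \<sigma> (- n) x)) (n + k)"
    and m_adj: "\<And>f n. f \<in> CX \<Longrightarrow> adj (m f n) (m (\<lambda>x. cnj (f (iter_int \<sigma> n x))) (- n))"
    and m_const: "\<And>c. norm (m (\<lambda>_. c) 0) \<le> cmod c"
    and mlt: "bounded_bilinear mlt"
    and norm_mlt: "\<And>S T. norm (mlt S T) \<le> norm S * norm T"
    and adj_add: "\<And>S T S' T'. adj S T \<Longrightarrow> adj S' T' \<Longrightarrow> adj (S + S') (T + T')"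
    and adj_zero: "adj 0 0"
    and norm_adj: "\<And>S T. adj S T \<Longrightarrow> norm (mlt T S) = (norm S)\<^sup>2"
begin

definition total :: "(int \<Rightarrow> 'x \<Rightarrow> complex) \<Rightarrow> 'b" where
  "total a = (\<Sum>n\<in>fam_supp a. m (a n) n)"

lemma m_zero [simp]: "m (\<lambda>_. 0) n = 0"
  using m_add[of "\<lambda>_. 0" "\<lambda>_. 0" n] by (simp add: CX_const)

lemma m_sum: "finite S \<Longrightarrow> (\<And>i. i \<in> S \<Longrightarrow> f i \<in> CX) \<Longrightarrow> m (\<lambda>x. \<Sum>i\<in>S. f i x) n = (\<Sum>i\<in>S. m (f i) n)"
  by (induction S rule: finite_induct) (simp_all add: m_add CX_sum)

lemma total_on: "finite F \<Longrightarrow> fam_supp a \<subseteq> F \<Longrightarrow> total a = (\<Sum>n\<in>F. m (a n) n)"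
  unfolding total_def by (rule sum.mono_neutral_left) (auto simp: fam_supp_def)

lemma total_single: "total (single f n) = m f n"
  by (subst total_on[of "{n}"]) (auto simp: single_def fam_supp_def)

lemma total_add:
  assumes "a \<in> fin_fams" "b \<in> fin_fams"
  shows "total (\<lambda>n x. a n x + b n x) = total a + total b"
proof -
  define F where "F = fam_supp a \<union> fam_supp b"
  have F: "finite F" using assms by (simp add: F_def fin_famsD)
  have "total (\<lambda>n x. a n x + b n x) = (\<Sum>n\<in>F. m (\<lambda>x. a n x + b n x) n)"
    by (rule total_on[OF F]) (auto simp: F_def fam_supp_def)
  also have "\<dots> = (\<Sum>n\<in>F. m (a n) n) + (\<Sum>n\<in>F. m (b n) n)"
    using assms by (simp add: m_add fin_famsD sum.distrib)
  also have "\<dots> = total a + total b"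
    using total_on[OF F, of a] total_on[OF F, of b] by (simp add: F_def)
  finally show ?thesis .
qed

lemma total_mult:
  assumes a: "a \<in> fin_fams" and b: "b \<in> fin_fams"
  shows "total (fam_mult \<sigma> a b) = mlt (total a) (total b)"
proof -
  interpret mlt: bounded_bilinear mlt by (rule mlt)
  define A F where "A = fam_supp a" and "F = (\<lambda>(k, l). k + l) ` (fam_supp a \<times> fam_supp b)"
  have fin: "finite A" "finite F" using a b by (simp_all add: A_def F_def fin_famsD)
  have shift: "(\<Sum>n\<in>F. m (b (n - k)) (n - k)) = total b" if "k \<in> A" for k
  proof -
    have "(\<Sum>n\<in>F. m (b (n - k)) (n - k)) = (\<Sum>l\<in>(\<lambda>n. n - k) ` F. m (b l) l)"
      by (subst sum.reindex) (auto simp: inj_on_def)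
    also have "fam_supp b \<subseteq> (\<lambda>n. n - k) ` F"
    proof
      fix l assume "l \<in> fam_supp b"
      then have "k + l \<in> F" using that unfolding F_def A_def by force
      then show "l \<in> (\<lambda>n. n - k) ` F" by (rule rev_image_eqI) simp
    qed
    then have "(\<Sum>l\<in>(\<lambda>n. n - k) ` F. m (b l) l) = total b"
      using fin by (intro total_on[symmetric]) simp_all
    finally show ?thesis .
  qed
  have "total (fam_mult \<sigma> a b) = (\<Sum>n\<in>F. m (fam_mult \<sigma> a b n) n)"
    using fam_mult_supp[of a b] fin(2) unfolding F_def by (intro total_on)
  also have "\<dots> = (\<Sum>n\<in>F. \<Sum>k\<in>A. m (\<lambda>x. a k x * b (n - k) (iter_int \<sigma> (- k) x)) n)"
    using a b fin unfolding fam_mult_alt[abs_def] A_def[symmetric]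
    by (intro sum.cong refl m_sum CX_mult CX_iter fin_famsD) auto
  also have "\<dots> = (\<Sum>n\<in>F. \<Sum>k\<in>A. mlt (m (a k) k) (m (b (n - k)) (n - k)))"
    using a b by (simp add: m_mult fin_famsD)
  also have "\<dots> = (\<Sum>k\<in>A. mlt (m (a k) k) (\<Sum>n\<in>F. m (b (n - k)) (n - k)))"
    by (subst sum.swap) (simp add: mlt.sum_right)
  also have "\<dots> = mlt (total a) (total b)"
    by (simp add: shift mlt.sum_left[symmetric]) (simp add: total_def A_def)
  finally show ?thesis .
qed

lemma adj_sum: "finite S \<Longrightarrow> (\<And>i. i \<in> S \<Longrightarrow> adj (f i) (g i)) \<Longrightarrow> adj (\<Sum>i\<in>S. f i) (\<Sum>i\<in>S. g i)"
  by (induction S rule: finite_induct) (simp_all add: adj_add adj_zero)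

lemma total_star:
  assumes a: "a \<in> fin_fams"
  shows "adj (total a) (total (fam_star \<sigma> a))"
proof -
  have "total (fam_star \<sigma> a) = (\<Sum>n\<in>uminus ` fam_supp a. m (fam_star \<sigma> a n) n)"
    using a by (intro total_on fam_star_supp) (simp add: fin_famsD)
  also have "\<dots> = (\<Sum>n\<in>fam_supp a. m (\<lambda>x. cnj (a n (iter_int \<sigma> n x))) (- n))"
    by (subst sum.reindex) (auto simp: fam_star_def)
  finally show ?thesis
    unfolding total_def using a by (auto intro!: adj_sum m_adj simp: fin_famsD)
qed

lemma total_scale:
  assumes a: "a \<in> fin_fams"
  shows "total (\<lambda>n x. c * a n x) = mlt (m (\<lambda>_. c) 0) (total a)"
proof -
  interpret mlt: bounded_bilinear mlt by (rule mlt)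
  have "total (\<lambda>n x. c * a n x) = (\<Sum>n\<in>fam_supp a. m (\<lambda>x. c * a n x) n)"
    using a by (intro total_on fin_famsD) (auto simp: fam_supp_def)
  also have "\<dots> = (\<Sum>n\<in>fam_supp a. mlt (m (\<lambda>_. c) 0) (m (a n) n))"
    using a by (simp add: m_mult CX_const fin_famsD)
  finally show ?thesis by (simp add: total_def mlt.sum_right)
qed

text \<open>Because the norm of the target satisfies the C*-identity, pulling it back along \<open>total\<close> gives
  one of the C*-seminorms among which the crossed product takes the largest.\<close>

lemma norm_total_cstar_seminorm: "cstar_seminorm \<sigma> (\<lambda>a. norm (total a))"
proof -
  have le: "norm (total (\<lambda>n x. c * a n x)) \<le> cmod c * norm (total a)" if "a \<in> fin_fams" for c a
    unfolding total_scale[OF that]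
    by (rule order_trans[OF norm_mlt mult_right_mono[OF m_const]]) simp
  have "norm (total (\<lambda>n x. c * a n x)) = cmod c * norm (total a)" if a: "a \<in> fin_fams" for c a
  proof (cases "c = 0")
    case False
    have "norm (total a) \<le> cmod (1 / c) * norm (total (\<lambda>n x. c * a n x))"
      using le[OF fam_scale_fin[OF a], of "1 / c" "\<lambda>_. c"] False by simp
    then show ?thesis
      using le[OF a, of c] False by (simp add: norm_divide field_simps)
  qed (use le[OF a, of 0] in simp)
  moreover have "norm (total (fam_mult \<sigma> (fam_star \<sigma> a) a)) = (norm (total a))\<^sup>2" if "a \<in> fin_fams" for a
    unfolding total_mult[OF fam_star_fin[OF that] that] by (rule norm_adj[OF total_star[OF that]])
  ultimately show ?thesis
    by (simp add: cstar_seminorm_def total_add total_mult norm_mlt norm_triangle_ineq)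
qed

end

section \<open>Covariance in the crossed product\<close>

locale crossed_prod =
  fixes \<sigma> :: "'x::t2_space \<Rightarrow> 'x" and \<iota> :: "('x \<Rightarrow> complex) \<Rightarrow> 'a::unital_cstar_algebra" and \<delta> :: 'a
  assumes cp: "crossed_product \<sigma> \<iota> \<delta>"

sublocale crossed_prod \<subseteq> dynamics \<sigma>
  by unfold_locales (use cp in \<open>simp add: crossed_product_def\<close>)

context crossed_prod
begin

lemma \<iota>_add: "f \<in> CX \<Longrightarrow> g \<in> CX \<Longrightarrow> \<iota> (\<lambda>x. f x + g x) = \<iota> f + \<iota> g"
  and \<iota>_scale: "f \<in> CX \<Longrightarrow> \<iota> (\<lambda>x. c * f x) = c *\<^sub>C \<iota> f"
  and \<iota>_mult: "f \<in> CX \<Longrightarrow> g \<in> CX \<Longrightarrow> \<iota> (\<lambda>x. f x * g x) = \<iota> f * \<iota> g"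
  and \<iota>_cnj: "f \<in> CX \<Longrightarrow> \<iota> (\<lambda>x. cnj (f x)) = star (\<iota> f)"
  and \<iota>_one: "\<iota> (\<lambda>_. 1) = 1"
  and \<delta>_left: "star \<delta> * \<delta> = 1" and \<delta>_right: "\<delta> * star \<delta> = 1"
  and \<delta>_\<iota>: "f \<in> CX \<Longrightarrow> \<delta> * \<iota> f * star \<delta> = \<iota> (f \<circ> inv \<sigma>)"
  and dense: "closure (fin_sum \<iota> \<delta> ` fin_fams) = UNIV"
  and largest: "cstar_seminorm \<sigma> q \<Longrightarrow> a \<in> fin_fams \<Longrightarrow> q a \<le> norm (fin_sum \<iota> \<delta> a)"
  using cp unfolding crossed_product_def by blast+

lemma \<iota>_const: "\<iota> (\<lambda>_. c) = c *\<^sub>C 1"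
  using \<iota>_scale[of "\<lambda>_. 1" c] by (simp add: CX_const \<iota>_one)

abbreviation U :: "int \<Rightarrow> 'a" where "U \<equiv> unitary_pow \<delta>"

lemma U_0 [simp]: "U 0 = 1" and U_1 [simp]: "U 1 = \<delta>" by (simp_all add: unitary_pow_def)

lemma U_Suc: "U (n + 1) = \<delta> * U n"
proof (cases "0 \<le> n")
  case True
  then show ?thesis by (simp add: unitary_pow_def nat_add_distrib)
next
  case False
  define k where "k = nat (- (n + 1))"
  have n: "n = - int (Suc k)" using False by (simp add: k_def)
  show ?thesis unfolding n
    by (cases k) (simp_all add: unitary_pow_def nat_add_distrib \<delta>_right mult.assoc[symmetric])
qed

lemma U_pred: "U (n - 1) = star \<delta> * U n"
  using U_Suc[of "n - 1"] by (simp add: mult.assoc[symmetric] \<delta>_left)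

lemma U_add: "U (m + n) = U m * U n"
proof (induction m rule: int_induct[of _ 0])
  case (step1 i)
  then show ?case using U_Suc[of "i + n"] U_Suc[of i] by (simp add: ac_simps)
next
  case (step2 i)
  then show ?case using U_pred[of "i + n"] U_pred[of i] by (simp add: algebra_simps)
qed simp

lemma U_star: "star (U n) = U (- n)"
  by (auto simp: unitary_pow_def star_power star_star)

lemma U_\<iota>: "f \<in> CX \<Longrightarrow> U n * \<iota> f = \<iota> (\<lambda>x. f (iter_int \<sigma> (- n) x)) * U n"
proof (induction n rule: int_induct[of _ 0])
  case (step1 i)
  define g where "g = (\<lambda>x. f (iter_int \<sigma> (- i) x))"
  have g: "g \<in> CX" unfolding g_def by (rule CX_iter[OF step1.prems])
  have "\<delta> * \<iota> g = \<delta> * \<iota> g * (star \<delta> * \<delta>)" by (simp add: \<delta>_left)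
  also have "\<dots> = \<iota> (g \<circ> inv \<sigma>) * \<delta>" by (simp only: mult.assoc[symmetric] \<delta>_\<iota>[OF g])
  finally have *: "\<delta> * \<iota> g = \<iota> (g \<circ> inv \<sigma>) * \<delta>" .
  have "iter_int \<sigma> (- i - 1) x = iter_int \<sigma> (- i) (inv \<sigma> x)" for x
    using iter_add[of "- i" "-1" x] iter_pred[of 0 x] by simp
  then have gi: "g \<circ> inv \<sigma> = (\<lambda>x. f (iter_int \<sigma> (- (i + 1)) x))" by (auto simp: g_def)
  have "U (i + 1) * \<iota> f = \<delta> * (U i * \<iota> f)" by (simp add: U_Suc mult.assoc)
  also have "\<dots> = \<delta> * \<iota> g * U i" using step1 by (simp add: g_def mult.assoc)
  also have "\<dots> = \<iota> (g \<circ> inv \<sigma>) * U (i + 1)" by (simp add: * U_Suc mult.assoc)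
  finally show ?case unfolding gi .
next
  case (step2 i)
  define g h where "g = (\<lambda>x. f (iter_int \<sigma> (- i) x))" and "h = (\<lambda>x. f (iter_int \<sigma> (- (i - 1)) x))"
  have h: "h \<in> CX" unfolding h_def by (rule CX_iter[OF step2.prems])
  have "iter_int \<sigma> (- i + 1) (inv \<sigma> x) = iter_int \<sigma> (- i) x" for x
    using iter_add[of "- i + 1" "-1" x] iter_pred[of 0 x] by simp
  then have gh: "h \<circ> inv \<sigma> = g" by (auto simp: g_def h_def)
  have "star \<delta> * \<iota> g = star \<delta> * (\<delta> * \<iota> h * star \<delta>)" by (simp add: \<delta>_\<iota>[OF h] gh)
  also have "\<dots> = \<iota> h * star \<delta>" by (simp add: mult.assoc[symmetric] \<delta>_left)
  finally have *: "star \<delta> * \<iota> g = \<iota> h * star \<delta>" .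
  have "U (i - 1) * \<iota> f = star \<delta> * (U i * \<iota> f)" by (simp add: U_pred mult.assoc)
  also have "\<dots> = star \<delta> * \<iota> g * U i" using step2 by (simp add: g_def mult.assoc)
  also have "\<dots> = \<iota> h * U (i - 1)" by (simp add: * U_pred mult.assoc)
  finally show ?case unfolding h_def .
qed simp

text \<open>The covariance relation \<open>\<delta> f = (f \<circ> \<sigma>\<^sup>-\<^sup>1) \<delta>\<close> is unchanged when \<open>\<delta>\<close> is multiplied by a scalar
  of modulus one. This is the gauge action of the circle on finite sums.\<close>

lemma gauge_covariant:
  assumes t: "cmod t = 1"
  shows "covariant_monomials \<sigma> (\<lambda>f n. (t powi n) *\<^sub>C (\<iota> f * U n)) (*) (\<lambda>S T. T = star S)"
proof (intro covariant_monomials.intro covariant_monomials_axioms.intro)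
  have t0: "t \<noteq> 0" using t by auto
  fix f g :: "'x \<Rightarrow> complex" and n k :: int and c :: complex and S T S' T' :: 'a
  assume f: "f \<in> CX"
  show "t powi (- n) *\<^sub>C (\<iota> (\<lambda>x. cnj (f (iter_int \<sigma> n x))) * U (- n)) =
      star (t powi n *\<^sub>C (\<iota> f * U n))"
  proof -
    have "cnj t * t = 1" using t by (simp add: complex_norm_square[symmetric] mult.commute)
    then have "cnj t = inverse t" using t0 by (metis inverse_unique mult.commute)
    then have "cnj (t powi n) = t powi (- n)" by (simp add: power_int_minus power_int_inverse)
    then show ?thesis
      using U_\<iota>[OF CX_cnj[OF f], of "- n"] by (simp add: star_scaleC star_mult U_star \<iota>_cnj[OF f])
  qed
  assume g: "g \<in> CX"
  show "t powi n *\<^sub>C (\<iota> (\<lambda>x. f x + g x) * U n) = t powi n *\<^sub>C (\<iota> f * U n) + t powi n *\<^sub>C (\<iota> g * U n)"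
    by (simp add: \<iota>_add[OF f g] distrib_right scaleC_add_right)
  have "\<iota> f * U n * (\<iota> g * U k) = \<iota> f * (U n * \<iota> g) * U k" by (simp only: mult.assoc)
  also have "\<dots> = \<iota> (\<lambda>x. f x * g (iter_int \<sigma> (- n) x)) * U (n + k)"
    by (simp add: U_\<iota>[OF g] \<iota>_mult[OF f CX_iter[OF g]] U_add mult.assoc)
  finally show "t powi n *\<^sub>C (\<iota> f * U n) * (t powi k *\<^sub>C (\<iota> g * U k)) =
      t powi (n + k) *\<^sub>C (\<iota> (\<lambda>x. f x * g (iter_int \<sigma> (- n) x)) * U (n + k))"
    using t0 by (simp add: scaleC_mult_left scaleC_mult_right scaleC_scaleC power_int_add mult.commute)
qed (auto simp: dynamics_axioms \<iota>_const norm_scaleC bounded_bilinear_mult norm_mult_ineq star_add cstar_identity)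

end

sublocale crossed_prod \<subseteq> alg: covariant_monomials \<sigma> "\<lambda>f n. \<iota> f * unitary_pow \<delta> n" "(*)" "\<lambda>S T. T = star S"
  rewrites "alg.total = fin_sum \<iota> \<delta>"
proof -
  show *: "covariant_monomials \<sigma> (\<lambda>f n. \<iota> f * unitary_pow \<delta> n) (*) (\<lambda>S T. T = star S)"
    using gauge_covariant[of 1] by simp
  show "covariant_monomials.total (\<lambda>f n. \<iota> f * unitary_pow \<delta> n) = fin_sum \<iota> \<delta>"
    by (auto simp: covariant_monomials.total_def[OF *] fin_sum_def fam_supp_def)
qed

section \<open>Extension from finite sums to the crossed product\<close>

text \<open>Since the norm of the crossed product is the largest C*-seminorm on finite sums, the
  homomorphism \<open>total\<close> is contractive, hence extends by continuity to the whole algebra.\<close>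

locale covariant_extension =
  crossed_prod \<sigma> \<iota> \<delta> + covariant_monomials \<sigma> m mlt adj
  for \<sigma> :: "'x::t2_space \<Rightarrow> 'x" and \<iota> :: "('x \<Rightarrow> complex) \<Rightarrow> 'a::unital_cstar_algebra" and \<delta> :: 'a
    and m :: "('x \<Rightarrow> complex) \<Rightarrow> int \<Rightarrow> 'b::banach" and mlt adj

context crossed_prod
begin

lemma fin_sum_diff:
  assumes "a \<in> fin_fams" "b \<in> fin_fams"
  shows "fin_sum \<iota> \<delta> (\<lambda>n x. a n x - b n x) = fin_sum \<iota> \<delta> a - fin_sum \<iota> \<delta> b"
    and "(\<lambda>n x. a n x - b n x) \<in> fin_fams"
proof -
  have b: "(\<lambda>n x. (-1) * b n x) \<in> fin_fams" by (rule fam_scale_fin[OF assms(2)])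
  show "(\<lambda>n x. a n x - b n x) \<in> fin_fams" using fam_add_fin[OF assms(1) b] by simp
  show "fin_sum \<iota> \<delta> (\<lambda>n x. a n x - b n x) = fin_sum \<iota> \<delta> a - fin_sum \<iota> \<delta> b"
    using alg.total_add[OF assms(1) b] alg.total_scale[OF assms(2), of "-1"]
    by (simp add: \<iota>_const scaleC_minus_one)
qed

text \<open>Statements proved for finite sums are carried over to the whole algebra along such sequences.\<close>

lemma approximable: "\<exists>a. (\<forall>k. a k \<in> fin_fams) \<and> (\<lambda>k. fin_sum \<iota> \<delta> (a k)) \<longlonglongrightarrow> b"
proof -
  have "b \<in> closure (fin_sum \<iota> \<delta> ` fin_fams)" by (simp add: dense)
  then obtain s where s: "\<And>k. s k \<in> fin_sum \<iota> \<delta> ` fin_fams" "s \<longlonglongrightarrow> b"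
    unfolding closure_sequential by blast
  then have "\<forall>k. \<exists>a\<in>fin_fams. s k = fin_sum \<iota> \<delta> a" by blast
  then obtain a where a: "\<And>k. a k \<in> fin_fams" "\<And>k. s k = fin_sum \<iota> \<delta> (a k)" by metis
  then have "s = (\<lambda>k. fin_sum \<iota> \<delta> (a k))" by auto
  with s(2) a(1) show ?thesis by auto
qed

lemma dense_induct:
  assumes "\<And>a. a \<in> fin_fams \<Longrightarrow> P (fin_sum \<iota> \<delta> a)"
    and "\<And>f b. (\<And>k. P (f k)) \<Longrightarrow> f \<longlonglongrightarrow> b \<Longrightarrow> P b"
  shows "P b"
  using approximable[of b] assms by metis

end

context covariant_extension
begin

lemma norm_total_le: "a \<in> fin_fams \<Longrightarrow> norm (total a) \<le> norm (fin_sum \<iota> \<delta> a)"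
  by (rule largest[OF norm_total_cstar_seminorm])

text \<open>By \<open>extension_lim\<close> below, the value does not depend on the chosen approximating sequence.\<close>

definition extension :: "'a \<Rightarrow> 'b" where
  "extension b = lim (\<lambda>k. total ((SOME a. (\<forall>k. a k \<in> fin_fams) \<and> (\<lambda>k. fin_sum \<iota> \<delta> (a k)) \<longlonglongrightarrow> b) k))"

lemma total_diff:
  assumes "a \<in> fin_fams" "b \<in> fin_fams"
  shows "norm (total a - total b) \<le> norm (fin_sum \<iota> \<delta> a - fin_sum \<iota> \<delta> b)"
proof -
  have "total a = total (\<lambda>n x. a n x - b n x) + total b"
    using total_add[OF fin_sum_diff(2)[OF assms] assms(2)] by simp
  then show ?thesis
    using norm_total_le[OF fin_sum_diff(2)[OF assms]] by (simp add: fin_sum_diff(1)[OF assms])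
qed

lemma extension_lim:
  assumes "\<And>k. a k \<in> fin_fams" "(\<lambda>k. fin_sum \<iota> \<delta> (a k)) \<longlonglongrightarrow> b"
  shows "(\<lambda>k. total (a k)) \<longlonglongrightarrow> extension b"
proof -
  define c where "c = (SOME a. (\<forall>k. a k \<in> fin_fams) \<and> (\<lambda>k. fin_sum \<iota> \<delta> (a k)) \<longlonglongrightarrow> b)"
  have c: "\<And>k. c k \<in> fin_fams" "(\<lambda>k. fin_sum \<iota> \<delta> (c k)) \<longlonglongrightarrow> b"
    using someI_ex[OF approximable[of b]] by (simp_all add: c_def)
  have "Cauchy (\<lambda>k. total (c k))"
  proof (rule CauchyI)
    fix e :: real assume "0 < e"
    then obtain M where "\<And>i j. M \<le> i \<Longrightarrow> M \<le> j \<Longrightarrow> norm (fin_sum \<iota> \<delta> (c i) - fin_sum \<iota> \<delta> (c j)) < e"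
      using CauchyD[OF LIMSEQ_imp_Cauchy[OF c(2)]] by blast
    then show "\<exists>M. \<forall>i\<ge>M. \<forall>j\<ge>M. norm (total (c i) - total (c j)) < e"
      using total_diff[OF c(1) c(1)] by (meson le_less_trans)
  qed
  then have lim: "(\<lambda>k. total (c k)) \<longlonglongrightarrow> extension b"
    unfolding extension_def c_def[symmetric] by (simp add: Cauchy_convergent_iff convergent_LIMSEQ_iff)
  have "(\<lambda>k. fin_sum \<iota> \<delta> (a k) - fin_sum \<iota> \<delta> (c k)) \<longlonglongrightarrow> 0"
    using tendsto_diff[OF assms(2) c(2)] by simp
  then have "(\<lambda>k. norm (fin_sum \<iota> \<delta> (a k) - fin_sum \<iota> \<delta> (c k))) \<longlonglongrightarrow> 0"
    by (rule tendsto_norm_zero)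
  then have "(\<lambda>k. total (a k) - total (c k)) \<longlonglongrightarrow> 0"
    by (rule Lim_null_comparison[rotated]) (simp add: total_diff assms c)
  from tendsto_add[OF this lim] show ?thesis by simp
qed

lemma extension_fin: "a \<in> fin_fams \<Longrightarrow> extension (fin_sum \<iota> \<delta> a) = total a"
  using extension_lim[of "\<lambda>_. a" "fin_sum \<iota> \<delta> a"] by (simp add: LIMSEQ_const_iff)

lemma extension_monomial: "f \<in> CX \<Longrightarrow> extension (\<iota> f * U n) = m f n"
  using extension_fin[OF single_fin, of f n] by (simp add: total_single alg.total_single)

lemma extension_add: "extension (b + c) = extension b + extension c"
proof -
  obtain f where f: "\<And>k. f k \<in> fin_fams" "(\<lambda>k. fin_sum \<iota> \<delta> (f k)) \<longlonglongrightarrow> b" using approximable by metis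
  obtain g where g: "\<And>k. g k \<in> fin_fams" "(\<lambda>k. fin_sum \<iota> \<delta> (g k)) \<longlonglongrightarrow> c" using approximable by metis
  have "(\<lambda>k. total (\<lambda>n x. f k n x + g k n x)) \<longlonglongrightarrow> extension (b + c)"
    by (rule extension_lim) (simp_all add: fam_add_fin f g alg.total_add tendsto_add)
  moreover have "(\<lambda>k. total (\<lambda>n x. f k n x + g k n x)) \<longlonglongrightarrow> extension b + extension c"
    using tendsto_add[OF extension_lim[OF f] extension_lim[OF g]] by (simp add: total_add f g)
  ultimately show ?thesis by (rule LIMSEQ_unique)
qed

lemma extension_mult: "extension (b * c) = mlt (extension b) (extension c)"
proof -
  obtain f where f: "\<And>k. f k \<in> fin_fams" "(\<lambda>k. fin_sum \<iota> \<delta> (f k)) \<longlonglongrightarrow> b" using approximable by metis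
  obtain g where g: "\<And>k. g k \<in> fin_fams" "(\<lambda>k. fin_sum \<iota> \<delta> (g k)) \<longlonglongrightarrow> c" using approximable by metis
  have "(\<lambda>k. total (fam_mult \<sigma> (f k) (g k))) \<longlonglongrightarrow> extension (b * c)"
    by (rule extension_lim) (simp_all add: fam_mult_fin f g alg.total_mult tendsto_mult)
  moreover have "(\<lambda>k. total (fam_mult \<sigma> (f k) (g k))) \<longlonglongrightarrow> mlt (extension b) (extension c)"
    using bounded_bilinear.tendsto[OF mlt extension_lim[OF f] extension_lim[OF g]] by (simp add: total_mult f g)
  ultimately show ?thesis by (rule LIMSEQ_unique)
qed

lemma extension_scaleC: "extension (c *\<^sub>C b) = mlt (m (\<lambda>_. c) 0) (extension b)"
  using extension_mult[of "c *\<^sub>C 1" b] extension_monomial[OF CX_const, of c 0]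
  by (simp add: \<iota>_const scaleC_mult_left)

end

section \<open>Operators on square-summable sequences\<close>

definition op_adj :: "('i ell2 \<Rightarrow>\<^sub>L 'i ell2) \<Rightarrow> ('i ell2 \<Rightarrow>\<^sub>L 'i ell2) \<Rightarrow> bool" where
  "op_adj S T \<longleftrightarrow> (\<forall>v w. cinner (S v) w = cinner v (T w))"

lemma norm_sq_cinner: "(norm (v::'h::complex_hilbert_space))\<^sup>2 = cmod (cinner v v)"
  unfolding cinner_self norm_of_real by simp

text \<open>The C*-identity for operators whose adjoint is known explicitly,
  so that adjoints need not be obtained from the Riesz representation theorem.\<close>

lemma op_adj_norm:
  assumes "op_adj S T"
  shows "norm (T o\<^sub>L S) = (norm S)\<^sup>2"
proof (rule antisym)
  have ST: "cinner (S v) w = cinner v (T w)" for v w using assms by (simp add: op_adj_def)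
  have "norm T \<le> norm S"
  proof (rule norm_blinfun_bound)
    fix w
    show "norm (T w) \<le> norm S * norm w"
    proof (cases "T w = 0")
      case False
      have "(norm (T w))\<^sup>2 = cmod (cinner (S (T w)) w)" by (simp add: norm_sq_cinner ST)
      also have "\<dots> \<le> norm S * norm (T w) * norm w"
        using Cauchy_Schwarz_complex[of "S (T w)" w] mult_right_mono[OF norm_blinfun[of S "T w"], of "norm w"]
        by simp
      finally show ?thesis using False by (simp add: power2_eq_square algebra_simps)
    qed simp
  qed simp
  then show "norm (T o\<^sub>L S) \<le> (norm S)\<^sup>2"
    using norm_blinfun_compose[of T S] mult_right_mono[of "norm T" "norm S" "norm S"]
    by (simp add: power2_eq_square)
  have "norm S \<le> sqrt (norm (T o\<^sub>L S))"
  proof (rule norm_blinfun_bound)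
    fix v
    have "(norm (S v))\<^sup>2 = cmod (cinner v ((T o\<^sub>L S) v))" by (simp add: norm_sq_cinner ST)
    also have "\<dots> \<le> norm v * (norm (T o\<^sub>L S) * norm v)"
      using Cauchy_Schwarz_complex[of v "(T o\<^sub>L S) v"]
        mult_left_mono[OF norm_blinfun[of "T o\<^sub>L S" v], of "norm v"]
      by simp
    also have "\<dots> = (sqrt (norm (T o\<^sub>L S)) * norm v)\<^sup>2" by (simp add: power_mult_distrib power2_eq_square)
    finally show "norm (S v) \<le> sqrt (norm (T o\<^sub>L S)) * norm v" by (rule power2_le_imp_le) simp
  qed simp
  then show "(norm S)\<^sup>2 \<le> norm (T o\<^sub>L S)"
    using power_mono[of "norm S" "sqrt (norm (T o\<^sub>L S))" 2] by simp
qed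

lemma coord_basis: "coord (ell2_basis i) j = (if j = i then 1 else 0)"
  by transfer simp

lemma cinner_basis: "cinner v (ell2_basis j) = coord v j"
proof -
  have "cinner v (ell2_basis j) = (\<Sum>\<^sub>\<infinity>k\<in>{j}. coord v k * cnj (coord (ell2_basis j) k))"
    unfolding cinner_ell2_def by (rule infsum_cong_neutral) (auto simp: coord_basis)
  then show ?thesis by (simp add: coord_basis)
qed

lemma coord_sum: "coord (\<Sum>i\<in>S. f i) j = (\<Sum>i\<in>S. coord (f i) j)"
  by (induction S rule: infinite_finite_induct) auto

lemma tendsto_coord: "(f \<longlongrightarrow> v) F \<Longrightarrow> ((\<lambda>k. coord (f k) i) \<longlongrightarrow> coord v i) F"
proof (rule Lim_null[THEN iffD2], rule Lim_null_comparison)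
  assume "(f \<longlongrightarrow> v) F"
  then show "((\<lambda>k. norm (f k - v)) \<longlongrightarrow> 0) F" by (intro tendsto_norm_zero) (simp add: Lim_null[symmetric])
  show "\<forall>\<^sub>F k in F. norm (coord (f k) i - coord v i) \<le> norm (f k - v)"
    using coord_le_norm[of "f _ - v" i] by simp
qed

lemma ell2_tail_small:
  assumes "0 < e"
  obtains F where "finite F" "norm (v - (\<Sum>i\<in>F. coord v i *\<^sub>C ell2_basis i)) \<le> e"
proof -
  let ?s = "\<lambda>i. (cmod (coord v i))\<^sup>2"
  have "(sum ?s \<longlongrightarrow> infsum ?s UNIV) (finite_subsets_at_top UNIV)"
    by (rule infsum_tendsto[OF coord_summable])
  then have "\<forall>\<^sub>F F in finite_subsets_at_top UNIV. dist (sum ?s F) (infsum ?s UNIV) < e\<^sup>2"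
    using assms by (intro tendstoD) auto
  then obtain F where F: "finite F" "dist (sum ?s F) (infsum ?s UNIV) < e\<^sup>2"
    by (auto simp: eventually_finite_subsets_at_top)
  have "norm (v - (\<Sum>i\<in>F. coord v i *\<^sub>C ell2_basis i)) \<le> e"
  proof (rule norm_ell2_le)
    fix G :: "'a set" assume G: "finite G"
    have c: "coord (v - (\<Sum>i\<in>F. coord v i *\<^sub>C ell2_basis i)) j = (if j \<in> F then 0 else coord v j)" for j
      using F(1) by (simp add: coord_sum coord_basis if_distrib[of "(*) _"] cong: if_cong)
    have "(\<Sum>j\<in>G. (cmod (coord (v - (\<Sum>i\<in>F. coord v i *\<^sub>C ell2_basis i)) j))\<^sup>2) = sum ?s (G - F)"
      unfolding c using G by (intro sum.mono_neutral_cong_right) auto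
    also have "\<dots> = sum ?s (G \<union> F) - sum ?s F"
      using G F(1) sum.subset_diff[of F "G \<union> F" ?s] by (simp add: Un_Diff)
    also have "\<dots> \<le> infsum ?s UNIV - sum ?s F"
      using finite_sum_le_infsum[OF coord_summable, of "G \<union> F" v] G F(1) by simp
    also have "\<dots> \<le> e\<^sup>2" using F(2) by (simp add: dist_real_def)
    finally show "(\<Sum>j\<in>G. (cmod (coord (v - (\<Sum>i\<in>F. coord v i *\<^sub>C ell2_basis i)) j))\<^sup>2) \<le> e\<^sup>2" .
  qed (use assms in simp)
  with F(1) show ?thesis by (rule that)
qed

definition coord_subspace :: "'i set \<Rightarrow> 'i ell2 set" where
  "coord_subspace I = {v. \<forall>i. i \<notin> I \<longrightarrow> coord v i = 0}"

lemma coord_subspace_UNIV [simp]: "coord_subspace UNIV = UNIV"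
  by (simp add: coord_subspace_def)

lemma fin_hilbert_eq: "fin_hilbert p = coord_subspace {0..<int p}"
  by (simp add: fin_hilbert_def coord_subspace_def)

lemma basis_in_coord_subspace [simp]: "ell2_basis i \<in> coord_subspace I \<longleftrightarrow> i \<in> I"
  by (auto simp: coord_subspace_def coord_basis)

lemma closed_csubspace_coord_subspace: "closed_csubspace (coord_subspace I)"
proof -
  have "closed (coord_subspace I)"
  proof (unfold closed_sequential_limits, intro allI impI)
    fix f and v :: "'a ell2" assume *: "(\<forall>n. f n \<in> coord_subspace I) \<and> f \<longlonglongrightarrow> v"
    show "v \<in> coord_subspace I" unfolding coord_subspace_def
    proof (intro CollectI allI impI)
      fix i assume "i \<notin> I"
      then have "coord (f n) i = 0" for n using * by (auto simp: coord_subspace_def)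
      then show "coord v i = 0"
        using * tendsto_coord[of f v sequentially i] by (simp add: LIMSEQ_const_iff)
    qed
  qed
  then show ?thesis by (auto simp: closed_csubspace_def coord_subspace_def)
qed

text \<open>The coordinate subspace on \<open>I\<close> is the closed span of the \<open>e\<^sub>i\<close>, \<open>i \<in> I\<close>, so bounded operators on it are
  determined by their values on these vectors.\<close>

lemma bounded_ops_coord_subspace_eqI:
  assumes S: "S \<in> bounded_ops (coord_subspace I)" and T: "T \<in> bounded_ops (coord_subspace I)"
    and eq: "\<And>i. i \<in> I \<Longrightarrow> S (ell2_basis i) = T (ell2_basis i)"
  shows "S = T"
proof
  fix v
  let ?H = "coord_subspace I"
  show "S v = T v"
  proof (cases "v \<in> ?H")
    case True
    obtain K L where K: "\<And>v. v \<in> ?H \<Longrightarrow> norm (S v) \<le> K * norm v"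
      and L: "\<And>v. v \<in> ?H \<Longrightarrow> norm (T v) \<le> L * norm v"
      using S T unfolding bounded_ops_def by (elim CollectE conjE exE) blast
    have H: "closed_csubspace ?H" by (rule closed_csubspace_coord_subspace)
    have add: "R (x + y) = R x + R y" if "x \<in> ?H" "y \<in> ?H" "R \<in> bounded_ops ?H" for R x y
      using that by (auto simp: bounded_ops_def)
    have scale: "R (c *\<^sub>C x) = c *\<^sub>C R x" if "x \<in> ?H" "R \<in> bounded_ops ?H" for R c x
      using that by (auto simp: bounded_ops_def)
    have R0: "R 0 = 0" if "R \<in> bounded_ops ?H" for R
      using scale[OF _ that, of 0 0] H by (simp add: closed_csubspace_def)
    have fin: "(\<Sum>i\<in>F. coord v i *\<^sub>C ell2_basis i) \<in> ?H
        \<and> S (\<Sum>i\<in>F. coord v i *\<^sub>C ell2_basis i) = T (\<Sum>i\<in>F. coord v i *\<^sub>C ell2_basis i)" if "finite F" for F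
      using that
    proof (induction F rule: finite_induct)
      case empty
      then show ?case using H R0[OF S] R0[OF T] by (simp add: closed_csubspace_def)
    next
      case (insert i F)
      have i: "coord v i *\<^sub>C ell2_basis i \<in> ?H
          \<and> S (coord v i *\<^sub>C ell2_basis i) = T (coord v i *\<^sub>C ell2_basis i)"
      proof (cases "i \<in> I")
        case True
        then show ?thesis
          using H scale[OF _ S, of "ell2_basis i"] scale[OF _ T, of "ell2_basis i"] eq[of i]
          by (simp add: closed_csubspace_def)
      next
        case False
        then have "coord v i = 0" using \<open>v \<in> ?H\<close> by (simp add: coord_subspace_def)
        then show ?thesis using H R0[OF S] R0[OF T] by (simp add: closed_csubspace_def)
      qed
      from insert.IH have F: "(\<Sum>i\<in>F. coord v i *\<^sub>C ell2_basis i) \<in> ?H" by simp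
      show ?case
        using insert i H add[OF conjunct1[OF i] F S] add[OF conjunct1[OF i] F T]
        by (simp add: closed_csubspace_def)
    qed
    have "norm (S v - T v) \<le> e" if e: "0 < e" for e
    proof -
      define C where "C = \<bar>K\<bar> + \<bar>L\<bar> + 1"
      have C: "C > 0" by (simp add: C_def)
      obtain F where F: "finite F" "norm (v - (\<Sum>i\<in>F. coord v i *\<^sub>C ell2_basis i)) \<le> e / C"
        using ell2_tail_small[of "e / C" v] e C by auto
      define w where "w = (\<Sum>i\<in>F. coord v i *\<^sub>C ell2_basis i)"
      have w: "w \<in> ?H" "S w = T w" using fin[OF F(1)] by (simp_all add: w_def)
      have "(-1) *\<^sub>C w \<in> ?H" using H w by (simp add: closed_csubspace_def)
      then have d: "v - w \<in> ?H"
        using H True unfolding closed_csubspace_def scaleC_minus_one by (metis diff_conv_add_uminus)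
      have "S v - T v = S (v - w) - T (v - w)"
        using add[OF d w(1) S] add[OF d w(1) T] w(2) by simp
      then have "norm (S v - T v) \<le> norm (S (v - w)) + norm (T (v - w))"
        by (simp add: norm_triangle_ineq4)
      also have "\<dots> \<le> K * norm (v - w) + L * norm (v - w)" using K L d by (simp add: add_mono)
      also have "\<dots> \<le> C * norm (v - w)"
        by (simp add: C_def distrib_right[symmetric] mult_right_mono)
      also have "\<dots> \<le> C * (e / C)" using F(2) C by (intro mult_left_mono) (auto simp: w_def)
      finally show ?thesis using C by simp
    qed
    then show ?thesis using field_le_epsilon[of "norm (S v - T v)" 0] by simp
  next
    case False
    then show ?thesis using S T by (simp add: bounded_ops_def)
  qed
qed

section \<open>Representations along orbits\<close>

text \<open>A common form of the two families of representations. The index set \<open>\<int>\<close> carries an action \<open>\<tau>\<close> of \<open>\<int>\<close>,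
  the map \<open>z\<close> is equivariant from it into the dynamical system, and \<open>\<delta>\<^sup>n\<close> moves \<open>e\<^sub>j\<close> to a multiple of
  \<open>e\<^sub>i\<close>, \<open>i = \<tau> n j\<close>, with coefficient \<open>W n i\<close>. The equation for \<open>W (n + k)\<close> is the cocycle identity which makes
  these operators multiply correctly. For an aperiodic point \<open>\<tau>\<close> is translation and \<open>W = 1\<close>.\<close>

locale orbit_data = crossed_prod \<sigma> \<iota> \<delta>
  for \<sigma> :: "'x::t2_space \<Rightarrow> 'x" and \<iota> :: "('x \<Rightarrow> complex) \<Rightarrow> 'a::unital_cstar_algebra" and \<delta> :: 'a +
  fixes z :: "int \<Rightarrow> 'x" and \<tau> :: "int \<Rightarrow> int \<Rightarrow> int" and W :: "int \<Rightarrow> int \<Rightarrow> complex"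
  assumes \<tau>_zero: "\<tau> 0 i = i" and \<tau>_add: "\<tau> (n + k) i = \<tau> n (\<tau> k i)"
    and z_\<tau>: "z (\<tau> n i) = iter_int \<sigma> n (z i)"
    and norm_W: "cmod (W n i) = 1" and W_add: "W (n + k) i = W n i * W k (\<tau> (- n) i)"
begin

lemma \<tau>_cancel [simp]: "\<tau> n (\<tau> (- n) i) = i" "\<tau> (- n) (\<tau> n i) = i"
  by (simp_all add: \<tau>_add[symmetric] \<tau>_zero)

lemma \<tau>_neg_add: "\<tau> (- n - k) i = \<tau> (- k) (\<tau> (- n) i)"
  by (metis \<tau>_add add.commute diff_conv_add_uminus)

lemma bij_\<tau>: "bij (\<tau> n)"
  by (rule bij_betw_byWitness[of _ "\<tau> (- n)"]) auto

lemma W_0: "W 0 i = 1"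
proof -
  have "W 0 i = W 0 i * W 0 i" using W_add[of 0 0 i] by (simp add: \<tau>_zero)
  then show ?thesis using norm_W[of 0 i] by auto
qed

lemma W_cnj: "cnj (W n (\<tau> n i)) = W (- n) i"
proof -
  have 1: "W (- n) i * W n (\<tau> n i) = 1" using W_add[of "- n" n i] by (simp add: W_0)
  have "cnj (W n (\<tau> n i)) = W (- n) i * (W n (\<tau> n i) * cnj (W n (\<tau> n i)))"
    by (simp only: mult.assoc[symmetric] 1) simp
  also have "\<dots> = W (- n) i" by (simp add: complex_norm_square[symmetric] norm_W)
  finally show ?thesis .
qed

definition weighted_shift :: "('x \<Rightarrow> complex) \<Rightarrow> int \<Rightarrow> int ell2 \<Rightarrow> int ell2" where
  "weighted_shift f n v = Abs_ell2 (\<lambda>i. f (z i) * W n i * coord v (\<tau> (- n) i))"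

lemma weighted_shift_sum_le:
  assumes K: "\<And>x. cmod (f x) \<le> K" and F: "finite F"
  shows "(\<Sum>i\<in>F. (cmod (f (z i) * W n i * coord v (\<tau> (- n) i)))\<^sup>2) \<le> (K * norm v)\<^sup>2"
proof -
  have inj: "inj_on (\<tau> (- n)) F" using bij_\<tau>[of "- n"] by (auto simp: bij_def intro: inj_on_subset)
  have "(\<Sum>i\<in>F. (cmod (f (z i) * W n i * coord v (\<tau> (- n) i)))\<^sup>2)
      \<le> (\<Sum>i\<in>F. K\<^sup>2 * (cmod (coord v (\<tau> (- n) i)))\<^sup>2)"
    using K by (intro sum_mono) (simp add: norm_mult norm_W power_mult_distrib mult_right_mono power_mono)
  also have "\<dots> = K\<^sup>2 * (\<Sum>j\<in>\<tau> (- n) ` F. (cmod (coord v j))\<^sup>2)"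
    using inj by (simp add: sum_distrib_left sum.reindex)
  also have "\<dots> \<le> K\<^sup>2 * (norm v)\<^sup>2"
    using sum_coord_le_norm[of "\<tau> (- n) ` F" v] F by (intro mult_left_mono) auto
  finally show ?thesis by (simp add: power_mult_distrib)
qed

lemma coord_weighted_shift:
  assumes "f \<in> CX"
  shows "coord (weighted_shift f n v) i = f (z i) * W n i * coord v (\<tau> (- n) i)"
proof -
  obtain K where "\<And>x. cmod (f x) \<le> K" using CX_bounded[OF assms] by blast
  from weighted_shift_sum_le[of f, OF this]
  have "(\<lambda>i. (cmod (f (z i) * W n i * coord v (\<tau> (- n) i)))\<^sup>2) summable_on UNIV"
    unfolding sq_summable_iff_bounded by blast
  then show ?thesis by (simp add: weighted_shift_def Abs_ell2_inverse)
qed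

lemma norm_weighted_shift:
  assumes "f \<in> CX" "\<And>x. cmod (f x) \<le> K" "0 \<le> K"
  shows "norm (weighted_shift f n v) \<le> K * norm v"
  by (rule norm_ell2_le) (use assms weighted_shift_sum_le[of f K] in \<open>simp_all add: coord_weighted_shift\<close>)

lemma bounded_linear_weighted_shift:
  assumes f: "f \<in> CX"
  shows "bounded_linear (weighted_shift f n)"
proof -
  obtain K where K: "0 \<le> K" "\<And>x. cmod (f x) \<le> K" using CX_bounded[OF f] by blast
  show ?thesis
  proof (rule bounded_linear_intro[of _ K])
    show "weighted_shift f n (v + w) = weighted_shift f n v + weighted_shift f n w" for v w
      by (rule coord_eqI) (simp add: coord_weighted_shift[OF f] algebra_simps)
    show "weighted_shift f n (r *\<^sub>R v) = r *\<^sub>R weighted_shift f n v" for r v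
      by (rule coord_eqI) (simp add: coord_weighted_shift[OF f] scaleR_ell2_def)
    show "norm (weighted_shift f n v) \<le> norm v * K" for v
      using norm_weighted_shift[OF f K(2,1)] by (simp add: mult.commute)
  qed
qed

definition weighted_shift_op :: "('x \<Rightarrow> complex) \<Rightarrow> int \<Rightarrow> int ell2 \<Rightarrow>\<^sub>L int ell2" where
  "weighted_shift_op f n = Blinfun (weighted_shift f n)"

lemma weighted_shift_op: "f \<in> CX \<Longrightarrow> blinfun_apply (weighted_shift_op f n) v = weighted_shift f n v"
  by (simp add: weighted_shift_op_def bounded_linear_Blinfun_apply bounded_linear_weighted_shift)

lemma coord_weighted_shift_op:
  "f \<in> CX \<Longrightarrow> coord (blinfun_apply (weighted_shift_op f n) v) i = f (z i) * W n i * coord v (\<tau> (- n) i)"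
  by (simp add: weighted_shift_op coord_weighted_shift)

lemma weighted_shift_op_adj:
  assumes f: "f \<in> CX"
  shows "op_adj (weighted_shift_op f n) (weighted_shift_op (\<lambda>x. cnj (f (iter_int \<sigma> n x))) (- n))"
  unfolding op_adj_def
proof (intro allI)
  fix v w
  have g: "(\<lambda>x. cnj (f (iter_int \<sigma> n x))) \<in> CX" by (intro CX_cnj CX_iter f)
  have "cinner (weighted_shift_op f n v) w = (\<Sum>\<^sub>\<infinity>i. f (z i) * W n i * coord v (\<tau> (- n) i) * cnj (coord w i))"
    by (simp add: cinner_ell2_def coord_weighted_shift_op[OF f])
  also have "\<dots> = (\<Sum>\<^sub>\<infinity>j. f (z (\<tau> n j)) * W n (\<tau> n j) * coord v (\<tau> (- n) (\<tau> n j)) * cnj (coord w (\<tau> n j)))"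
    by (rule infsum_reindex_bij_betw[symmetric, OF bij_\<tau>])
  also have "\<dots> = cinner v (weighted_shift_op (\<lambda>x. cnj (f (iter_int \<sigma> n x))) (- n) w)"
    by (simp add: cinner_ell2_def coord_weighted_shift_op[OF g] z_\<tau> W_cnj[symmetric] algebra_simps)
  finally show "cinner (weighted_shift_op f n v) w = cinner v (weighted_shift_op (\<lambda>x. cnj (f (iter_int \<sigma> n x))) (- n) w)" .
qed

end

sublocale orbit_data \<subseteq> covariant_extension \<sigma> \<iota> \<delta> weighted_shift_op blinfun_compose op_adj
proof (intro covariant_extension.intro covariant_monomials.intro covariant_monomials_axioms.intro)
  fix f g :: "'x \<Rightarrow> complex" and n k :: int and c :: complex
    and S T S' T' :: "int ell2 \<Rightarrow>\<^sub>L int ell2"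
  show "norm (weighted_shift_op (\<lambda>_. c) 0) \<le> cmod c"
    using norm_weighted_shift[OF CX_const, of c "cmod c" 0]
    by (intro norm_blinfun_bound) (simp_all add: weighted_shift_op CX_const)
  show "op_adj S T \<Longrightarrow> op_adj S' T' \<Longrightarrow> op_adj (S + S') (T + T')"
    by (simp add: op_adj_def blinfun.add_left cinner_add_left cinner_add_right)
  show "op_adj 0 (0 :: int ell2 \<Rightarrow>\<^sub>L int ell2)" by (simp add: op_adj_def)
  assume f: "f \<in> CX" and g: "g \<in> CX"
  show "weighted_shift_op (\<lambda>x. f x + g x) n = weighted_shift_op f n + weighted_shift_op g n"
    by (intro blinfun_eqI coord_eqI)
      (simp add: blinfun.add_left coord_weighted_shift_op f g CX_add algebra_simps)
  show "weighted_shift_op f n o\<^sub>L weighted_shift_op g k = weighted_shift_op (\<lambda>x. f x * g (iter_int \<sigma> (- n) x)) (n + k)"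
    by (intro blinfun_eqI coord_eqI)
      (simp add: coord_weighted_shift_op f g CX_mult CX_iter z_\<tau> W_add \<tau>_neg_add mult_ac)
qed (auto simp: crossed_prod_axioms dynamics_axioms weighted_shift_op_adj bounded_bilinear_blinfun_compose
    norm_blinfun_compose op_adj_norm)

context orbit_data
begin

definition orbit_rep :: "'a \<Rightarrow> int ell2 \<Rightarrow> int ell2" where
  "orbit_rep b = blinfun_apply (extension b)"

lemma weighted_shift_op_const: "blinfun_apply (weighted_shift_op (\<lambda>_. c) 0) v = c *\<^sub>C v"
  by (rule coord_eqI) (simp add: coord_weighted_shift_op CX_const \<tau>_zero W_0)

lemma orbit_rep_mult: "orbit_rep (b * c) v = orbit_rep b (orbit_rep c v)"
  by (simp add: orbit_rep_def extension_mult)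

lemma orbit_rep_scaleC: "orbit_rep (c *\<^sub>C b) v = c *\<^sub>C orbit_rep b v"
  by (simp add: orbit_rep_def extension_scaleC weighted_shift_op_const)

lemma orbit_rep_one: "orbit_rep 1 v = v"
  using extension_monomial[OF CX_const, of 1 0] by (simp add: orbit_rep_def \<iota>_one weighted_shift_op_const)

lemma orbit_rep_linear: "orbit_rep b (c *\<^sub>C v) = c *\<^sub>C orbit_rep b v"
proof -
  have "orbit_rep b (c *\<^sub>C v) = orbit_rep (b * (c *\<^sub>C 1)) v" by (simp add: orbit_rep_mult orbit_rep_scaleC orbit_rep_one)
  also have "\<dots> = c *\<^sub>C orbit_rep b v" by (simp add: scaleC_mult_right orbit_rep_scaleC)
  finally show ?thesis .
qed

lemma orbit_rep_tendsto:
  assumes "\<And>k. a k \<in> fin_fams" "(\<lambda>k. fin_sum \<iota> \<delta> (a k)) \<longlonglongrightarrow> b"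
  shows "(\<lambda>k. blinfun_apply (total (a k)) v) \<longlonglongrightarrow> orbit_rep b v"
  unfolding orbit_rep_def by (intro tendsto_intros extension_lim assms)

lemma orbit_rep_star: "cinner (orbit_rep (star b) v) w = cinner v (orbit_rep b w)"
proof -
  obtain f where f: "\<And>k. f k \<in> fin_fams" "(\<lambda>k. fin_sum \<iota> \<delta> (f k)) \<longlonglongrightarrow> b" using approximable by metis
  have "bounded_linear (star :: 'a \<Rightarrow> 'a)"
    using star_scaleC[of "complex_of_real _"]
    by (intro bounded_linear_intro[of _ 1]) (auto simp: star_add scaleC_of_real)
  then have "(\<lambda>k. star (fin_sum \<iota> \<delta> (f k))) \<longlonglongrightarrow> star b" using f(2) by (rule bounded_linear.tendsto)
  then have "(\<lambda>k. fin_sum \<iota> \<delta> (fam_star \<sigma> (f k))) \<longlonglongrightarrow> star b" by (simp add: alg.total_star f)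
  then have "(\<lambda>k. cinner (total (fam_star \<sigma> (f k)) v) w) \<longlonglongrightarrow> cinner (orbit_rep (star b) v) w"
    by (intro tendsto_cinner orbit_rep_tendsto tendsto_const fam_star_fin f)
  moreover have "cinner (total (fam_star \<sigma> (f k)) v) w = cinner v (total (f k) w)" for k
  proof -
    have "op_adj (total (f k)) (total (fam_star \<sigma> (f k)))" by (rule total_star[OF f(1)])
    then show ?thesis by (metis cinner_commute op_adj_def)
  qed
  moreover have "(\<lambda>k. cinner v (total (f k) w)) \<longlonglongrightarrow> cinner v (orbit_rep b w)"
    by (intro tendsto_cinner orbit_rep_tendsto tendsto_const f)
  ultimately show ?thesis by (simp add: LIMSEQ_unique)
qed

lemma hilbert_rep_orbit_rep: "hilbert_rep UNIV orbit_rep"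
  unfolding hilbert_rep_def bounded_ops_def
proof (safe intro!: orbit_rep_mult orbit_rep_scaleC orbit_rep_one orbit_rep_star orbit_rep_linear)
  show "closed_csubspace (UNIV :: int ell2 set)"
    using closed_csubspace_coord_subspace[of "UNIV :: int set"] by simp
  show "\<exists>K. \<forall>v\<in>UNIV. norm (orbit_rep a v) \<le> K * norm v" for a
    unfolding orbit_rep_def using norm_blinfun by blast
qed (simp_all add: orbit_rep_def extension_add blinfun.add_left blinfun.add_right)

lemma orbit_rep_monomial: "f \<in> CX \<Longrightarrow> orbit_rep (\<iota> f * U n) (ell2_basis i) = (f (z (\<tau> n i)) * W n (\<tau> n i)) *\<^sub>C ell2_basis (\<tau> n i)"
  by (intro coord_eqI) (auto simp: orbit_rep_def extension_monomial coord_weighted_shift_op coord_basis)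

lemma orbit_rep_\<iota>: "f \<in> CX \<Longrightarrow> orbit_rep (\<iota> f) (ell2_basis i) = f (z i) *\<^sub>C ell2_basis i"
  using orbit_rep_monomial[of f 0 i] by (simp add: \<tau>_zero W_0)

lemma orbit_rep_\<delta>: "orbit_rep \<delta> (ell2_basis i) = W 1 (\<tau> 1 i) *\<^sub>C ell2_basis (\<tau> 1 i)"
  using orbit_rep_monomial[OF CX_const, of 1 1 i] by (simp add: \<iota>_one)

end

section \<open>The orbit representations of the crossed product\<close>

context crossed_prod
begin

lemma fin_sum_on: "finite F \<Longrightarrow> fam_supp a \<subseteq> F \<Longrightarrow> fin_sum \<iota> \<delta> a = (\<Sum>n\<in>F. \<iota> (a n) * U n)"
  by (rule alg.total_on)

text \<open>Representations are contractive, so they are determined by their values on the generators \<open>f\<close>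
  and \<open>\<delta>\<close>; the value on \<open>\<delta>\<^sup>*\<close> is the adjoint of the value on \<open>\<delta>\<close>. This is what makes the definite
  descriptions of the orbit representations meaningful.\<close>

lemma hilbert_rep_eqI:
  fixes \<rho> \<rho>' :: "'a \<Rightarrow> 'h::complex_hilbert_space \<Rightarrow> 'h"
  assumes r: "hilbert_rep H \<rho>" "hilbert_rep H \<rho>'"
    and f: "\<And>f. f \<in> CX \<Longrightarrow> \<rho> (\<iota> f) = \<rho>' (\<iota> f)" and d: "\<rho> \<delta> = \<rho>' \<delta>"
  shows "\<rho> = \<rho>'"
proof (intro ext)
  interpret R: hilbert_representation H \<rho> by unfold_locales (rule r)
  interpret R': hilbert_representation H \<rho>' by unfold_locales (rule r)
  fix b v
  have s: "\<rho> (star \<delta>) v = \<rho>' (star \<delta>) v" for v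
  proof (cases "v \<in> H")
    case True
    define w where "w = \<rho> (star \<delta>) v - \<rho>' (star \<delta>) v"
    have w: "w \<in> H" unfolding w_def using True by (simp add: R.diff_H)
    have "cinner w w = cinner (\<rho> (star \<delta>) v) w - cinner (\<rho>' (star \<delta>) v) w"
      by (subst (1) w_def) (rule cinner_diff_left)
    also have "\<dots> = 0" using True w by (simp add: R.star_a R'.star_a d)
    finally have "cinner w w = 0" .
    then show ?thesis by (simp add: cinner_self w_def)
  qed (simp add: R.out_H R'.out_H)
  have p: "\<rho> (e ^ n) v = \<rho>' (e ^ n) v" if "\<And>v. \<rho> e v = \<rho>' e v" for e n v
    by (induction n) (cases "v \<in> H"; simp add: R.one_a R'.one_a R.out_H R'.out_H that R.mult_a R'.mult_a)+
  have u: "\<rho> (U n) v = \<rho>' (U n) v" for n v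
    using p[of \<delta>] p[of "star \<delta>"] d s by (simp add: unitary_pow_def)
  show "\<rho> b v = \<rho>' b v"
  proof (induction b rule: dense_induct)
    case (1 a)
    then show ?case
      by (auto simp: alg.total_def R.sum_a R'.sum_a R.mult_a R'.mult_a u f fin_famsD intro!: sum.cong)
  next
    case (2 g b)
    have "(\<lambda>k. \<rho> (g k) v) \<longlonglongrightarrow> \<rho>' b v" using R'.tendsto_a[OF 2(2)] by (simp add: 2(1))
    then show ?case using R.tendsto_a[OF 2(2)] by (rule LIMSEQ_unique[rotated])
  qed
qed

lemma hilbert_rep_coord_eqI:
  assumes r: "hilbert_rep (coord_subspace I) \<rho>" "hilbert_rep (coord_subspace I) \<rho>'"
    and f: "\<And>f i. f \<in> CX \<Longrightarrow> i \<in> I \<Longrightarrow> \<rho> (\<iota> f) (ell2_basis i) = \<rho>' (\<iota> f) (ell2_basis i)"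
    and d: "\<And>i. i \<in> I \<Longrightarrow> \<rho> \<delta> (ell2_basis i) = \<rho>' \<delta> (ell2_basis i)"
  shows "\<rho> = \<rho>'"
proof (rule hilbert_rep_eqI[OF r])
  have b: "\<rho> a \<in> bounded_ops (coord_subspace I)" "\<rho>' a \<in> bounded_ops (coord_subspace I)" for a
    using r by (auto simp: hilbert_rep_def)
  show "f \<in> CX \<Longrightarrow> \<rho> (\<iota> f) = \<rho>' (\<iota> f)" for f by (rule bounded_ops_coord_subspace_eqI[OF b f])
  show "\<rho> \<delta> = \<rho>' \<delta>" by (rule bounded_ops_coord_subspace_eqI[OF b d])
qed

lemma free_orbit: "orbit_data \<sigma> \<iota> \<delta> (\<lambda>i. iter_int \<sigma> i x) (\<lambda>n i. n + i) (\<lambda>_ _. 1)"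
  by (intro orbit_data.intro orbit_data_axioms.intro crossed_prod_axioms)
    (simp_all add: iter_add add.assoc)

text \<open>The representation along the orbit of an arbitrary point \<open>x\<close>, periodic or not. Its diagonal matrix
  entries are values of the coefficient function at \<open>0\<close>, and so it bounds this function by the norm.\<close>

lemma free_orbit_rep:
  obtains R where "hilbert_rep UNIV R"
    "\<And>f i. f \<in> CX \<Longrightarrow> R (\<iota> f) (ell2_basis i) = f (iter_int \<sigma> i x) *\<^sub>C ell2_basis i"
    "\<And>i. R \<delta> (ell2_basis i) = ell2_basis (i + 1)"
    "\<And>a i. a \<in> fin_fams \<Longrightarrow> coord (R (fin_sum \<iota> \<delta> a) (ell2_basis i)) i = a 0 (iter_int \<sigma> i x)"
proof -
  interpret orbit_data \<sigma> \<iota> \<delta> "\<lambda>i. iter_int \<sigma> i x" "\<lambda>n i. n + i" "\<lambda>_ _. 1" by (rule free_orbit)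
  show ?thesis
  proof (rule that[OF hilbert_rep_orbit_rep])
    show "orbit_rep (\<iota> f) (ell2_basis i) = f (iter_int \<sigma> i x) *\<^sub>C ell2_basis i" if "f \<in> CX" for f i
      by (rule orbit_rep_\<iota>[OF that])
    show "orbit_rep \<delta> (ell2_basis i) = ell2_basis (i + 1)" for i
      using orbit_rep_\<delta>[of i] by (simp only: scaleC_one add.commute[of 1])
    show "coord (orbit_rep (fin_sum \<iota> \<delta> a) (ell2_basis i)) i = a 0 (iter_int \<sigma> i x)" if a: "a \<in> fin_fams" for a i
    proof -
      have "coord (orbit_rep (fin_sum \<iota> \<delta> a) (ell2_basis i)) i
          = (\<Sum>n\<in>fam_supp a. a n (iter_int \<sigma> i x) * coord (ell2_basis i) (- n + i))"
        by (simp only: orbit_rep_def extension_fin[OF a] total_def blinfun.sum_left coord_sum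
            coord_weighted_shift_op[OF fin_famsD(1)[OF a]] mult_1_right)
      also have "\<dots> = (\<Sum>n\<in>fam_supp a. if n = 0 then a n (iter_int \<sigma> i x) else 0)"
        by (intro sum.cong) (auto simp: coord_basis)
      also have "\<dots> = a 0 (iter_int \<sigma> i x)"
        using a by (simp add: fin_famsD) (simp add: fam_supp_def)
      finally show ?thesis .
    qed
  qed
qed

text \<open>The \<open>p\<close>-dimensional representation is realised on \<open>\<ell>\<^sup>2(\<int>)\<close>, as a sum of copies on the blocks
  \<open>{qp, \<dots>, qp + p - 1}\<close>: the action \<open>\<tau>\<close> rotates every block, and the weight is \<open>t\<close> to the number of times
  that the end of the block is passed. This avoids a separate construction for a dimension which depends on the
  point; the block \<open>q = 0\<close> is cut out afterwards.\<close>

lemma cyclic_orbit: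
  assumes p: "0 < p" "iter_int \<sigma> p y = y" and t: "cmod t = 1"
  shows "orbit_data \<sigma> \<iota> \<delta> (\<lambda>i. iter_int \<sigma> i y) (\<lambda>n i. (i div p) * p + (i + n) mod p)
    (\<lambda>n i. t powi (i div p - (i - n) div p))"
proof (intro orbit_data.intro orbit_data_axioms.intro crossed_prod_axioms)
  fix n k i :: int
  have t0: "t \<noteq> 0" using t by auto
  have block: "(q * p + r mod p) div p = q" for q r using p(1) by simp
  have inblock: "(q * p + r mod p + s) mod p = (r + s) mod p" for q r s
    by (metis mod_add_left_eq mod_mult_self3 mod_mod_trivial add.commute)
  show "i div p * p + (i + 0) mod p = i" by simp
  show "i div p * p + (i + (n + k)) mod p
      = (i div p * p + (i + k) mod p) div p * p + (i div p * p + (i + k) mod p + n) mod p"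
    by (simp only: block inblock) (simp only: ac_simps)
  have per: "iter_int \<sigma> (q * p + r) y = iter_int \<sigma> r y" for q r
    using iter_mult[OF p(2), of q] iter_add[of r "q * p" y] by (simp add: add.commute)
  have "iter_int \<sigma> (i div p * p + (i + n) mod p) y = iter_int \<sigma> (i + n) y"
    using per[of "i div p" "(i + n) mod p"] per[of "(i + n) div p" "(i + n) mod p"] by simp
  then show "iter_int \<sigma> (i div p * p + (i + n) mod p) y = iter_int \<sigma> n (iter_int \<sigma> i y)"
    by (simp add: iter_add[symmetric] add.commute)
  show "cmod (t powi (i div p - (i - n) div p)) = 1" by (simp add: norm_power_int t)
  have "(i div p * p + (i + - n) mod p - k) div p = i div p + (i - n - k) div p - (i - n) div p"
  proof -
    have e: "i div p * p + (i + - n) mod p - k = (i div p - (i - n) div p) * p + (i - n - k)"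
      using div_mult_mod_eq[of "i - n" p] by (simp add: algebra_simps)
    have "((i div p - (i - n) div p) * p + (i - n - k)) div p = (i div p - (i - n) div p) + (i - n - k) div p"
      using p(1) by (intro div_mult_self3) simp
    then show ?thesis unfolding e by simp
  qed
  then show "t powi (i div p - (i - (n + k)) div p)
      = t powi (i div p - (i - n) div p) *
        t powi ((i div p * p + (i + - n) mod p) div p - (i div p * p + (i + - n) mod p - k) div p)"
    using t0 by (simp add: block power_int_add[symmetric] diff_diff_eq)
qed

text \<open>The block \<open>{0, \<dots>, p - 1}\<close> spans a reducing subspace of the representation by rotations of
  blocks.\<close>

lemma cyclic_orbit_rep:
  assumes p: "0 < p" "iter_int \<sigma> p y = y" and t: "cmod t = 1"
  obtains R where "hilbert_rep (coord_subspace {0..<p}) R"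
    "\<And>f i. f \<in> CX \<Longrightarrow> i \<in> {0..<p} \<Longrightarrow> R (\<iota> f) (ell2_basis i) = f (iter_int \<sigma> i y) *\<^sub>C ell2_basis i"
    "\<And>j. j \<in> {0..p - 2} \<Longrightarrow> R \<delta> (ell2_basis j) = ell2_basis (j + 1)"
    "R \<delta> (ell2_basis (p - 1)) = t *\<^sub>C ell2_basis 0"
proof -
  interpret orbit_data \<sigma> \<iota> \<delta> "\<lambda>i. iter_int \<sigma> i y" "\<lambda>n i. (i div p) * p + (i + n) mod p"
    "\<lambda>n i. t powi (i div p - (i - n) div p)"
    by (rule cyclic_orbit[OF assms])
  interpret O: hilbert_representation UNIV orbit_rep by unfold_locales (rule hilbert_rep_orbit_rep)
  define H where "H = coord_subspace {0..<p}"
  have H: "closed_csubspace H" unfolding H_def by (rule closed_csubspace_coord_subspace)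
  have total_H: "total a v \<in> H" if a: "a \<in> fin_fams" and v: "v \<in> H" for a v
    unfolding H_def coord_subspace_def
  proof (intro CollectI allI impI)
    fix i assume "i \<notin> {0..<p}"
    then have "i div p \<noteq> 0" using p(1) by (auto simp: zdiv_eq_0_iff)
    moreover have "(i div p * p + (i + - n) mod p) div p = i div p" for n using p(1) by simp
    ultimately have "i div p * p + (i + - n) mod p \<notin> {0..<p}" for n
      by (metis atLeastLessThan_iff div_pos_pos_trivial)
    then have "coord v (i div p * p + (i + - n) mod p) = 0" for n
      using v by (simp add: H_def coord_subspace_def)
    then show "coord (total a v) i = 0"
      using a by (simp add: total_def blinfun.sum_left coord_sum coord_weighted_shift_op fin_famsD)
  qed
  have orbit_rep_H: "orbit_rep b v \<in> H" if v: "v \<in> H" for b v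
  proof (induction b rule: dense_induct)
    case (1 a)
    then show ?case using total_H[OF _ v] by (simp add: orbit_rep_def extension_fin)
  next
    case (2 g b)
    have "closed H" using H by (simp add: closed_csubspace_def)
    then show ?case using 2(1) O.tendsto_a[OF 2(2)] by (rule closed_sequentially)
  qed
  define R where "R = (\<lambda>a v. if v \<in> H then orbit_rep a v else 0)"
  have hr: "hilbert_rep H R"
    unfolding hilbert_rep_def
  proof (intro conjI allI ballI)
    show "closed_csubspace H" by (rule H)
    fix a
    obtain K where K: "\<And>v. norm (orbit_rep a v) \<le> K * norm v" using O.bounded[of a] by blast
    have "\<exists>K. \<forall>v\<in>H. norm (R a v) \<le> K * norm v" by (rule exI[of _ K]) (simp add: R_def K)
    then show "R a \<in> bounded_ops H"
      using H by (simp add: bounded_ops_def R_def orbit_rep_H O.add_v O.scaleC_v closed_csubspace_def)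
  qed (simp_all add: R_def orbit_rep_H O.add_a O.scaleC_a O.mult_a O.one_a O.star_a)
  have RO: "R a (ell2_basis i) = orbit_rep a (ell2_basis i)" if "i \<in> {0..<p}" for a i
    using that by (simp add: R_def H_def)
  show ?thesis
  proof (rule that)
    show "hilbert_rep (coord_subspace {0..<p}) R" using hr by (simp add: H_def)
    show "R (\<iota> f) (ell2_basis i) = f (iter_int \<sigma> i y) *\<^sub>C ell2_basis i" if "f \<in> CX" "i \<in> {0..<p}" for f i
      unfolding RO[OF that(2)] by (rule orbit_rep_\<iota>[OF that(1)])
    show "R \<delta> (ell2_basis j) = ell2_basis (j + 1)" if "j \<in> {0..p - 2}" for j
      using that by (subst RO) (simp_all add: orbit_rep_\<delta> div_pos_pos_trivial mod_pos_pos_trivial)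
    show "R \<delta> (ell2_basis (p - 1)) = t *\<^sub>C ell2_basis 0"
    proof -
      have "(- 1) div p = - 1" using p(1) by (rule div_eq_minus1)
      then show ?thesis using p(1) by (subst RO) (simp_all add: orbit_rep_\<delta> div_pos_pos_trivial)
    qed
  qed
qed

lemma aperiodic_rep:
  "hilbert_rep UNIV (aperiodic_rep \<sigma> \<iota> \<delta> x)"
  "f \<in> CX \<Longrightarrow> aperiodic_rep \<sigma> \<iota> \<delta> x (\<iota> f) (ell2_basis i) = f (iter_int \<sigma> i x) *\<^sub>C ell2_basis i"
  "a \<in> fin_fams \<Longrightarrow> coord (aperiodic_rep \<sigma> \<iota> \<delta> x (fin_sum \<iota> \<delta> a) (ell2_basis i)) i = a 0 (iter_int \<sigma> i x)"
proof -
  obtain R where R: "hilbert_rep UNIV R"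
    "\<And>f i. f \<in> CX \<Longrightarrow> R (\<iota> f) (ell2_basis i) = f (iter_int \<sigma> i x) *\<^sub>C ell2_basis i"
    "\<And>i. R \<delta> (ell2_basis i) = ell2_basis (i + 1)"
    "\<And>a i. a \<in> fin_fams \<Longrightarrow> coord (R (fin_sum \<iota> \<delta> a) (ell2_basis i)) i = a 0 (iter_int \<sigma> i x)"
    by (rule free_orbit_rep[of x]) blast
  have "aperiodic_rep \<sigma> \<iota> \<delta> x = R"
    unfolding aperiodic_rep_def
  proof (rule the_equality)
    fix \<rho> assume "hilbert_rep UNIV \<rho>
      \<and> (\<forall>f\<in>CX. \<forall>i. \<rho> (\<iota> f) (ell2_basis i) = f (iter_int \<sigma> i x) *\<^sub>C ell2_basis i)
      \<and> (\<forall>i. \<rho> \<delta> (ell2_basis i) = ell2_basis (i + 1))"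
    then show "\<rho> = R"
      using R by (intro hilbert_rep_coord_eqI[of UNIV]) simp_all
  qed (use R in simp)
  with R show "hilbert_rep UNIV (aperiodic_rep \<sigma> \<iota> \<delta> x)"
    "f \<in> CX \<Longrightarrow> aperiodic_rep \<sigma> \<iota> \<delta> x (\<iota> f) (ell2_basis i) = f (iter_int \<sigma> i x) *\<^sub>C ell2_basis i"
    "a \<in> fin_fams \<Longrightarrow> coord (aperiodic_rep \<sigma> \<iota> \<delta> x (fin_sum \<iota> \<delta> a) (ell2_basis i)) i = a 0 (iter_int \<sigma> i x)"
    by simp_all
qed

lemma periodic_rep:
  assumes y: "periodic \<sigma> y" and t: "cmod t = 1"
  defines "I \<equiv> {0..<int (least_period \<sigma> y)}"
  shows "hilbert_rep (coord_subspace I) (periodic_rep \<sigma> \<iota> \<delta> y t)"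
    and "f \<in> CX \<Longrightarrow> i \<in> I \<Longrightarrow>
      periodic_rep \<sigma> \<iota> \<delta> y t (\<iota> f) (ell2_basis i) = f (iter_int \<sigma> i y) *\<^sub>C ell2_basis i"
proof -
  define p where "p = int (least_period \<sigma> y)"
  have I: "I = {0..<p}" by (simp add: I_def p_def)
  have p: "0 < p" "iter_int \<sigma> p y = y" using least_period[OF y] by (auto simp: p_def)
  obtain R where R: "hilbert_rep (coord_subspace {0..<p}) R"
    "\<And>f i. f \<in> CX \<Longrightarrow> i \<in> {0..<p} \<Longrightarrow> R (\<iota> f) (ell2_basis i) = f (iter_int \<sigma> i y) *\<^sub>C ell2_basis i"
    "\<And>j. j \<in> {0..p - 2} \<Longrightarrow> R \<delta> (ell2_basis j) = ell2_basis (j + 1)"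
    "R \<delta> (ell2_basis (p - 1)) = t *\<^sub>C ell2_basis 0"
    by (rule cyclic_orbit_rep[OF p t]) blast
  have cover: "j \<in> {0..p - 2} \<or> j = p - 1" if "j \<in> {0..<p}" for j using that by auto
  have "periodic_rep \<sigma> \<iota> \<delta> y t = R"
    unfolding periodic_rep_def Let_def fin_hilbert_eq p_def[symmetric]
  proof (rule the_equality)
    fix \<rho> assume r: "hilbert_rep (coord_subspace {0..<p}) \<rho>
      \<and> (\<forall>f\<in>CX. \<forall>i\<in>{0..p - 1}. \<rho> (\<iota> f) (ell2_basis i) = f (iter_int \<sigma> i y) *\<^sub>C ell2_basis i)
      \<and> (\<forall>j\<in>{0..p - 2}. \<rho> \<delta> (ell2_basis j) = ell2_basis (j + 1))
      \<and> \<rho> \<delta> (ell2_basis (p - 1)) = t *\<^sub>C ell2_basis 0"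
    show "\<rho> = R"
    proof (rule hilbert_rep_coord_eqI[of "{0..<p}"])
      show "\<rho> \<delta> (ell2_basis i) = R \<delta> (ell2_basis i)" if "i \<in> {0..<p}" for i
        using cover[OF that] r R(3,4) by auto
    qed (use r R in auto)
  qed (use R in auto)
  with R show "hilbert_rep (coord_subspace I) (periodic_rep \<sigma> \<iota> \<delta> y t)"
    and "f \<in> CX \<Longrightarrow> i \<in> I \<Longrightarrow>
      periodic_rep \<sigma> \<iota> \<delta> y t (\<iota> f) (ell2_basis i) = f (iter_int \<sigma> i y) *\<^sub>C ell2_basis i"
    by (simp_all add: I)
qed

text \<open>Evaluated at \<open>x\<close>, the projection is the matrix entry at \<open>e\<^sub>0\<close> of the representation along the orbit
  of \<open>x\<close>. Contractivity makes the resulting function of \<open>x\<close> a uniform limit of continuous functions.\<close>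

lemma cond_exp:
  shows cond_exp_CX: "cond_exp \<iota> \<delta> a \<in> CX"
    and cond_exp_add: "cond_exp \<iota> \<delta> (a + b) x = cond_exp \<iota> \<delta> a x + cond_exp \<iota> \<delta> b x"
    and cond_exp_le: "cmod (cond_exp \<iota> \<delta> a x) \<le> norm a"
    and cond_exp_fin: "fam \<in> fin_fams \<Longrightarrow> cond_exp \<iota> \<delta> (fin_sum \<iota> \<delta> fam) = fam 0"
proof -
  define P where "P = (\<lambda>E. (\<forall>a. E a \<in> CX)
     \<and> (\<forall>a b x. E (a + b) x = E a x + E b x)
     \<and> (\<forall>c a x. E (c *\<^sub>C a) x = c * E a x)
     \<and> (\<forall>a x. cmod (E a x) \<le> norm a)
     \<and> (\<forall>a\<in>fin_fams. E (fin_sum \<iota> \<delta> a) = a 0))"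
  define E where "E = (\<lambda>a x. coord (aperiodic_rep \<sigma> \<iota> \<delta> x a (ell2_basis 0)) 0)"
  have norm_basis: "norm (ell2_basis 0 :: int ell2) \<le> 1"
  proof (rule norm_ell2_le)
    show "(\<Sum>j\<in>F. (cmod (coord (ell2_basis 0) j))\<^sup>2) \<le> 1\<^sup>2" if "finite F" for F :: "int set"
      using that by (simp add: coord_basis if_distrib[of cmod] if_distrib[of "\<lambda>r. r\<^sup>2"] sum.delta cong: if_cong)
  qed simp
  have hr: "hilbert_representation UNIV (aperiodic_rep \<sigma> \<iota> \<delta> x)" for x
    by unfold_locales (rule aperiodic_rep)
  note lin = hilbert_representation.add_a[OF hr] hilbert_representation.scaleC_a[OF hr]
  have E_add: "E (a + b) x = E a x + E b x" and E_scale: "E (c *\<^sub>C a) x = c * E a x" for a b c x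
    by (simp_all add: E_def lin)
  have E_le: "cmod (E a x) \<le> norm a" for a x
  proof -
    have "cmod (E a x) \<le> norm (aperiodic_rep \<sigma> \<iota> \<delta> x a (ell2_basis 0))"
      unfolding E_def by (rule coord_le_norm)
    also have "\<dots> \<le> norm a * norm (ell2_basis 0 :: int ell2)"
      by (rule hilbert_representation.contractive[OF hr])
    also have "\<dots> \<le> norm a * 1" using norm_basis by (rule mult_left_mono) simp
    finally show ?thesis by simp
  qed
  have E_fin: "E (fin_sum \<iota> \<delta> a) = a 0" if "a \<in> fin_fams" for a
    using aperiodic_rep(3)[OF that, of _ 0] by (auto simp: E_def)
  have diff: "F a x - F b x = F (a - b) x" if "\<And>a b x. F (a + b) x = F a x + F b x"
    for F :: "'a \<Rightarrow> 'x \<Rightarrow> complex" and a b x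
    using that[of "a - b" b x] by simp
  have E_CX: "E b \<in> CX" for b
  proof -
    obtain f where f: "\<And>k. f k \<in> fin_fams" "(\<lambda>k. fin_sum \<iota> \<delta> (f k)) \<longlonglongrightarrow> b" using approximable by metis
    have "uniform_limit UNIV (\<lambda>k. f k 0) (E b) sequentially"
    proof (rule uniform_limitI)
      fix e :: real assume "0 < e"
      then have "\<forall>\<^sub>F k in sequentially. dist (fin_sum \<iota> \<delta> (f k)) b < e" by (rule tendstoD[OF f(2)])
      then show "\<forall>\<^sub>F k in sequentially. \<forall>x\<in>UNIV. dist (f k 0 x) (E b x) < e"
      proof (eventually_elim, intro ballI)
        fix k x assume k: "dist (fin_sum \<iota> \<delta> (f k)) b < e"
        have "dist (f k 0 x) (E b x) = cmod (E (fin_sum \<iota> \<delta> (f k) - b) x)"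
          by (simp add: dist_norm diff[of E, OF E_add, symmetric] E_fin f)
        then show "dist (f k 0 x) (E b x) < e" using E_le[of "fin_sum \<iota> \<delta> (f k) - b" x] k by (simp add: dist_norm)
      qed
    qed
    moreover have "\<forall>\<^sub>F k in sequentially. continuous_on UNIV (f k 0)"
      using fin_famsD(1)[OF f(1), of _ 0] by (simp add: CX_def)
    ultimately show ?thesis
      unfolding CX_def by (auto intro: uniform_limit_theorem)
  qed
  have PE: "P E" by (simp add: P_def E_CX E_add E_scale E_le E_fin)
  have "cond_exp \<iota> \<delta> = E"
    unfolding cond_exp_def P_def[symmetric]
  proof (rule the_equality)
    show "P E" by (rule PE)
  next
    fix G assume G: "P G"
    show "G = E"
    proof (intro ext)
      fix b x
      obtain f where f: "\<And>k. f k \<in> fin_fams" "(\<lambda>k. fin_sum \<iota> \<delta> (f k)) \<longlonglongrightarrow> b"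
        using approximable by metis
      have 0: "(\<lambda>k. norm (fin_sum \<iota> \<delta> (f k) - b)) \<longlonglongrightarrow> 0"
        using f(2) by (intro tendsto_norm_zero) (simp add: Lim_null[symmetric])
      have lim: "(\<lambda>k. f k 0 x) \<longlonglongrightarrow> H b x" if H: "P H" for H
      proof (rule Lim_null[THEN iffD2, OF Lim_null_comparison[OF _ 0]], rule always_eventually, rule allI)
        fix k
        have "f k 0 x - H b x = H (fin_sum \<iota> \<delta> (f k) - b) x"
          using H f(1)[of k] diff[of H "fin_sum \<iota> \<delta> (f k)" x b] by (simp add: P_def)
        then show "norm (f k 0 x - H b x) \<le> norm (fin_sum \<iota> \<delta> (f k) - b)"
          using H by (simp add: P_def)
      qed
      show "G b x = E b x" by (rule LIMSEQ_unique[OF lim[OF G] lim[OF PE]])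
    qed
  qed
  then show "cond_exp \<iota> \<delta> a \<in> CX" "cond_exp \<iota> \<delta> (a + b) x = cond_exp \<iota> \<delta> a x + cond_exp \<iota> \<delta> b x"
    "cmod (cond_exp \<iota> \<delta> a x) \<le> norm a"
    "fam \<in> fin_fams \<Longrightarrow> cond_exp \<iota> \<delta> (fin_sum \<iota> \<delta> fam) = fam 0"
    by (simp_all add: E_CX E_add E_scale E_le E_fin)
qed

end

section \<open>Fejer means\<close>

text \<open>Averages over the \<open>M\<close>-th roots of unity replace integrals over the circle; they pick out the
  constant term of Laurent polynomials of degree less than \<open>M\<close>.\<close>

lemma sum_roots_of_unity_powi:
  assumes "0 < M" "\<bar>n\<bar> < int M"
  shows "(\<Sum>j<M. cis (2 * pi * real j / real M) powi n) = (if n = 0 then of_nat M else 0)"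
proof (cases "n = 0")
  case False
  define q where "q = cis (2 * pi * n / M)"
  have "cis (2 * pi * real j / real M) powi n = q ^ j" for j
    by (simp add: q_def cis_power_int Complex.DeMoivre mult_ac)
  moreover have "q ^ M = 1"
    using assms(1) cis_multiple_2pi[of n] by (simp add: q_def Complex.DeMoivre mult_ac)
  moreover have "q \<noteq> 1"
  proof
    assume "q = 1"
    then have "cos (2 * pi * n / M) = 1" by (simp add: q_def complex_eq_iff)
    then obtain k :: int where "2 * pi * n / M = real_of_int k * 2 * pi"
      unfolding cos_one_2pi_int by blast
    then have "real_of_int n = real_of_int (k * int M)" using assms(1) by (simp add: field_simps)
    then have "n = k * int M" using of_int_eq_iff by blast
    with False assms(2) show False by (auto simp: abs_mult)
  qed
  ultimately show ?thesis using False by (simp add: geometric_sum)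
qed simp

definition fejer_coeff :: "nat \<Rightarrow> int \<Rightarrow> real" where
  "fejer_coeff N n = max 0 (1 - \<bar>n\<bar> / N)"

text \<open>The squared Dirichlet sum \<open>w\<close> is \<open>N\<close> times the Fejer kernel. Its \<open>n\<close>-th coefficient is the number of
  pairs \<open>(k, l)\<close> in \<open>[0, N)\<^sup>2\<close> with \<open>l = k + n\<close>. The bound on \<open>M\<close> excludes aliasing.\<close>

lemma fejer_kernel_coeff:
  fixes w :: "nat \<Rightarrow> real"
  assumes N: "0 < N" and M: "\<bar>n\<bar> + int N < int M"
  defines "w \<equiv> \<lambda>j::nat. (cmod (\<Sum>k=0..<int N. cis (2 * pi * real j / real M) powi k))\<^sup>2"
  shows "(\<Sum>j<M. of_real (w j) * cis (2 * pi * real j / real M) powi n) = of_real (real M * real N * fejer_coeff N n)"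
proof -
  let ?K = "{0..<int N}"
  have M0: "0 < M" using M by linarith
  have w: "complex_of_real (w j) * cis (2 * pi * real j / real M) powi n
      = (\<Sum>k\<in>?K. \<Sum>l\<in>?K. cis (2 * pi * real j / real M) powi (k - l + n))" for j
  proof -
    define z where "z = cis (2 * pi * real j / real M)"
    have z: "z \<noteq> 0" "cnj (z powi l) = z powi (- l)" for l
      by (simp_all add: z_def cis_power_int cis_cnj)
    have "complex_of_real (w j) = (\<Sum>k\<in>?K. z powi k) * (\<Sum>l\<in>?K. z powi (- l))"
      by (simp only: w_def z_def[symmetric] complex_norm_square cnj_sum z(2))
    moreover have "z powi k * z powi (- l) * z powi n = z powi (k - l + n)" for k l
      by (simp only: power_int_add[symmetric] z(1) simp_thms disj_ac diff_conv_add_uminus)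
    ultimately show ?thesis
      unfolding z_def[symmetric] by (simp only: sum_distrib_left sum_distrib_right) (rule sum.swap)
  qed
  have "(\<Sum>j<M. of_real (w j) * cis (2 * pi * real j / real M) powi n)
      = (\<Sum>k\<in>?K. \<Sum>l\<in>?K. \<Sum>j<M. cis (2 * pi * real j / real M) powi (k - l + n))"
    unfolding w by (subst sum.swap, intro sum.cong refl sum.swap)
  also have "\<dots> = (\<Sum>k\<in>?K. \<Sum>l\<in>?K. if l = k + n then of_nat M else 0)"
    using M by (intro sum.cong refl, subst sum_roots_of_unity_powi[OF M0]) auto
  also have "\<dots> = (\<Sum>k\<in>?K. if k + n \<in> ?K then of_nat M else 0)" by simp
  also have "\<dots> = of_nat M * of_nat (card (?K \<inter> {k. k + n \<in> ?K}))" by (simp add: sum.If_cases)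
  also have "?K \<inter> {k. k + n \<in> ?K} = {max 0 (- n)..<min (int N) (int N - n)}" by auto
  also have "card \<dots> = nat (int N - \<bar>n\<bar>)" by (simp add: min_def max_def)
  also have "complex_of_nat M * of_nat (nat (int N - \<bar>n\<bar>)) = of_real (real M * real N * fejer_coeff N n)"
  proof -
    have "real (nat (int N - \<bar>n\<bar>)) = N * fejer_coeff N n"
      using N by (auto simp: fejer_coeff_def max_def field_simps of_nat_nat)
    then have "complex_of_real (real (nat (int N - \<bar>n\<bar>))) = of_real (N * fejer_coeff N n)" by simp
    then show ?thesis by (simp add: mult.assoc)
  qed
  finally show ?thesis .
qed

context crossed_prod
begin

lemma fin_sum_scaled:
  assumes a: "a \<in> fin_fams"
  shows "fin_sum \<iota> \<delta> (\<lambda>n x. c n * a n x) = (\<Sum>n\<in>fam_supp a. c n *\<^sub>C (\<iota> (a n) * U n))"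
proof -
  have "fin_sum \<iota> \<delta> (\<lambda>n x. c n * a n x) = (\<Sum>n\<in>fam_supp a. \<iota> (\<lambda>x. c n * a n x) * U n)"
    using a by (intro fin_sum_on fin_famsD) (auto simp: fam_supp_def)
  then show ?thesis using a by (simp add: \<iota>_scale fin_famsD scaleC_mult_left)
qed

lemma gauge_contractive:
  assumes "cmod t = 1" and a: "a \<in> fin_fams"
  shows "norm (fin_sum \<iota> \<delta> (\<lambda>n x. t powi n * a n x)) \<le> norm (fin_sum \<iota> \<delta> a)"
proof -
  interpret g: covariant_extension \<sigma> \<iota> \<delta> "\<lambda>f n. (t powi n) *\<^sub>C (\<iota> f * U n)" "(*)" "\<lambda>S T. T = star S"
    by (intro covariant_extension.intro crossed_prod_axioms gauge_covariant assms)
  show ?thesis using g.norm_total_le[OF a] by (simp add: fin_sum_scaled[OF a] g.total_def)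
qed

text \<open>The Cesaro mean is a convex combination of the images of the finite sum under the gauge action,
  because the Fejer kernel is positive with total mass one; and the gauge action is contractive.\<close>

lemma fejer_contractive:
  assumes N: "0 < N" and a: "a \<in> fin_fams"
  shows "norm (fin_sum \<iota> \<delta> (\<lambda>n x. of_real (fejer_coeff N n) * a n x)) \<le> norm (fin_sum \<iota> \<delta> a)"
proof -
  obtain L where L: "\<And>n. n \<in> fam_supp a \<Longrightarrow> \<bar>n\<bar> \<le> L"
    using fin_famsD(2)[OF a] by (metis (no_types) bdd_above_finite bdd_above.E finite_imageI image_eqI)
  \<comment> \<open>More roots of unity than the degree of \<open>a\<close> plus that of the kernel, so that no aliasing occurs;
    \<open>0\<close> is included below since its coefficient is the total mass of the kernel.\<close>
  define M where "M = nat (max 0 L + int N + 1)"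
  have M: "\<bar>n\<bar> + int N < int M" if "n \<in> insert 0 (fam_supp a)" for n
    using that L[of n] by (auto simp: M_def)
  have M0: "0 < M" using M[of 0] by simp
  define z where "z = (\<lambda>j::nat. cis (2 * pi * real j / real M))"
  define w where "w = (\<lambda>j. (cmod (\<Sum>k=0..<int N. z j powi k))\<^sup>2)"
  have kernel: "(\<Sum>j<M. of_real (w j) * z j powi n) = of_real (real M * real N * fejer_coeff N n)"
    if "n \<in> insert 0 (fam_supp a)" for n
    unfolding w_def z_def by (rule fejer_kernel_coeff[OF N M[OF that]])
  have w0: "w j \<ge> 0" for j by (simp add: w_def)
  have "complex_of_real (\<Sum>j<M. w j) = complex_of_real (real M * real N)"
    using kernel[of 0] by (simp add: fejer_coeff_def)
  then have mass: "(\<Sum>j<M. w j) = real M * real N" using of_real_eq_iff by blast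
  let ?G = "\<lambda>t. fin_sum \<iota> \<delta> (\<lambda>n x. t powi n * a n x)"
  have "(\<Sum>j<M. of_real (w j) *\<^sub>C ?G (z j))
      = (\<Sum>n\<in>fam_supp a. (\<Sum>j<M. of_real (w j) * z j powi n) *\<^sub>C (\<iota> (a n) * U n))"
    by (simp add: fin_sum_scaled[OF a] scaleC_sum_right scaleC_sum_left scaleC_scaleC) (rule sum.swap)
  also have "\<dots> = (\<Sum>n\<in>fam_supp a. of_real (real M * real N) *\<^sub>C of_real (fejer_coeff N n) *\<^sub>C (\<iota> (a n) * U n))"
    by (intro sum.cong refl) (simp add: kernel scaleC_scaleC)
  also have "\<dots> = of_real (real M * real N) *\<^sub>C fin_sum \<iota> \<delta> (\<lambda>n x. of_real (fejer_coeff N n) * a n x)"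
    by (simp only: fin_sum_scaled[OF a] scaleC_sum_right)
  finally have "real M * real N * norm (fin_sum \<iota> \<delta> (\<lambda>n x. of_real (fejer_coeff N n) * a n x))
      = norm (\<Sum>j<M. of_real (w j) *\<^sub>C ?G (z j))"
    by (simp add: norm_scaleC norm_mult)
  also have "\<dots> \<le> (\<Sum>j<M. w j * norm (fin_sum \<iota> \<delta> a))"
  proof (rule sum_norm_le)
    fix j
    have "cmod (z j) = 1" by (simp add: z_def)
    then show "norm (of_real (w j) *\<^sub>C ?G (z j)) \<le> w j * norm (fin_sum \<iota> \<delta> a)"
      using w0[of j] by (simp add: norm_scaleC mult_left_mono gauge_contractive[OF _ a])
  qed
  also have "\<dots> = real M * real N * norm (fin_sum \<iota> \<delta> a)" by (simp add: sum_distrib_right[symmetric] mass)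
  finally show ?thesis using M0 N by simp
qed

section \<open>Fourier coefficients\<close>

lemma norm_unitary_\<iota>:
  assumes u: "u \<in> CX" and 1: "\<And>x. cmod (u x) = 1"
  shows "norm (\<iota> u) = 1"
proof -
  have "star (\<iota> u) * \<iota> u = \<iota> (\<lambda>x. cnj (u x) * u x)" by (simp add: \<iota>_mult CX_cnj u \<iota>_cnj)
  also have "(\<lambda>x. cnj (u x) * u x) = (\<lambda>_. 1)"
  proof
    show "cnj (u x) * u x = 1" for x
      using complex_norm_square[of "u x"] 1[of x] by (simp add: mult.commute)
  qed
  finally have "(norm (\<iota> u))\<^sup>2 = 1" by (simp add: \<iota>_one cstar_identity[symmetric])
  then show ?thesis using norm_ge_zero[of "\<iota> u"] by (auto simp: power2_eq_1_iff)
qed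

text \<open>A real function bounded by one is the real part of the unitary \<open>g + i \<surd>(1 - g\<^sup>2)\<close>, and unitaries have norm
  one.\<close>

lemma \<iota>_real_contractive:
  assumes g: "continuous_on UNIV g" and 1: "\<And>x. \<bar>g x\<bar> \<le> (1::real)"
  shows "norm (\<iota> (\<lambda>x. of_real (g x))) \<le> 1"
proof -
  define u where "u = (\<lambda>x. Complex (g x) (sqrt (1 - (g x)\<^sup>2)))"
  have u: "u \<in> CX" unfolding u_def CX_def Complex_eq
    using g by (auto intro!: continuous_intros)
  have "(g x)\<^sup>2 \<le> 1" for x using 1[of x] by (simp add: abs_square_le_1)
  then have u1: "cmod (u x) = 1" for x by (simp add: u_def cmod_def)
  have "(\<lambda>x. complex_of_real (g x)) = (\<lambda>x. (1/2) * (u x + cnj (u x)))"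
    by (auto simp: u_def complex_eq_iff)
  then have "\<iota> (\<lambda>x. of_real (g x)) = (1/2) *\<^sub>C (\<iota> u + \<iota> (\<lambda>x. cnj (u x)))"
    by (simp only: \<iota>_scale \<iota>_add u CX_cnj CX_add)
  also have "norm \<dots> \<le> (1/2) * (norm (\<iota> u) + norm (\<iota> (\<lambda>x. cnj (u x))))"
    by (simp add: norm_scaleC norm_triangle_ineq)
  also have "\<dots> = 1" using norm_unitary_\<iota>[OF u u1] norm_unitary_\<iota>[OF CX_cnj[OF u]] u1 by simp
  finally show ?thesis .
qed

text \<open>The C*-identity reduces this to the nonnegative function \<open>\<bar>f\<bar>\<^sup>2 / K\<^sup>2\<close>.\<close>

lemma \<iota>_contractive:
  assumes f: "f \<in> CX" and K: "0 < K" "\<And>x. cmod (f x) \<le> K"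
  shows "norm (\<iota> f) \<le> K"
proof (rule power2_le_imp_le)
  define g where "g = (\<lambda>x. (cmod (f x) / K)\<^sup>2)"
  have g: "continuous_on UNIV g" using f K(1) unfolding g_def CX_def by (auto intro!: continuous_intros)
  have g1: "\<bar>g x\<bar> \<le> 1" for x
    using K(1) K(2)[of x] by (simp add: g_def power_le_one)
  have gC: "(\<lambda>x. complex_of_real (g x)) \<in> CX" using g by (auto simp: CX_def intro!: continuous_intros)
  have "star (\<iota> f) * \<iota> f = \<iota> (\<lambda>x. cnj (f x) * f x)" by (simp add: \<iota>_mult CX_cnj f \<iota>_cnj)
  also have "(\<lambda>x. cnj (f x) * f x) = (\<lambda>x. of_real (K\<^sup>2) * of_real (g x))"
    using K(1) complex_norm_square by (auto simp: g_def power_divide mult.commute)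
  finally have "(norm (\<iota> f))\<^sup>2 = norm (complex_of_real (K\<^sup>2) *\<^sub>C \<iota> (\<lambda>x. of_real (g x)))"
    by (simp only: \<iota>_scale[OF gC] cstar_identity[symmetric])
  also have "\<dots> \<le> K\<^sup>2 * 1" unfolding norm_scaleC norm_of_real using \<iota>_real_contractive[OF g g1]
    by (intro mult_mono) auto
  finally show "(norm (\<iota> f))\<^sup>2 \<le> K\<^sup>2" by simp
qed (use K in simp)

lemma norm_U_le: "norm (U n) \<le> 1"
proof -
  have "(norm (U n))\<^sup>2 = 1" using U_add[of "- n" n] by (simp add: cstar_identity[symmetric] U_star)
  then show ?thesis using norm_ge_zero[of "U n"] by (auto simp: power2_eq_1_iff)
qed

abbreviation F :: "'a \<Rightarrow> int \<Rightarrow> 'x \<Rightarrow> complex" where "F \<equiv> fourier \<iota> \<delta>"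

lemma fourier_add: "F (a + b) n x = F a n x + F b n x"
  by (simp add: fourier_def distrib_right cond_exp_add)

lemma fourier_diff: "F (a - b) n x = F a n x - F b n x"
  using fourier_add[of "a - b" b n x] by simp

lemma fourier_CX: "F a n \<in> CX"
  by (simp add: fourier_def cond_exp_CX)

lemma fourier_le: "cmod (F a n x) \<le> norm a"
proof -
  have "cmod (F a n x) \<le> norm (a * U (- n))" unfolding fourier_def by (rule cond_exp_le)
  also have "\<dots> \<le> norm a * norm (U (- n))" by (rule norm_mult_ineq)
  also have "\<dots> \<le> norm a * 1" by (intro mult_left_mono norm_U_le) simp
  finally show ?thesis by simp
qed

lemma fam_mult_single_right:
  assumes "a \<in> fin_fams"
  shows "fam_mult \<sigma> a (single f j) n x = a (n - j) x * f (iter_int \<sigma> (j - n) x)"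
proof -
  have "fam_mult \<sigma> a (single f j) n x
      = (\<Sum>k\<in>fam_supp a. if k = n - j then a k x * f (iter_int \<sigma> (- k) x) else 0)"
    unfolding fam_mult_alt by (intro sum.cong) (auto simp: single_def)
  also have "\<dots> = a (n - j) x * f (iter_int \<sigma> (j - n) x)"
    using assms by (simp add: fin_famsD) (simp add: fam_supp_def)
  finally show ?thesis .
qed

lemma fam_mult_single_left: "fam_mult \<sigma> (single f 0) b n x = f x * b n x"
proof -
  have "fam_supp (single f 0) = (if f = (\<lambda>_. 0) then {} else {0})"
    by (auto simp: fam_supp_def single_def)
  then show ?thesis by (simp add: fam_mult_alt single_def)
qed

lemma fourier_fin:
  assumes a: "a \<in> fin_fams"
  shows "F (fin_sum \<iota> \<delta> a) n = a n"
proof -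
  have s: "single (\<lambda>_. 1) (- n) \<in> fin_fams" by (intro single_fin CX_const)
  have "fin_sum \<iota> \<delta> a * U (- n) = fin_sum \<iota> \<delta> (fam_mult \<sigma> a (single (\<lambda>_. 1) (- n)))"
    by (simp add: alg.total_mult[OF a s] alg.total_single \<iota>_one)
  then have "F (fin_sum \<iota> \<delta> a) n = fam_mult \<sigma> a (single (\<lambda>_. 1) (- n)) 0"
    by (simp add: fourier_def cond_exp_fin fam_mult_fin[OF a s])
  also have "\<dots> = a n" by (auto simp: fam_mult_single_right[OF a])
  finally show ?thesis .
qed

lemma fourier_monomial: "f \<in> CX \<Longrightarrow> F (\<iota> f * U k) n = (if n = k then f else (\<lambda>_. 0))"
  using fourier_fin[OF single_fin, of f k n] unfolding alg.total_single by (simp add: single_def)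

lemma fourier_\<iota>: "f \<in> CX \<Longrightarrow> F (\<iota> f) n = (if n = 0 then f else (\<lambda>_. 0))"
  using fourier_monomial[of f 0 n] by simp

lemma fourier_tendsto:
  assumes "f \<longlonglongrightarrow> b"
  shows "(\<lambda>k. F (f k) n x) \<longlonglongrightarrow> F b n x"
proof (rule Lim_null[THEN iffD2], rule Lim_null_comparison)
  show "\<forall>\<^sub>F k in sequentially. norm (F (f k) n x - F b n x) \<le> norm (f k - b)"
    by (simp add: fourier_diff[symmetric] fourier_le)
  show "(\<lambda>k. norm (f k - b)) \<longlonglongrightarrow> 0"
    using assms by (intro tendsto_norm_zero) (simp add: Lim_null[symmetric])
qed

lemma \<iota>_fin_sum: "f \<in> CX \<Longrightarrow> \<iota> f = fin_sum \<iota> \<delta> (single f 0)"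
  by (simp add: alg.total_single)

lemma fourier_mult_right:
  assumes f: "f \<in> CX"
  shows "F (b * \<iota> f) n x = F b n x * f (iter_int \<sigma> (- n) x)"
proof (induction b rule: dense_induct)
  case (1 a)
  have "fin_sum \<iota> \<delta> a * \<iota> f = fin_sum \<iota> \<delta> (fam_mult \<sigma> a (single f 0))"
    using 1 f by (simp add: \<iota>_fin_sum alg.total_mult single_fin)
  then show ?case using 1 f by (simp add: fourier_fin fam_mult_fin single_fin fam_mult_single_right)
next
  case (2 g b)
  have "(\<lambda>k. F (g k * \<iota> f) n x) \<longlonglongrightarrow> F (b * \<iota> f) n x"
    by (intro fourier_tendsto tendsto_mult 2 tendsto_const)
  moreover have "(\<lambda>k. F (g k) n x * f (iter_int \<sigma> (- n) x)) \<longlonglongrightarrow> F b n x * f (iter_int \<sigma> (- n) x)"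
    by (intro fourier_tendsto tendsto_mult 2 tendsto_const)
  ultimately show ?case unfolding 2(1) by (rule LIMSEQ_unique)
qed

lemma fourier_mult_left:
  assumes f: "f \<in> CX"
  shows "F (\<iota> f * b) n x = f x * F b n x"
proof (induction b rule: dense_induct)
  case (1 a)
  have "\<iota> f * fin_sum \<iota> \<delta> a = fin_sum \<iota> \<delta> (fam_mult \<sigma> (single f 0) a)"
    using 1 f by (simp add: \<iota>_fin_sum alg.total_mult single_fin)
  then show ?case using 1 f by (simp add: fourier_fin fam_mult_fin single_fin fam_mult_single_left)
next
  case (2 g b)
  have "(\<lambda>k. F (\<iota> f * g k) n x) \<longlonglongrightarrow> F (\<iota> f * b) n x"
    by (intro fourier_tendsto tendsto_mult 2 tendsto_const)
  moreover have "(\<lambda>k. f x * F (g k) n x) \<longlonglongrightarrow> f x * F b n x"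
    by (intro fourier_tendsto tendsto_mult 2 tendsto_const)
  ultimately show ?case unfolding 2(1) by (rule LIMSEQ_unique)
qed

lemma fejer_tendsto:
  assumes a: "a \<in> fin_fams"
  shows "(\<lambda>N. fin_sum \<iota> \<delta> (\<lambda>n x. of_real (fejer_coeff N n) * a n x)) \<longlonglongrightarrow> fin_sum \<iota> \<delta> a"
proof -
  have c: "(\<lambda>N. fejer_coeff N n) \<longlonglongrightarrow> 1" for n
  proof -
    have "(\<lambda>N. max 0 (1 - \<bar>real_of_int n\<bar> * (1 / real N))) \<longlonglongrightarrow> max 0 (1 - \<bar>real_of_int n\<bar> * 0)"
      by (intro tendsto_intros lim_1_over_n)
    then show ?thesis by (simp add: fejer_coeff_def)
  qed
  have "(\<lambda>N. \<Sum>n\<in>fam_supp a. fejer_coeff N n *\<^sub>R (\<iota> (a n) * U n)) \<longlonglongrightarrow>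
      (\<Sum>n\<in>fam_supp a. 1 *\<^sub>R (\<iota> (a n) * U n))"
    by (intro tendsto_intros c)
  then show ?thesis by (simp add: fin_sum_scaled[OF a] scaleC_of_real alg.total_def)
qed

text \<open>An element is determined by its Fourier coefficients: a finite sum \<open>a\<close> near \<open>b\<close> is close to its
  Cesaro mean of some order \<open>N\<close>. With \<open>N\<close> fixed, a finite sum \<open>c\<close> much closer to \<open>b\<close> has coefficients
  which are small compared to \<open>1/N\<close>, so its mean, having fewer than \<open>2N\<close> terms, is small; and the means of \<open>a\<close> and
  \<open>c\<close> are close to each other because taking means is contractive.\<close>

lemma fourier_zero_imp_zero:
  assumes b: "\<And>n x. F b n x = 0"
  shows "b = 0"
proof -
  let ?S = "\<lambda>N a. fin_sum \<iota> \<delta> (\<lambda>n x. complex_of_real (fejer_coeff N n) * a n x)"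
  have approx: "\<exists>a\<in>fin_fams. norm (fin_sum \<iota> \<delta> a - b) < e" if "0 < e" for e
  proof -
    have "b \<in> closure (fin_sum \<iota> \<delta> ` fin_fams)" by (simp add: dense)
    then show ?thesis using that unfolding closure_approachable by (auto simp: dist_norm)
  qed
  have le: "norm b \<le> 5 * e" if e: "0 < e" for e
  proof -
    obtain a where a: "a \<in> fin_fams" "norm (fin_sum \<iota> \<delta> a - b) < e" using approx[OF e] by blast
    obtain N0 where N0: "\<And>N. N0 \<le> N \<Longrightarrow> norm (?S N a - fin_sum \<iota> \<delta> a) < e"
      using LIMSEQ_D[OF fejer_tendsto[OF a(1)] e] by blast
    define N where "N = Suc N0"
    have N: "0 < N" "norm (?S N a - fin_sum \<iota> \<delta> a) < e" using N0[of N] by (auto simp: N_def)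
    define d where "d = e / (2 * N)"
    have d: "0 < d" "d \<le> e" using e N(1) by (auto simp: d_def field_simps)
    obtain c where c: "c \<in> fin_fams" "norm (fin_sum \<iota> \<delta> c - b) < d" using approx[OF d(1)] by blast
    have cn: "cmod (c n x) \<le> d" for n x
      using fourier_le[of "fin_sum \<iota> \<delta> c - b" n x] c b by (simp add: fourier_diff fourier_fin)
    have supp: "fam_supp (\<lambda>n x. complex_of_real (fejer_coeff N n) * c n x) \<subseteq> {- int N<..<int N}"
    proof
      fix n assume "n \<in> fam_supp (\<lambda>n x. complex_of_real (fejer_coeff N n) * c n x)"
      then have "fejer_coeff N n \<noteq> 0" by (auto simp: fam_supp_def)
      then have "\<not> real N \<le> \<bar>real_of_int n\<bar>" using N(1) by (auto simp: fejer_coeff_def le_divide_eq)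
      then show "n \<in> {- int N<..<int N}" by auto
    qed
    have "norm (?S N c) = norm (\<Sum>n\<in>{- int N<..<int N}. \<iota> (\<lambda>x. complex_of_real (fejer_coeff N n) * c n x) * U n)"
      by (subst fin_sum_on[OF _ supp]) simp_all
    also have "\<dots> \<le> (\<Sum>n\<in>{- int N<..<int N}. d)"
    proof (rule sum_norm_le)
      fix n
      have r: "0 \<le> fejer_coeff N n" "fejer_coeff N n \<le> 1" by (auto simp: fejer_coeff_def)
      have le_d: "norm (\<iota> (\<lambda>x. complex_of_real (fejer_coeff N n) * c n x)) \<le> d"
      proof (rule \<iota>_contractive[OF CX_scale d(1)])
        show "c n \<in> CX" using c(1) by (rule fin_famsD)
        show "cmod (complex_of_real (fejer_coeff N n) * c n x) \<le> d" for x
          using mult_mono[OF r(2) cn[of n x]] r by (simp add: norm_mult)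
      qed
      have "norm (\<iota> (\<lambda>x. complex_of_real (fejer_coeff N n) * c n x)) * norm (U n) \<le> d * 1"
        using le_d norm_U_le d(1) by (intro mult_mono) auto
      then show "norm (\<iota> (\<lambda>x. complex_of_real (fejer_coeff N n) * c n x) * U n) \<le> d"
        by (intro order_trans[OF norm_mult_ineq]) simp
    qed
    also have "\<dots> \<le> 2 * N * d"
      using d by (simp add: mult_right_mono)
    also have "\<dots> = e" using N(1) by (simp add: d_def)
    finally have Sc: "norm (?S N c) \<le> e" .
    have "?S N a - ?S N c = ?S N (\<lambda>n x. a n x - c n x)"
      using fin_sum_diff(1)[OF fam_scale_fin[OF a(1)] fam_scale_fin[OF c(1)]] by (simp add: right_diff_distrib)
    also have "norm \<dots> \<le> norm (fin_sum \<iota> \<delta> a - fin_sum \<iota> \<delta> c)"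
      using fejer_contractive[OF N(1) fin_sum_diff(2)[OF a(1) c(1)]] by (simp add: fin_sum_diff(1)[OF a(1) c(1)])
    also have "\<dots> \<le> norm (fin_sum \<iota> \<delta> a - b) + norm (fin_sum \<iota> \<delta> c - b)"
      using norm_triangle_ineq4[of "fin_sum \<iota> \<delta> a - b" "fin_sum \<iota> \<delta> c - b"] by simp
    finally have Sac: "norm (?S N a - ?S N c) \<le> 2 * e" using a c d by simp
    have tri: "norm (- u - v + w + x) \<le> norm u + norm v + norm w + norm x" for u v w x :: 'a
      using norm_triangle_ineq[of "- u - v + w" x] norm_triangle_ineq[of "- u - v" w]
        norm_triangle_ineq4[of "- u" v] by simp
    have e: "- (A - b) - (B - A) + (B - C) + C = b" for A B C :: 'a by simp
    have "norm b \<le> norm (fin_sum \<iota> \<delta> a - b) + norm (?S N a - fin_sum \<iota> \<delta> a)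
        + norm (?S N a - ?S N c) + norm (?S N c)"
      using tri[of "fin_sum \<iota> \<delta> a - b" "?S N a - fin_sum \<iota> \<delta> a" "?S N a - ?S N c" "?S N c"]
      unfolding e .
    then show ?thesis using a(2) N(2) Sac Sc by simp
  qed
  then have "norm b \<le> 0 + e" if "0 < e" for e using that le[of "e / 5"] by simp
  then have "norm b \<le> 0" by (rule field_le_epsilon)
  then show ?thesis by simp
qed

lemma fourier_eqI: "(\<And>n x. F a n x = F b n x) \<Longrightarrow> a = b"
  using fourier_zero_imp_zero[of "a - b"] by (simp add: fourier_diff)

section \<open>The commutant of the continuous functions\<close>

lemma supp_subset_Per_iff:
  "supp (F a n) \<subseteq> Per \<sigma> n \<longleftrightarrow> (\<forall>x. F a n x \<noteq> 0 \<longrightarrow> x \<in> Per \<sigma> n)"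
proof
  assume "\<forall>x. F a n x \<noteq> 0 \<longrightarrow> x \<in> Per \<sigma> n"
  then show "supp (F a n) \<subseteq> Per \<sigma> n"
    unfolding supp_def by (intro closure_minimal closed_Per) auto
qed (use closure_subset[of "{x. F a n x \<noteq> 0}"] in \<open>auto simp: supp_def\<close>)

lemma Per_neg: "x \<in> Per \<sigma> n \<longleftrightarrow> iter_int \<sigma> (- n) x = x"
proof -
  have "iter_int \<sigma> (- k) x = x" if "iter_int \<sigma> k x = x" for k
    using iter_cancel(2)[of k x] unfolding that .
  from this[of n] this[of "- n"] show ?thesis by (auto simp: Per_def)
qed

text \<open>Comparing coefficients, \<open>a\<close> commutes with \<open>f\<close> iff \<open>a(n)(x) (f(\<sigma>\<^sup>-\<^sup>n x) - f(x)) = 0\<close> for all \<open>n\<close> and \<open>x\<close>,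
  and continuous functions separate \<open>x\<close> from \<open>\<sigma>\<^sup>-\<^sup>n x\<close> unless they are equal.\<close>

lemma commutant_iff: "a \<in> CX_commutant \<iota> \<longleftrightarrow> (\<forall>n. supp (F a n) \<subseteq> Per \<sigma> n)"
proof
  assume a: "a \<in> CX_commutant \<iota>"
  show "\<forall>n. supp (F a n) \<subseteq> Per \<sigma> n"
    unfolding supp_subset_Per_iff
  proof (intro allI impI)
    fix n x assume nz: "F a n x \<noteq> 0"
    show "x \<in> Per \<sigma> n"
    proof (rule ccontr)
      assume "x \<notin> Per \<sigma> n"
      then obtain f where f: "f \<in> CX" "f x = 1" "f (iter_int \<sigma> (- n) x) = 0"
        using CX_separates_points[of x "iter_int \<sigma> (- n) x"] by (auto simp: Per_neg)
      have "F (a * \<iota> f) n x = F (\<iota> f * a) n x" using a f(1) by (simp add: CX_commutant_def)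
      then show False using f nz by (simp add: fourier_mult_left fourier_mult_right)
    qed
  qed
next
  assume "\<forall>n. supp (F a n) \<subseteq> Per \<sigma> n"
  then have *: "iter_int \<sigma> (- n) x = x" if "F a n x \<noteq> 0" for n x
    using that by (simp add: supp_subset_Per_iff Per_neg)
  show "a \<in> CX_commutant \<iota>"
    unfolding CX_commutant_def
  proof (intro CollectI ballI fourier_eqI)
    fix f :: "'x \<Rightarrow> complex" and n x assume f: "f \<in> CX"
    show "F (a * \<iota> f) n x = F (\<iota> f * a) n x"
      using *[of n x] by (cases "F a n x = 0") (simp_all add: fourier_mult_left fourier_mult_right f)
  qed
qed

lemma \<iota>_CX_subset_commutant: "\<iota> ` CX \<subseteq> CX_commutant \<iota>"
  by (auto simp: CX_commutant_def \<iota>_mult[symmetric] mult.commute)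

text \<open>If aperiodic points are dense, then the coefficients of order \<open>n \<noteq> 0\<close> of an element of the
  commutant vanish on a dense set. If they are not dense, then by Baire's theorem some \<open>Per\<^sup>n(\<sigma>)\<close> has interior
  points, and \<open>f \<delta>\<^sup>n\<close> with a function \<open>f \<noteq> 0\<close> supported there commutes with all functions.\<close>

lemma commutant_eq_CX_iff: "CX_commutant \<iota> = \<iota> ` CX \<longleftrightarrow> topologically_free \<sigma>"
proof
  assume free: "topologically_free \<sigma>"
  have "a \<in> \<iota> ` CX" if "a \<in> CX_commutant \<iota>" for a
  proof
    show "F a 0 \<in> CX" by (rule fourier_CX)
    show "a = \<iota> (F a 0)"
    proof (rule fourier_eqI)
      fix n x
      show "F a n x = F (\<iota> (F a 0)) n x"
      proof (cases "n = 0")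
        case False
        have "{x. \<not> periodic \<sigma> x} \<subseteq> {x. F a n x = 0}"
        proof
          fix x assume x: "x \<in> {x. \<not> periodic \<sigma> x}"
          have "x \<notin> Per \<sigma> n"
            using aperiodic_inj[of x n 0] x False by (auto simp: Per_def)
          then show "x \<in> {x. F a n x = 0}"
            using that by (auto simp: commutant_iff supp_subset_Per_iff)
        qed
        moreover have "closed {x. F a n x = 0}"
          using fourier_CX[of a n] unfolding CX_def by (intro closed_Collect_eq) auto
        ultimately have "closure {x. \<not> periodic \<sigma> x} \<subseteq> {x. F a n x = 0}" by (rule closure_minimal)
        then show ?thesis using free False by (auto simp: topologically_free_def fourier_\<iota> fourier_CX)
      qed (simp add: fourier_\<iota> fourier_CX)
    qed
  qed
  then show "CX_commutant \<iota> = \<iota> ` CX" using \<iota>_CX_subset_commutant by blast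
next
  assume eq: "CX_commutant \<iota> = \<iota> ` CX"
  show "topologically_free \<sigma>"
  proof (rule ccontr)
    assume "\<not> topologically_free \<sigma>"
    then obtain n where n: "n \<ge> 1" "interior (Per \<sigma> n) \<noteq> {}" by (rule not_free_interior)
    then obtain x where x: "x \<in> interior (Per \<sigma> n)" by blast
    obtain f where f: "f \<in> CX" "f x = 1" "\<And>y. y \<in> - interior (Per \<sigma> n) \<Longrightarrow> f y = 0"
      using CX_separates_closed[of "- interior (Per \<sigma> n)" x] x by auto
    have "\<iota> f * U n \<in> CX_commutant \<iota>"
      unfolding commutant_iff supp_subset_Per_iff
      using f interior_subset[of "Per \<sigma> n"] by (auto simp: fourier_monomial)
    then obtain g where g: "g \<in> CX" "\<iota> f * U n = \<iota> g" using eq by blast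
    have "f = (\<lambda>_. 0)" using fourier_monomial[OF f(1), of n n] fourier_\<iota>[OF g(1), of n] g(2) n(1) by simp
    with f(2) show False by simp
  qed
qed

section \<open>Commutants in representations\<close>

text \<open>An operator commuting with the diagonal operators \<open>diag(f(z\<^sub>i))\<close> is diagonal, since the points \<open>z\<^sub>i\<close>
  are distinct and continuous functions separate them.\<close>

lemma diagonal_of_commute:
  assumes rep: "hilbert_rep (coord_subspace I) R"
    and R: "\<And>f i. f \<in> CX \<Longrightarrow> i \<in> I \<Longrightarrow> R (\<iota> f) (ell2_basis i) = f (z i) *\<^sub>C ell2_basis i"
    and inj: "inj_on z I" and comm: "\<And>f. f \<in> CX \<Longrightarrow> R (a * \<iota> f) = R (\<iota> f * a)"
    and i: "i \<in> I"
  shows "R a (ell2_basis i) = coord (R a (ell2_basis i)) i *\<^sub>C ell2_basis i"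
proof (rule coord_eqI)
  interpret R: hilbert_representation "coord_subspace I" R by unfold_locales (rule rep)
  fix j
  have in_H: "R a (ell2_basis i) \<in> coord_subspace I" using i by simp
  show "coord (R a (ell2_basis i)) j = coord (coord (R a (ell2_basis i)) i *\<^sub>C ell2_basis i) j"
  proof (cases "j \<in> I \<and> j \<noteq> i")
    case True
    obtain f where f: "f \<in> CX" "f (z j) = 1" "f (z i) = 0"
      using CX_separates_points[of "z j" "z i"] inj True i by (auto simp: inj_on_def)
    have f': "(\<lambda>x. cnj (f x)) \<in> CX" by (rule CX_cnj[OF f(1)])
    let ?v = "R a (ell2_basis i)"
    have "R (\<iota> f) ?v = R (\<iota> f * a) (ell2_basis i)" by (rule R.mult_a[symmetric])
    also have "\<dots> = R (a * \<iota> f) (ell2_basis i)" by (simp only: comm[OF f(1)])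
    also have "\<dots> = R a (R (\<iota> f) (ell2_basis i))" by (rule R.mult_a)
    also have "\<dots> = 0" by (simp only: R[OF f(1) i] f(3) scaleC_zero_left R.zero_v)
    finally have "R (\<iota> f) ?v = 0" .
    then have "0 = cinner (R (\<iota> f) ?v) (ell2_basis j)" by (simp only: cinner_zero_left)
    also have "\<dots> = cinner (R (star (\<iota> (\<lambda>x. cnj (f x)))) ?v) (ell2_basis j)"
      by (simp only: \<iota>_cnj[OF f', symmetric] complex_cnj_cnj)
    also have "\<dots> = cinner ?v (R (\<iota> (\<lambda>x. cnj (f x))) (ell2_basis j))"
      using in_H True by (intro R.star_a) simp_all
    also have "\<dots> = coord ?v j"
      using True by (simp only: R[OF f'] f(2) cinner_basis complex_cnj_one scaleC_one)
    finally have "coord ?v j = 0" by (rule sym)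
    then show ?thesis using True by (simp add: coord_basis)
  next
    case False
    show ?thesis
    proof (cases "j = i")
      case False
      with \<open>\<not> (j \<in> I \<and> j \<noteq> i)\<close> have "coord (R a (ell2_basis i)) j = 0"
        using in_H by (simp only: coord_subspace_def mem_Collect_eq) blast
      with False show ?thesis by (simp add: coord_basis)
    qed (simp add: coord_basis)
  qed
qed

text \<open>The last hypothesis says that the diagonal of \<open>R a\<close> is given by a continuous function; it has to
  be supplied separately for infinite and for finite orbits.\<close>

lemma commute_iff_image:
  assumes rep: "hilbert_rep (coord_subspace I) R"
    and R: "\<And>f i. f \<in> CX \<Longrightarrow> i \<in> I \<Longrightarrow> R (\<iota> f) (ell2_basis i) = f (z i) *\<^sub>C ell2_basis i"
    and inj: "inj_on z I"
    and interp: "\<exists>f\<in>CX. \<forall>i\<in>I. f (z i) = coord (R a (ell2_basis i)) i"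
  shows "(\<forall>f\<in>CX. R (a * \<iota> f) = R (\<iota> f * a)) \<longleftrightarrow> R a \<in> R ` \<iota> ` CX"
proof
  have ops: "R b \<in> bounded_ops (coord_subspace I)" for b using rep by (simp add: hilbert_rep_def)
  assume comm: "\<forall>f\<in>CX. R (a * \<iota> f) = R (\<iota> f * a)"
  obtain g where g: "g \<in> CX" "\<And>i. i \<in> I \<Longrightarrow> g (z i) = coord (R a (ell2_basis i)) i"
    using interp by blast
  have "R a = R (\<iota> g)"
  proof (rule bounded_ops_coord_subspace_eqI[OF ops ops])
    fix i assume i: "i \<in> I"
    have "R a (ell2_basis i) = coord (R a (ell2_basis i)) i *\<^sub>C ell2_basis i"
      by (rule diagonal_of_commute[OF rep R inj bspec[OF comm] i])
    then show "R a (ell2_basis i) = R (\<iota> g) (ell2_basis i)" by (simp add: R[OF g(1) i] g(2)[OF i])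
  qed
  then show "R a \<in> R ` \<iota> ` CX" using g(1) by blast
next
  interpret R: hilbert_representation "coord_subspace I" R by unfold_locales (rule rep)
  assume "R a \<in> R ` \<iota> ` CX"
  then obtain g where g: "g \<in> CX" "R a = R (\<iota> g)" by blast
  show "\<forall>f\<in>CX. R (a * \<iota> f) = R (\<iota> f * a)"
  proof (intro ballI ext)
    fix f :: "'x \<Rightarrow> complex" and v assume f: "f \<in> CX"
    have "\<iota> g * \<iota> f = \<iota> f * \<iota> g" by (simp add: \<iota>_mult[symmetric] f g mult.commute)
    then have "R (\<iota> g) (R (\<iota> f) v) = R (\<iota> f) (R (\<iota> g) v)" by (simp only: R.mult_a[symmetric])
    then show "R (a * \<iota> f) v = R (\<iota> f * a) v" by (simp only: R.mult_a g(2))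
  qed
qed

lemma aperiodic_diagonal:
  "coord (aperiodic_rep \<sigma> \<iota> \<delta> x a (ell2_basis i)) i = F a 0 (iter_int \<sigma> i x)"
proof (induction a rule: dense_induct)
  case (1 a)
  then show ?case by (simp add: aperiodic_rep fourier_fin)
next
  case (2 g b)
  interpret R: hilbert_representation UNIV "aperiodic_rep \<sigma> \<iota> \<delta> x" by unfold_locales (rule aperiodic_rep)
  have "(\<lambda>k. F (g k) 0 (iter_int \<sigma> i x)) \<longlonglongrightarrow> coord (aperiodic_rep \<sigma> \<iota> \<delta> x b (ell2_basis i)) i"
    using tendsto_coord[OF R.tendsto_a[OF 2(2)], of "ell2_basis i" i] by (simp add: 2(1))
  then show ?case using fourier_tendsto[OF 2(2)] by (rule LIMSEQ_unique)
qed

text \<open>On an infinite orbit the diagonal of the operator of \<open>a\<close> is given by the function \<open>a(0)\<close>.\<close>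

lemma aperiodic_commute_iff:
  assumes "\<not> periodic \<sigma> x"
  shows "(\<forall>f\<in>CX. aperiodic_rep \<sigma> \<iota> \<delta> x (a * \<iota> f) = aperiodic_rep \<sigma> \<iota> \<delta> x (\<iota> f * a)) \<longleftrightarrow>
    aperiodic_rep \<sigma> \<iota> \<delta> x a \<in> aperiodic_rep \<sigma> \<iota> \<delta> x ` \<iota> ` CX"
proof (rule commute_iff_image[where I = UNIV and z = "\<lambda>i. iter_int \<sigma> i x"])
  show "inj_on (\<lambda>i. iter_int \<sigma> i x) UNIV" using aperiodic_inj[OF assms] by (auto intro: injI)
  show "\<exists>f\<in>CX. \<forall>i\<in>UNIV. f (iter_int \<sigma> i x) = coord (aperiodic_rep \<sigma> \<iota> \<delta> x a (ell2_basis i)) i"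
    by (rule bexI[of _ "F a 0"]) (simp_all add: aperiodic_diagonal fourier_CX)
qed (simp_all add: aperiodic_rep)

text \<open>On a finite orbit any diagonal is interpolated by a continuous function.\<close>

lemma periodic_commute_iff:
  assumes y: "periodic \<sigma> y" and t: "cmod t = 1"
  shows "(\<forall>f\<in>CX. periodic_rep \<sigma> \<iota> \<delta> y t (a * \<iota> f) = periodic_rep \<sigma> \<iota> \<delta> y t (\<iota> f * a)) \<longleftrightarrow>
    periodic_rep \<sigma> \<iota> \<delta> y t a \<in> periodic_rep \<sigma> \<iota> \<delta> y t ` \<iota> ` CX"
proof (rule commute_iff_image[OF periodic_rep(1)[OF y t] periodic_rep(2)[OF y t]])
  let ?I = "{0..<int (least_period \<sigma> y)}" and ?z = "\<lambda>i. iter_int \<sigma> i y"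
  show inj: "inj_on ?z ?I" by (rule least_period_inj[OF y])
  let ?d = "\<lambda>i. coord (periodic_rep \<sigma> \<iota> \<delta> y t a (ell2_basis i)) i"
  obtain f where "f \<in> CX" "\<forall>x\<in>?z ` ?I. f x = ?d (the_inv_into ?I ?z x)"
    using CX_interpolation[of "?z ` ?I" "\<lambda>x. ?d (the_inv_into ?I ?z x)"] by auto
  then show "\<exists>f\<in>CX. \<forall>i\<in>?I. f (?z i) = ?d i"
    using the_inv_into_f_f[OF inj] by (intro bexI[of _ f]) auto
qed

end

theorem proposition3p2:
  fixes \<sigma> :: "'x::t2_space \<Rightarrow> 'x"
    and \<iota> :: "('x \<Rightarrow> complex) \<Rightarrow> 'a::unital_cstar_algebra"
    and \<delta> :: 'a
    and \<pi> :: "'a \<Rightarrow> 'h::complex_hilbert_space \<Rightarrow> 'h"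
    and xs :: "'x set"
    and yts :: "('x \<times> complex) set"
  assumes "crossed_product \<sigma> \<iota> \<delta>"
    and "hilbert_rep UNIV \<pi>"
    and "\<forall>x\<in>xs. \<not> periodic \<sigma> x"
    and "\<forall>(y, t)\<in>yts. periodic \<sigma> y \<and> cmod t = 1"
    and "rep_kernel \<pi> = (\<Inter>x\<in>xs. rep_kernel (aperiodic_rep \<sigma> \<iota> \<delta> x))
                      \<inter> (\<Inter>(y, t)\<in>yts. rep_kernel (periodic_rep \<sigma> \<iota> \<delta> y t))"
  shows "(CX_commutant \<iota> = {a. \<forall>n. supp (fourier \<iota> \<delta> a n) \<subseteq> Per \<sigma> n}
          \<and> (CX_commutant \<iota> = \<iota> ` CX \<longleftrightarrow> topologically_free \<sigma>))
       \<and> rep_commutant \<iota> \<pi> =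
          {\<pi> a | a. (\<forall>x\<in>xs. aperiodic_rep \<sigma> \<iota> \<delta> x a \<in> aperiodic_rep \<sigma> \<iota> \<delta> x ` \<iota> ` CX)
                  \<and> (\<forall>(y, t)\<in>yts. periodic_rep \<sigma> \<iota> \<delta> y t a \<in> periodic_rep \<sigma> \<iota> \<delta> y t ` \<iota> ` CX)}"
proof -
  interpret crossed_prod \<sigma> \<iota> \<delta> by unfold_locales (rule assms(1))
  interpret Pi: hilbert_representation UNIV \<pi> by unfold_locales (rule assms(2))
  have ap: "aperiodic_rep \<sigma> \<iota> \<delta> x b = aperiodic_rep \<sigma> \<iota> \<delta> x c \<longleftrightarrow>
      b - c \<in> rep_kernel (aperiodic_rep \<sigma> \<iota> \<delta> x)" for x b c
    by (rule hilbert_representation.eq_iff_diff_in_kernel[where H = UNIV])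
      (unfold_locales, rule aperiodic_rep)
  have pe: "periodic_rep \<sigma> \<iota> \<delta> y t b = periodic_rep \<sigma> \<iota> \<delta> y t c \<longleftrightarrow>
      b - c \<in> rep_kernel (periodic_rep \<sigma> \<iota> \<delta> y t)" if "(y, t) \<in> yts" for y t b c
    by (rule hilbert_representation.eq_iff_diff_in_kernel[where H = "coord_subspace {0..<int (least_period \<sigma> y)}"],
        unfold_locales, rule periodic_rep) (use that assms(4) in auto)
  have "\<pi> b = \<pi> c \<longleftrightarrow> (\<forall>x\<in>xs. aperiodic_rep \<sigma> \<iota> \<delta> x b = aperiodic_rep \<sigma> \<iota> \<delta> x c)
      \<and> (\<forall>(y, t)\<in>yts. periodic_rep \<sigma> \<iota> \<delta> y t b = periodic_rep \<sigma> \<iota> \<delta> y t c)" for b c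
    unfolding Pi.eq_iff_diff_in_kernel assms(5) using ap pe by auto
  then have "(\<forall>f\<in>CX. \<pi> (a * \<iota> f) = \<pi> (\<iota> f * a)) \<longleftrightarrow>
      (\<forall>x\<in>xs. \<forall>f\<in>CX. aperiodic_rep \<sigma> \<iota> \<delta> x (a * \<iota> f) = aperiodic_rep \<sigma> \<iota> \<delta> x (\<iota> f * a))
      \<and> (\<forall>(y, t)\<in>yts. \<forall>f\<in>CX. periodic_rep \<sigma> \<iota> \<delta> y t (a * \<iota> f) = periodic_rep \<sigma> \<iota> \<delta> y t (\<iota> f * a))" for a
    by blast
  moreover have "(\<forall>x\<in>xs. \<forall>f\<in>CX. aperiodic_rep \<sigma> \<iota> \<delta> x (a * \<iota> f) = aperiodic_rep \<sigma> \<iota> \<delta> x (\<iota> f * a)) \<longleftrightarrow>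
      (\<forall>x\<in>xs. aperiodic_rep \<sigma> \<iota> \<delta> x a \<in> aperiodic_rep \<sigma> \<iota> \<delta> x ` \<iota> ` CX)" for a
    using assms(3) by (intro ball_cong refl aperiodic_commute_iff) blast
  moreover have "(\<forall>(y, t)\<in>yts. \<forall>f\<in>CX. periodic_rep \<sigma> \<iota> \<delta> y t (a * \<iota> f) = periodic_rep \<sigma> \<iota> \<delta> y t (\<iota> f * a)) \<longleftrightarrow>
      (\<forall>(y, t)\<in>yts. periodic_rep \<sigma> \<iota> \<delta> y t a \<in> periodic_rep \<sigma> \<iota> \<delta> y t ` \<iota> ` CX)" for a
  proof (intro ball_cong refl)
    fix yt assume "yt \<in> yts"
    moreover obtain y t where "yt = (y, t)" by (rule prod.exhaust)
    ultimately show "(case yt of (y, t) \<Rightarrow> \<forall>f\<in>CX. periodic_rep \<sigma> \<iota> \<delta> y t (a * \<iota> f) = periodic_rep \<sigma> \<iota> \<delta> y t (\<iota> f * a))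
      \<longleftrightarrow> (case yt of (y, t) \<Rightarrow> periodic_rep \<sigma> \<iota> \<delta> y t a \<in> periodic_rep \<sigma> \<iota> \<delta> y t ` \<iota> ` CX)"
      using assms(4) periodic_commute_iff[of y t a] by auto
  qed
  ultimately have "rep_commutant \<iota> \<pi> =
      {\<pi> a | a. (\<forall>x\<in>xs. aperiodic_rep \<sigma> \<iota> \<delta> x a \<in> aperiodic_rep \<sigma> \<iota> \<delta> x ` \<iota> ` CX)
              \<and> (\<forall>(y, t)\<in>yts. periodic_rep \<sigma> \<iota> \<delta> y t a \<in> periodic_rep \<sigma> \<iota> \<delta> y t ` \<iota> ` CX)}"
    unfolding rep_commutant_def by simp
  moreover have "CX_commutant \<iota> = {a. \<forall>n. supp (fourier \<iota> \<delta> a n) \<subseteq> Per \<sigma> n}"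
    using commutant_iff by blast
  ultimately show ?thesis using commutant_eq_CX_iff by blast
qed

end
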